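(* Let $\mathcal B$ be the complete local ring of an isolated singularity over $\mathbb F=\mathbb F_q$ (with no further restriction), and let $\mathcal R\subset\mathcal O=\mathbb F_q[[z]]$ be a Gorenstein ring presented as a quotient of $\mathcal B$, such that the localization (fraction field) of $\mathcal R$ is $\mathbb F_q((z))$. Let $\delta=\dim_{\mathbb F_q}\mathcal O/\mathcal R$, let $n\ge1$ be arbitrary, and let $\mathscr C\subset\mathcal B^n$ be the lift (full preimage) of $\mathfrak c^{n}\subset\mathcal R^n$, where $\mathfrak c$ is the conductor of $\mathcal R$ in $\mathcal O$. Then $$\mathcal H^{mot}_{\mathcal R}(q,t;n)=q^{\delta n^2}\,t^{\delta n}\,\mathscr H^{inst}_{\mathscr C}\bigl(q,1/(tq^{n});n\bigr).$$
   Context: $\mathcal R$ has residue field $\mathbb F_q$. The conductor $\mathfrak c$ is the largest ideal of $\mathcal O$ contained in $\mathcal R$ (it equals $z^{2\delta}\mathcal O$ for Gorenstein $\mathcal R$). An $\mathcal R$-submodule $M\subset\mathcal O^n$ is standard if $\mathcal OM=\mathcal O^n$. Then $$\mathcal H^{mot}_{\mathcal R}(q,t;n)=\sum_{M\ \text{standard}}t^{\dim_{\mathbb F_q}(\mathcal O^n/M)},\qquad \mathscr H^{inst}_{\mathscr C}(q,t;n)=\sum_{\mathscr C\subset\mathcal M\subset\mathcal B^n}t^{\dim_{\mathbb F_q}(\mathcal B^n/\mathcal M)},$$ where the second sum is over $\mathcal B$-submodules $\mathcal M$ of $\mathcal B^n$ containing $\mathscr C$. Both sums are finite. *)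

theory Defs
  imports
    "HOL-Library.Extended_Nat"
    "HOL-Library.Cardinality"
    "HOL-Computational_Algebra.Formal_Laurent_Series"
    "HOL-Algebra.Algebra"
    "HOL-Algebra.Algebraic_Closure_Type"
begin

section \<open>Modules\<close>

text \<open>
  The record of modules extends that of rings, so the fields for a multiplication and its unit
  must be filled in below; they play no role in the theory of modules.
\<close>

definition self_module :: "('a, 'm) ring_scheme \<Rightarrow> ('a, 'a) module" where
  "self_module A =
     \<lparr>carrier = carrier A, monoid.mult = monoid.mult A, one = monoid.one A, ring.zero = ring.zero A,
      add = add A, module.smult = monoid.mult A\<rparr>"

definition free_module :: "('a, 'm) ring_scheme \<Rightarrow> nat \<Rightarrow> ('a, nat \<Rightarrow> 'a) module" where
  "free_module A n =
     \<lparr>carrier = {..<n} \<rightarrow>\<^sub>E carrier A,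
      monoid.mult = (\<lambda>u v. \<lambda>i\<in>{..<n}. u i \<otimes>\<^bsub>A\<^esub> v i),
      one = (\<lambda>i\<in>{..<n}. \<one>\<^bsub>A\<^esub>),
      ring.zero = (\<lambda>i\<in>{..<n}. \<zero>\<^bsub>A\<^esub>),
      add = (\<lambda>u v. \<lambda>i\<in>{..<n}. u i \<oplus>\<^bsub>A\<^esub> v i),
      module.smult = (\<lambda>a v. \<lambda>i\<in>{..<n}. a \<otimes>\<^bsub>A\<^esub> v i)\<rparr>"

definition restrict_scalars :: "('k \<Rightarrow> 'a) \<Rightarrow> ('a, 'v) module \<Rightarrow> ('k, 'v) module" where
  "restrict_scalars \<iota> V =
     \<lparr>carrier = carrier V, monoid.mult = monoid.mult V, one = monoid.one V, ring.zero = ring.zero V,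
      add = add V, module.smult = (\<lambda>c v. \<iota> c \<odot>\<^bsub>V\<^esub> v)\<rparr>"

definition quotient_module :: "('k, 'v) module \<Rightarrow> 'v set \<Rightarrow> ('k, 'v set) module" where
  "quotient_module V W =
     \<lparr>carrier = a_rcosets\<^bsub>V\<^esub> W, monoid.mult = set_add V, one = W,
      ring.zero = W, add = set_add V, module.smult = (\<lambda>c U. W <+>\<^bsub>V\<^esub> ((\<lambda>x. c \<odot>\<^bsub>V\<^esub> x) ` U))\<rparr>"

definition generated_submodule :: "('a, 'm) ring_scheme \<Rightarrow> ('a, 'v) module \<Rightarrow> 'v set \<Rightarrow> 'v set" where
  "generated_submodule A V S = \<Inter>{N. submodule N A V \<and> S \<subseteq> N}"

definition module_hom :: "('a, 'm) ring_scheme \<Rightarrow> ('a, 'v) module \<Rightarrow> ('a, 'w) module \<Rightarrow> ('v \<Rightarrow> 'w) set" where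
  "module_hom A V W =
     {f. f \<in> carrier V \<rightarrow> carrier W \<and>
         (\<forall>x\<in>carrier V. \<forall>y\<in>carrier V. f (x \<oplus>\<^bsub>V\<^esub> y) = f x \<oplus>\<^bsub>W\<^esub> f y) \<and>
         (\<forall>a\<in>carrier A. \<forall>x\<in>carrier V. f (a \<odot>\<^bsub>V\<^esub> x) = a \<odot>\<^bsub>W\<^esub> f x)}"

definition is_finite_basis :: "('k, 'm) ring_scheme \<Rightarrow> ('k, 'v) module \<Rightarrow> 'v set \<Rightarrow> bool" where
  "is_finite_basis K V b \<longleftrightarrow>
     finite b \<and> b \<subseteq> carrier V \<and>
     (\<forall>v\<in>carrier V. \<exists>!c. c \<in> b \<rightarrow>\<^sub>E carrier K \<and> v = (\<Oplus>\<^bsub>V\<^esub>x\<in>b. c x \<odot>\<^bsub>V\<^esub> x))"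

text \<open>Meaningful for finite-dimensional spaces only.\<close>

definition vdim :: "('k, 'm) ring_scheme \<Rightarrow> ('k, 'v) module \<Rightarrow> nat" where
  "vdim K V = (THE d. \<exists>b. is_finite_basis K V b \<and> card b = d)"

text \<open>
  \<open>\<iota>\<close> is the structure map of an algebra over the field \<open>'f\<close>, \<open>V\<close> a module over that algebra;
  \<open>codim \<iota> V W\<close> is the dimension over \<open>'f\<close> of \<open>V / W\<close>.
\<close>

definition codim :: "('f::field \<Rightarrow> 'a) \<Rightarrow> ('a, 'v) module \<Rightarrow> 'v set \<Rightarrow> nat" where
  "codim \<iota> V W =
     vdim (ring_of_type_algebra :: 'f ring) (quotient_module (restrict_scalars \<iota> V) W)"


section \<open>Gorenstein local rings\<close>

definition local_ring :: "('a, 'm) ring_scheme \<Rightarrow> bool" where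
  "local_ring A \<longleftrightarrow> cring A \<and> (\<exists>!m. maximalideal m A)"

definition max_ideal :: "('a, 'm) ring_scheme \<Rightarrow> 'a set" where
  "max_ideal A = (THE m. maximalideal m A)"

text \<open>
  The lifting property is tested on modules carried by the type \<open>'a\<close> of ring elements. By Baer's
  criterion this is no restriction, since these modules include the ring and all its ideals.
\<close>

definition injective_module :: "('a, 'm) ring_scheme \<Rightarrow> ('a, 'e) module \<Rightarrow> bool" where
  "injective_module A E \<longleftrightarrow>
     Module.module A E \<and>
     (\<forall>(N :: ('a, 'a) module) (P :: ('a, 'a) module) i f.
        Module.module A N \<and> Module.module A P \<and>
        i \<in> module_hom A N P \<and> inj_on i (carrier N) \<and> f \<in> module_hom A N E \<longrightarrow>
        (\<exists>g\<in>module_hom A P E. \<forall>x\<in>carrier N. g (i x) = f x))"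

definition injective_resolution ::
    "('a, 'm) ring_scheme \<Rightarrow> ('a, 'v) module \<Rightarrow> (nat \<Rightarrow> ('a, 'e) module) \<Rightarrow> ('v \<Rightarrow> 'e) \<Rightarrow>
     (nat \<Rightarrow> 'e \<Rightarrow> 'e) \<Rightarrow> bool" where
  "injective_resolution A M E \<epsilon> d \<longleftrightarrow>
     (\<forall>i. injective_module A (E i)) \<and>
     \<epsilon> \<in> module_hom A M (E 0) \<and> inj_on \<epsilon> (carrier M) \<and>
     (\<forall>i. d i \<in> module_hom A (E i) (E (Suc i))) \<and>
     {x \<in> carrier (E 0). d 0 x = \<zero>\<^bsub>E 1\<^esub>} = \<epsilon> ` carrier M \<and>
     (\<forall>i. {x \<in> carrier (E (Suc i)). d (Suc i) x = \<zero>\<^bsub>E (Suc (Suc i))\<^esub>} = d i ` carrier (E i))"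

text \<open>
  The injective modules may be taken on the type \<open>'a set\<close>: if \<open>'a\<close> is infinite, a module with at
  most as many elements as \<open>'a set\<close> has an injective hull which is again that small.
\<close>

definition finite_injective_dimension :: "('a, 'm) ring_scheme \<Rightarrow> ('a, 'a) module \<Rightarrow> bool" where
  "finite_injective_dimension A M \<longleftrightarrow>
     (\<exists>(E :: nat \<Rightarrow> ('a, 'a set) module) \<epsilon> d k.
        injective_resolution A M E \<epsilon> d \<and> (\<forall>i>k. carrier (E i) = {\<zero>\<^bsub>E i\<^esub>}))"

definition gorenstein_local_ring :: "('a, 'm) ring_scheme \<Rightarrow> bool" where
  "gorenstein_local_ring A \<longleftrightarrow>
     local_ring A \<and> noetherian_ring A \<and> finite_injective_dimension A (self_module A)"


section \<open>Complete local rings of isolated singularities\<close>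

fun ideal_power :: "('a, 'm) ring_scheme \<Rightarrow> 'a set \<Rightarrow> nat \<Rightarrow> 'a set" where
  "ideal_power A I 0 = carrier A"
| "ideal_power A I (Suc k) = ideal_prod A (ideal_power A I k) I"

definition adically_complete :: "('a, 'm) ring_scheme \<Rightarrow> 'a set \<Rightarrow> bool" where
  "adically_complete A I \<longleftrightarrow>
     (\<Inter>k. ideal_power A I k) = {\<zero>\<^bsub>A\<^esub>} \<and>
     (\<forall>s. (\<forall>k. s k \<in> carrier A \<and> s (Suc k) \<ominus>\<^bsub>A\<^esub> s k \<in> ideal_power A I k) \<longrightarrow>
          (\<exists>l\<in>carrier A. \<forall>k. s k \<ominus>\<^bsub>A\<^esub> l \<in> ideal_power A I k))"

definition krull_dim :: "('a, 'm) ring_scheme \<Rightarrow> enat" where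
  "krull_dim A =
     Sup {enat k | k. \<exists>p. (\<forall>i\<le>k. primeideal (p i) A) \<and> (\<forall>i<k. p i \<subset> p (Suc i))}"

definition regular_local_ring :: "('a, 'm) ring_scheme \<Rightarrow> bool" where
  "regular_local_ring A \<longleftrightarrow>
     local_ring A \<and> noetherian_ring A \<and>
     (\<exists>S\<subseteq>carrier A. finite S \<and> genideal A S = max_ideal A \<and> enat (card S) = krull_dim A)"

definition fraction :: "('a, 'm) ring_scheme \<Rightarrow> 'a set \<Rightarrow> 'a \<Rightarrow> 'a \<Rightarrow> ('a \<times> 'a) set" where
  "fraction A S a s =
     {(b, t). b \<in> carrier A \<and> t \<in> S \<and> (\<exists>u\<in>S. u \<otimes>\<^bsub>A\<^esub> (t \<otimes>\<^bsub>A\<^esub> a) = u \<otimes>\<^bsub>A\<^esub> (s \<otimes>\<^bsub>A\<^esub> b))}"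

text \<open>
  The ring of fractions with denominators in \<open>S\<close>. In the unions below all members are the same
  equivalence class.
\<close>

definition ring_of_fractions :: "('a, 'm) ring_scheme \<Rightarrow> 'a set \<Rightarrow> ('a \<times> 'a) set ring" where
  "ring_of_fractions A S =
     \<lparr>carrier = {fraction A S a s | a s. a \<in> carrier A \<and> s \<in> S},
      monoid.mult = (\<lambda>U V. \<Union>(a, s)\<in>U. \<Union>(b, t)\<in>V. fraction A S (a \<otimes>\<^bsub>A\<^esub> b) (s \<otimes>\<^bsub>A\<^esub> t)),
      one = fraction A S \<one>\<^bsub>A\<^esub> \<one>\<^bsub>A\<^esub>,
      ring.zero = fraction A S \<zero>\<^bsub>A\<^esub> \<one>\<^bsub>A\<^esub>,
      add = (\<lambda>U V. \<Union>(a, s)\<in>U. \<Union>(b, t)\<in>V.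
               fraction A S (t \<otimes>\<^bsub>A\<^esub> a \<oplus>\<^bsub>A\<^esub> s \<otimes>\<^bsub>A\<^esub> b) (s \<otimes>\<^bsub>A\<^esub> t))\<rparr>"

definition complete_local_algebra :: "('f::field \<Rightarrow> 'b) \<Rightarrow> 'b ring \<Rightarrow> bool" where
  "complete_local_algebra \<iota> B \<longleftrightarrow>
     local_ring B \<and> noetherian_ring B \<and> adically_complete B (max_ideal B) \<and>
     \<iota> \<in> ring_hom (ring_of_type_algebra :: 'f ring) B \<and>
     bij_betw (\<lambda>c. max_ideal B +>\<^bsub>B\<^esub> \<iota> c) UNIV (carrier (B Quot max_ideal B))"

text \<open>
  Complete local rings of (at most) isolated singularities at a rational point: the spectrum is
  regular away from the closed point. As usual, the closed point itself may be regular, as for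
  a ring of formal power series.
\<close>

definition isolated_singularity_ring :: "('f::field \<Rightarrow> 'b) \<Rightarrow> 'b ring \<Rightarrow> bool" where
  "isolated_singularity_ring \<iota> B \<longleftrightarrow>
     complete_local_algebra \<iota> B \<and>
     (\<forall>p. primeideal p B \<and> p \<noteq> max_ideal B \<longrightarrow>
          regular_local_ring (ring_of_fractions B (carrier B - p)))"


section \<open>Subrings of the ring of power series and the two generating functions\<close>

abbreviation \<O> :: "'f::field fps ring" where
  "\<O> \<equiv> ring_of_type_algebra"

abbreviation power_series_subring :: "'f::field fps set \<Rightarrow> 'f fps ring" where
  "power_series_subring R \<equiv> \<O>\<lparr>carrier := R\<rparr>"

definition has_fraction_field_laurent :: "'f::field fps set \<Rightarrow> bool" where
  "has_fraction_field_laurent R \<longleftrightarrow>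
     (\<forall>h :: 'f fls. \<exists>a\<in>R. \<exists>b\<in>R. b \<noteq> 0 \<and> h = fps_to_fls a / fps_to_fls b)"

definition delta_invariant :: "'f::field fps set \<Rightarrow> nat" where
  "delta_invariant R = codim fps_const (self_module \<O>) R"

definition conductor :: "'f::field fps set \<Rightarrow> 'f fps set" where
  "conductor R = (GREATEST I. ideal I \<O> \<and> I \<subseteq> R)"

definition conductor_lift :: "'b ring \<Rightarrow> ('b \<Rightarrow> 'f::field fps) \<Rightarrow> 'f fps set \<Rightarrow> nat \<Rightarrow> (nat \<Rightarrow> 'b) set" where
  "conductor_lift B \<pi> R n = {v \<in> carrier (free_module B n). \<forall>i<n. \<pi> (v i) \<in> conductor R}"

definition standard_submodules :: "'f::field fps set \<Rightarrow> nat \<Rightarrow> (nat \<Rightarrow> 'f fps) set set" where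
  "standard_submodules R n =
     {M. submodule M (power_series_subring R) (free_module \<O> n) \<and>
         generated_submodule \<O> (free_module \<O> n) M = carrier (free_module \<O> n)}"

definition submodules_above :: "'b ring \<Rightarrow> nat \<Rightarrow> (nat \<Rightarrow> 'b) set \<Rightarrow> (nat \<Rightarrow> 'b) set set" where
  "submodules_above B n C = {M. submodule M B (free_module B n) \<and> C \<subseteq> M}"

definition H_mot :: "'f::field fps set \<Rightarrow> nat \<Rightarrow> 'k::field \<Rightarrow> 'k" where
  "H_mot R n t = (\<Sum>M\<in>standard_submodules R n. t ^ codim fps_const (free_module \<O> n) M)"

definition H_inst :: "('f::field \<Rightarrow> 'b) \<Rightarrow> 'b ring \<Rightarrow> (nat \<Rightarrow> 'b) set \<Rightarrow> nat \<Rightarrow> 'k::field \<Rightarrow> 'k" where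
  "H_inst \<iota> B C n t = (\<Sum>M\<in>submodules_above B n C. t ^ codim \<iota> (free_module B n) M)"

text \<open>
  The variable \<open>t\<close> ranges over the nonzero elements of an arbitrary field of characteristic zero.
  With the field of rational functions over the rationals and its generator, this includes the
  identity of formal expressions in \<open>t\<close>.
\<close>

end

theory Submission
  imports Defs "HOL-Library.Function_Algebras" "HOL-Library.Product_Plus"
begin

text \<open>
  Completeness of \<open>\<B>\<close> and \<open>Frac R = F((z))\<close> give \<open>z\<^sup>N \<O> \<subseteq> R\<close> for some \<open>N\<close>, so that all indices can
  be computed modulo a power of \<open>z\<close>. Pushing Baer's criterion down a finite injective
  resolution of \<open>R\<close> shows that the cokernel of its first map is injective; comparing the lengths of
  \<open>R / z\<^sup>N R\<close> and of its dual then shows that \<open>\<O> / R\<close> has a socle of dimension at most one. Hence there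
  is a linear functional \<open>\<theta>\<close> on \<open>\<O>\<close> for which \<open>R\<close> is its own orthogonal complement, and the pairing
  \<open>\<theta> (\<Sum> f\<^sub>i g\<^sub>i)\<close> matches the modules between \<open>\<cc>\<^sup>n\<close> and \<open>R\<^sup>n\<close> with those between \<open>R\<^sup>n\<close> and \<open>\<O>\<^sup>n\<close>, with
  complementary codimensions. Finally, every standard \<open>M\<close> contains columns of matrices \<open>g\<close>
  congruent to the identity modulo \<open>z\<close>, that is, \<open>M = g L\<close> with \<open>R\<^sup>n \<subseteq> L\<close>. Modulo \<open>z\<^sup>N\<close> the proportion
  of the matrices with columns in \<open>M\<close> is \<open>q\<close> to the power \<open>- n dim (\<O>\<^sup>n / M)\<close>, so counting the pairs
  \<open>(M, g)\<close> in two ways gives \<open>\<Sum>\<^sub>M t\<^bsup>dim (\<O>\<^sup>n / M)\<^esup> = \<Sum>\<^sub>L (t q\<^sup>n)\<^bsup>dim (\<O>\<^sup>n / L)\<^esup>\<close>.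
\<close>

section \<open>Finite additive groups\<close>

text \<open>The Gorenstein property is given by an injective resolution, whereas the counting needs
  a self-dual pairing. The descent along the resolution works because every kernel after R is the
  image of an injective module and hence divisible by z^N; R itself is not divisible, so the descent
  stops at injective dimension one. Consequently each composition factor of R / J enlarges (R : J) /
  R by one and the same factor, the size of (R : m) / R, where m is the maximal ideal. For J = z^N R
  the module (R : J) / R is isomorphic to R / J, which forces this factor to be q. Fractional ideals
  are multiplied by z^N throughout, so that everything stays inside R. In the final formula, the
  inverted variable and the prefactor (t q^n)^(\<delta> n) both come from the duality, which
  replaces a codimension e by \<delta> n - e.\<close>

definition add_closed :: "'a::ab_group_add set \<Rightarrow> bool" where
  "add_closed A \<longleftrightarrow> 0 \<in> A \<and> (\<forall>a\<in>A. \<forall>b\<in>A. a - b \<in> A)"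

definition additive_on :: "'a::ab_group_add set \<Rightarrow> ('a \<Rightarrow> 'b::ab_group_add) \<Rightarrow> bool" where
  "additive_on A \<phi> \<longleftrightarrow> (\<forall>a\<in>A. \<forall>b\<in>A. \<phi> (a - b) = \<phi> a - \<phi> b)"

lemma add_closed_zero: "add_closed A \<Longrightarrow> 0 \<in> A"
  by (simp add: add_closed_def)

lemma add_closed_diff: "add_closed A \<Longrightarrow> a \<in> A \<Longrightarrow> b \<in> A \<Longrightarrow> a - b \<in> A"
  by (simp add: add_closed_def)

lemma add_closed_uminus: "add_closed A \<Longrightarrow> a \<in> A \<Longrightarrow> - a \<in> A"
  using add_closed_diff[of A 0 a] by (simp add: add_closed_zero)

lemma add_closed_add: "add_closed A \<Longrightarrow> a \<in> A \<Longrightarrow> b \<in> A \<Longrightarrow> a + b \<in> A"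
  using add_closed_diff[of A a "- b"] by (simp add: add_closed_uminus)

lemma add_closed_sum: "add_closed A \<Longrightarrow> (\<And>i. i \<in> I \<Longrightarrow> f i \<in> A) \<Longrightarrow> sum f I \<in> A"
  by (induction I rule: infinite_finite_induct) (auto simp: add_closed_zero add_closed_add)

lemma additive_on_zero: "add_closed A \<Longrightarrow> additive_on A \<phi> \<Longrightarrow> \<phi> 0 = 0"
  unfolding add_closed_def additive_on_def by (metis diff_self)

lemma add_closed_image:
  assumes "add_closed A" "additive_on A \<phi>"
  shows "add_closed (\<phi> ` A)"
proof -
  have "\<phi> a - \<phi> b \<in> \<phi> ` A" if "a \<in> A" "b \<in> A" for a b
    using that assms unfolding add_closed_def additive_on_def by (metis image_eqI)
  then show ?thesis
    using assms additive_on_zero[OF assms] unfolding add_closed_def by (auto intro: rev_image_eqI)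
qed

lemma card_fibre:
  assumes "add_closed A" "additive_on A \<phi>" "a \<in> A"
  shows "card {x \<in> A. \<phi> x = \<phi> a} = card {x \<in> A. \<phi> x = 0}"
proof -
  have "bij_betw (\<lambda>k. a - k) {x \<in> A. \<phi> x = 0} {x \<in> A. \<phi> x = \<phi> a}"
    by (rule bij_betw_byWitness[where f' = "\<lambda>k. a - k"])
      (use assms in \<open>auto simp: add_closed_def additive_on_def\<close>)
  then show ?thesis by (simp add: bij_betw_same_card)
qed

lemma card_additive:
  assumes "finite A" "add_closed A" "additive_on A \<phi>"
  shows "card A = card (\<phi> ` A) * card {x \<in> A. \<phi> x = 0}"
proof -
  have "card A = (\<Sum>x\<in>A. 1)" by simp
  also have "\<dots> = (\<Sum>y\<in>\<phi> ` A. \<Sum>x\<in>{x \<in> A. \<phi> x = y}. 1)"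
    using assms(1) by (rule sum.image_gen)
  also have "\<dots> = (\<Sum>y\<in>\<phi> ` A. card {x \<in> A. \<phi> x = 0})"
    by (rule sum.cong) (auto simp: card_fibre[OF assms(2,3)])
  finally show ?thesis by simp
qed

text \<open>As \<open>A\<close> contains the kernel of \<open>\<tau>\<close> on \<open>B\<close>, it
  is recovered from its image. Together with the cardinality version below, this turns equalities
  between infinite modules into counts of truncations.\<close>

lemma eq_of_image_eq:
  assumes "A \<subseteq> B" "add_closed A" "add_closed B" "additive_on B \<tau>" "\<And>b. b \<in> B \<Longrightarrow> \<tau> b = 0 \<Longrightarrow> b \<in> A"
    and "\<tau> ` B \<subseteq> \<tau> ` A"
  shows "A = B"
proof
  show "B \<subseteq> A"
  proof
    fix b assume b: "b \<in> B"
    then obtain a where a: "a \<in> A" "\<tau> b = \<tau> a" using assms(6) by blast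
    then have "\<tau> (b - a) = 0" using assms b unfolding additive_on_def by auto
    then have "b - a \<in> A" using assms(1,3,5) a b by (simp add: add_closed_diff subsetD)
    then have "b - a + a \<in> A" using assms(2) a(1) add_closed_add by blast
    then show "b \<in> A" by simp
  qed
qed (fact assms(1))

lemma eq_of_card_image_eq:
  assumes "A \<subseteq> B" "add_closed A" "add_closed B" "additive_on B \<tau>" "\<And>b. b \<in> B \<Longrightarrow> \<tau> b = 0 \<Longrightarrow> b \<in> A"
    and "finite (\<tau> ` B)" "card (\<tau> ` A) = card (\<tau> ` B)"
  shows "A = B"
  using assms(1-5)
proof (rule eq_of_image_eq)
  show "\<tau> ` B \<subseteq> \<tau> ` A"
    using card_subset_eq[OF assms(6) _ assms(7)] assms(1) by (metis equalityE image_mono)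
qed


section \<open>Large subrings of the ring of power series\<close>

lemma additive_on_fps_cutoff: "additive_on A (fps_cutoff M)"
  by (simp add: additive_on_def fps_cutoff_diff)

lemma fps_cutoff_eq_0: "fps_cutoff M f = 0 \<longleftrightarrow> (\<forall>k<M. f $ k = 0)"
  by (auto simp: fps_eq_iff)

lemma fps_cutoff_idem [simp]: "fps_cutoff M (fps_cutoff M f) = fps_cutoff M f"
  by (simp add: fps_eq_iff)

lemma fps_cutoff_mult_cutoff: "fps_cutoff M (f * fps_cutoff M g) = fps_cutoff M (f * g)"
  by (simp add: fps_eq_iff fps_cutoff_right_mult_nth)

lemma finite_fps_cutoff: "finite (fps_cutoff M ` (A :: 'f::{field,finite} fps set))"
proof (rule finite_subset)
  show "fps_cutoff M ` A \<subseteq> (\<lambda>h. Abs_fps (\<lambda>i. if i < M then h i else 0)) ` ({..<M} \<rightarrow>\<^sub>E UNIV)"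
  proof
    fix g assume "g \<in> fps_cutoff M ` A"
    then obtain f where "g = fps_cutoff M f" by blast
    then have "g = Abs_fps (\<lambda>i. if i < M then (restrict (fps_nth f) {..<M}) i else 0)"
      by (simp add: fps_eq_iff)
    then show "g \<in> (\<lambda>h. Abs_fps (\<lambda>i. if i < M then h i else 0)) ` ({..<M} \<rightarrow>\<^sub>E UNIV)"
      by (rule image_eqI[where x = "restrict (fps_nth f) {..<M}"]) (simp add: restrict_PiE_iff)
  qed
qed (auto intro!: finite_PiE)

text \<open>\<open>N\<close> is any bound with z^N \<O> \<subseteq> R, not necessarily the exponent
  of the conductor. Its positivity puts z^N into the maximal ideal.\<close>

locale large_subring =
  fixes R :: "'f::{field,finite} fps set" and N :: nat
  assumes R_one: "1 \<in> R"
    and R_diff: "a \<in> R \<Longrightarrow> b \<in> R \<Longrightarrow> a - b \<in> R"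
    and R_mult: "a \<in> R \<Longrightarrow> b \<in> R \<Longrightarrow> a * b \<in> R"
    and R_const: "fps_const c \<in> R"
    and N_pos: "N \<ge> 1"
    and R_large: "(\<And>k. k < N \<Longrightarrow> f $ k = 0) \<Longrightarrow> f \<in> R"
begin

definition submod :: "'f fps set \<Rightarrow> bool" where
  "submod A \<longleftrightarrow> add_closed A \<and> (\<forall>r\<in>R. \<forall>a\<in>A. r * a \<in> A)"

definition mm :: "'f fps set" where
  "mm = {r \<in> R. r $ 0 = 0}"

lemma R_zero: "0 \<in> R"
  using R_diff[OF R_one R_one] by simp

lemma R_add: "a \<in> R \<Longrightarrow> b \<in> R \<Longrightarrow> a + b \<in> R"
  using R_diff[of a "0 - b"] R_diff[OF R_zero, of b] by simp

lemma R_uminus: "a \<in> R \<Longrightarrow> - a \<in> R"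
  using R_diff[OF R_zero, of a] by simp

lemma R_power: "a \<in> R \<Longrightarrow> a ^ k \<in> R"
  by (induction k) (auto simp: R_one R_mult)

lemma R_sum: "(\<And>i. i \<in> I \<Longrightarrow> f i \<in> R) \<Longrightarrow> sum f I \<in> R"
  by (induction I rule: infinite_finite_induct) (auto simp: R_zero R_add)

lemma submod_R: "submod R"
  by (simp add: submod_def add_closed_def R_zero R_diff R_mult)

lemma submodD:
  assumes "submod A"
  shows "add_closed A" "0 \<in> A" "a \<in> A \<Longrightarrow> b \<in> A \<Longrightarrow> a - b \<in> A" "a \<in> A \<Longrightarrow> b \<in> A \<Longrightarrow> a + b \<in> A"
    "a \<in> A \<Longrightarrow> - a \<in> A" "r \<in> R \<Longrightarrow> a \<in> A \<Longrightarrow> r * a \<in> A"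
  using assms by (auto simp: submod_def add_closed_zero add_closed_diff add_closed_add add_closed_uminus)

lemma mm_R: "a \<in> mm \<Longrightarrow> a \<in> R"
  by (simp add: mm_def)

lemma submod_mm: "submod mm"
  unfolding submod_def mm_def add_closed_def by (auto simp: R_zero R_diff R_mult)

text \<open>A finite geometric series suffices: after scaling, r = 1 - s with s of positive order,
  and the remainder s^N / (1 - s) has order at least N, so it lies in R. Thus \<open>mm\<close> is
  the set of nonunits of R.\<close>

lemma R_inverse:
  assumes "r \<in> R" "r $ 0 \<noteq> 0"
  shows "inverse r \<in> R"
proof -
  define c where "c = fps_const (inverse (r $ 0))"
  define s where "s = 1 - c * r"
  have c: "c \<in> R" by (simp add: c_def R_const)
  have s: "s \<in> R" "s $ 0 = 0"
    using assms c by (simp_all add: s_def R_diff R_one R_mult) (simp add: c_def)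
  define h where "h = inverse (1 - s)"
  have h: "h * (1 - s) = 1" unfolding h_def using s(2) by (intro inverse_mult_eq_1) auto
  have "(1 - s) * (\<Sum>i<N. s ^ i) = 1 - s ^ N"
    by (simp add: one_diff_power_eq)
  then have "h * ((1 - s) * (\<Sum>i<N. s ^ i)) = h * (1 - s ^ N)" by simp
  then have "h * (1 - s) * (\<Sum>i<N. s ^ i) = h - h * s ^ N"
    by (metis right_diff_distrib mult.assoc mult_1_right)
  then have "h = (\<Sum>i<N. s ^ i) + h * s ^ N"
    using h by simp
  moreover have "(h * s ^ N) $ k = 0" if "k < N" for k
    using startsby_zero_power_prefix[OF s(2), of N] that by (auto simp: fps_mult_nth)
  then have "h * s ^ N \<in> R" by (intro R_large) auto
  ultimately have "h \<in> R" using R_add R_sum R_power s(1) by metis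
  moreover have "inverse r = c * h"
  proof -
    have "r * (c * h) = 1" using h by (simp add: s_def mult_ac)
    then show ?thesis by (metis fps_inverse_unique)
  qed
  ultimately show ?thesis using c R_mult by simp
qed

lemma submod_unit:
  assumes "submod A" "r \<in> R" "r \<notin> mm" "r * f \<in> A"
  shows "f \<in> A"
proof -
  have r: "r $ 0 \<noteq> 0" using assms by (simp add: mm_def)
  then have "inverse r * (r * f) \<in> A" using assms R_inverse submodD(6) by blast
  moreover have "inverse r * (r * f) = f"
    using inverse_mult_eq_1[OF r] by (simp flip: mult.assoc)
  ultimately show ?thesis by simp
qed

text \<open>Among the multiples of \<open>f\<close> outside \<open>A\<close>, take one of the largest possible order.\<close>

lemma socle_multiple:
  assumes A: "submod A" "\<And>g. \<forall>k<M. g $ k = 0 \<Longrightarrow> g \<in> A" and f: "f \<notin> A"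
  obtains r where "r \<in> R" "r * f \<notin> A" "\<And>a. a \<in> mm \<Longrightarrow> a * (r * f) \<in> A"
proof -
  \<comment> \<open>Series outside \<open>A\<close> have order below \<open>M\<close>, so a multiple
    of largest order exists; a further factor from \<open>mm\<close> would raise its order.\<close>
  have bound: "subdegree g < M" if "g \<notin> A" for g
    using that A(2)[of g] nth_less_subdegree_zero[of _ g] by (meson less_le_trans not_le)
  have "\<exists>r. (r \<in> R \<and> r * f \<notin> A) \<and> (\<forall>y. y \<in> R \<and> y * f \<notin> A \<longrightarrow> subdegree (y * f) \<le> subdegree (r * f))"
    by (rule ex_has_greatest_nat[where k = 1 and b = M]) (use f bound R_one in \<open>auto intro: less_imp_le\<close>)
  then obtain r where r: "r \<in> R" "r * f \<notin> A"
    "\<And>y. y \<in> R \<Longrightarrow> y * f \<notin> A \<Longrightarrow> subdegree (y * f) \<le> subdegree (r * f)" by blast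
  have "a * (r * f) \<in> A" if "a \<in> mm" for a
  proof (rule ccontr)
    assume n: "a * (r * f) \<notin> A"
    then have nz: "a \<noteq> 0" "r * f \<noteq> 0" using A(1) submodD(2) by fastforce+
    have "subdegree (a * r * f) \<le> subdegree (r * f)"
      using r(3)[of "a * r"] n that r(1) by (simp add: mm_R R_mult mult.assoc)
    then have "subdegree a + subdegree (r * f) \<le> subdegree (r * f)"
      using nz by (simp add: mult.assoc)
    moreover have "subdegree a \<noteq> 0" using nz(1) that by (auto simp: mm_def subdegree_eq_0_iff)
    ultimately show False by simp
  qed
  then show ?thesis using that r by blast
qed

end

section \<open>Baer's criterion and the descent along an injective resolution\<close>

lemma ring_of_type_algebra_simps [simp]:
  "carrier (ring_of_type_algebra :: 'a::comm_ring_1 ring) = UNIV"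
  "monoid.mult (ring_of_type_algebra :: 'a::comm_ring_1 ring) = (*)"
  "add (ring_of_type_algebra :: 'a::comm_ring_1 ring) = (+)"
  "monoid.one (ring_of_type_algebra :: 'a::comm_ring_1 ring) = 1"
  "ring.zero (ring_of_type_algebra :: 'a::comm_ring_1 ring) = 0"
  by (simp_all add: ring_of_type_algebra_def)

section \<open>Ideals containing z^N\<close>

context large_subring
begin

abbreviation RR :: "'f fps ring" where
  "RR \<equiv> power_series_subring R"

lemma RR_simps [simp]:
  "carrier RR = R" "a \<otimes>\<^bsub>RR\<^esub> b = a * b" "a \<oplus>\<^bsub>RR\<^esub> b = a + b" "\<one>\<^bsub>RR\<^esub> = 1" "\<zero>\<^bsub>RR\<^esub> = 0"
  by simp_all

lemma cring_RR: "cring RR"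
proof (rule cringI)
  show "abelian_group RR"
  proof (rule abelian_groupI)
    fix x assume "x \<in> carrier RR"
    then show "\<exists>y\<in>carrier RR. y \<oplus>\<^bsub>RR\<^esub> x = \<zero>\<^bsub>RR\<^esub>"
      by (intro bexI[where x = "- x"]) (auto simp: R_uminus)
  qed (auto simp: R_add R_zero)
  show "Group.comm_monoid RR"
    by (rule comm_monoidI) (auto simp: R_mult R_one)
qed (auto simp: algebra_simps)

text \<open>An ideal of R that contains z^N contains z^N R and hence z^(2N) \<O>, but in general not
  z^N \<O>. Sizes of ideals are therefore taken modulo z^(2N).\<close>

abbreviation trunc :: "'f fps \<Rightarrow> 'f fps" where
  "trunc \<equiv> fps_cutoff (2 * N)"

abbreviation tcard :: "'f fps set \<Rightarrow> nat" where
  "tcard J \<equiv> card (trunc ` J)"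

abbreviation xN :: "'f fps" where
  "xN \<equiv> fps_X ^ N"

definition xR :: "'f fps set" where
  "xR = (\<lambda>r. xN * r) ` R"

lemma xN_nth: "k < N \<Longrightarrow> (xN * f) $ k = 0"
  by (simp add: fps_X_power_mult_nth)

lemma xN_mult_R: "xN * f \<in> R"
  by (rule R_large) (rule xN_nth)

lemma xN_R: "xN \<in> R"
  using xN_mult_R[of 1] by simp

lemma xN_mm: "xN \<in> mm"
  using N_pos xN_R by (simp add: mm_def)

lemma xN_shift: "(\<And>k. k < N \<Longrightarrow> g $ k = 0) \<Longrightarrow> g = xN * fps_shift N g"
  by (simp add: fps_eq_iff fps_X_power_mult_nth not_less)

lemma shift_xN: "fps_shift N (xN * f) = f"
  by (simp add: fps_eq_iff fps_X_power_mult_nth)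

lemma submod_xR: "submod xR"
proof -
  have "xN * a - xN * b \<in> xR" if "a \<in> R" "b \<in> R" for a b
    using that unfolding xR_def by (auto simp: R_diff simp flip: right_diff_distrib)
  moreover have "r * (xN * b) \<in> xR" if "r \<in> R" "b \<in> R" for r b
    using that unfolding xR_def by (auto simp: R_mult mult.left_commute)
  moreover have "0 \<in> xR" using R_zero unfolding xR_def by (metis image_eqI mult_zero_right)
  ultimately show ?thesis
    unfolding submod_def add_closed_def by (auto simp: xR_def)
qed

lemma xR_R: "xR \<subseteq> R"
  using xN_mult_R by (auto simp: xR_def)

lemma xN_xR: "xN \<in> xR"
  using R_one by (auto simp: xR_def intro: image_eqI[where x = 1])

lemma submod_large:
  assumes "submod J" "xN \<in> J" "\<forall>k<2 * N. g $ k = 0"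
  shows "g \<in> J"
proof -
  have "g = fps_shift N g * xN" using xN_shift[of g] assms(3) by (simp add: mult.commute)
  moreover have "fps_shift N g \<in> R" by (rule R_large) (use assms(3) in auto)
  ultimately show ?thesis using assms submodD(6) by metis
qed

lemma one_notin_xR: "1 \<notin> xR"
proof
  assume "1 \<in> xR"
  then obtain r where "1 = xN * r" by (auto simp: xR_def)
  then have "(1 :: 'f fps) $ 0 = (xN * r) $ 0" by simp
  then show False using xN_nth[of 0 r] N_pos by simp
qed

text \<open>The element \<open>u\<close> is the next step of a composition series of R / J. It is
  found among the multiples of 1, which a proper ideal misses.\<close>

lemma proper_ideal_socle:
  assumes "submod J" "J \<subseteq> R" "xN \<in> J" "J \<noteq> R"
  obtains u where "u \<in> R" "u \<notin> J" "\<And>a. a \<in> mm \<Longrightarrow> a * u \<in> J"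
proof -
  have "1 \<notin> J"
  proof
    assume "1 \<in> J"
    then have "r \<in> J" if "r \<in> R" for r using submodD(6)[OF assms(1) that, of 1] by simp
    then show False using assms by blast
  qed
  then obtain r where "r \<in> R" "r * 1 \<notin> J" "\<And>a. a \<in> mm \<Longrightarrow> a * (r * 1) \<in> J"
    using socle_multiple[OF assms(1) submod_large[OF assms(1,3)]] by metis
  then show ?thesis using that[of r] by simp
qed

definition enlarge :: "'f fps set \<Rightarrow> 'f fps \<Rightarrow> 'f fps set" where
  "enlarge J u = {j + r * u | j r. j \<in> J \<and> r \<in> R}"

lemma enlarge_mem: "j \<in> J \<Longrightarrow> r \<in> R \<Longrightarrow> j + r * u \<in> enlarge J u"
  by (auto simp: enlarge_def)

lemma submod_enlarge:
  assumes "submod J"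
  shows "submod (enlarge J u)"
proof -
  have "(j + r * u) - (j' + r' * u) \<in> enlarge J u" if "j \<in> J" "j' \<in> J" "r \<in> R" "r' \<in> R" for j j' r r'
  proof -
    have eq: "(j + r * u) - (j' + r' * u) = (j - j') + (r - r') * u" by (simp add: algebra_simps)
    show ?thesis unfolding eq using that by (intro enlarge_mem submodD(3)[OF assms] R_diff)
  qed
  moreover have "s * (j + r * u) \<in> enlarge J u" if "j \<in> J" "r \<in> R" "s \<in> R" for j r s
  proof -
    have eq: "s * (j + r * u) = s * j + (s * r) * u" by (simp add: algebra_simps)
    show ?thesis unfolding eq using that by (intro enlarge_mem submodD(6)[OF assms] R_mult)
  qed
  moreover have "0 \<in> enlarge J u"
    using enlarge_mem[of 0 J 0 u] submodD(2)[OF assms] R_zero by simp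
  ultimately show ?thesis
    unfolding submod_def add_closed_def by (auto simp: enlarge_def)
qed

lemma subset_enlarge: "J \<subseteq> enlarge J u"
  using enlarge_mem[of _ J 0 u] R_zero by auto

lemma enlarge_R: "J \<subseteq> R \<Longrightarrow> u \<in> R \<Longrightarrow> enlarge J u \<subseteq> R"
  by (auto simp: enlarge_def R_add R_mult)

lemma mem_enlarge: "submod J \<Longrightarrow> u \<in> enlarge J u"
  using enlarge_mem[of 0 J 1 u] submodD(2) R_one by simp

text \<open>The strict growth is the termination measure for inductions over ideals.\<close>

lemma card_enlarge:
  assumes "submod J" "J \<subseteq> R" "xN \<in> J" "u \<notin> J"
  shows "tcard J < tcard (enlarge J u)"
proof (rule psubset_card_mono)
  show "trunc ` J \<subset> trunc ` (enlarge J u)"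
  proof
    show "trunc ` J \<noteq> trunc ` (enlarge J u)"
    proof
      assume eq: "trunc ` J = trunc ` (enlarge J u)"
      have "J = enlarge J u"
      proof (rule eq_of_image_eq[where \<tau> = "trunc"])
        show "b \<in> J" if "trunc b = 0" for b
          using that submod_large[OF assms(1,3)] by (simp add: fps_cutoff_eq_0)
      qed (simp_all add: eq subset_enlarge submodD(1)[OF assms(1)]
          submodD(1)[OF submod_enlarge[OF assms(1)]] additive_on_fps_cutoff)
      then show False using mem_enlarge[OF assms(1)] assms(4) by metis
    qed
  qed (use subset_enlarge in blast)
qed (rule finite_fps_cutoff)

section \<open>Linear maps on ideals and Baer's condition\<close>

definition linmap :: "('f fps, 'e) module \<Rightarrow> 'f fps set \<Rightarrow> ('f fps \<Rightarrow> 'e) \<Rightarrow> bool" where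
  "linmap E J \<phi> \<longleftrightarrow>
     \<phi> \<in> J \<rightarrow> carrier E \<and> (\<forall>a\<in>J. \<forall>b\<in>J. \<phi> (a + b) = \<phi> a \<oplus>\<^bsub>E\<^esub> \<phi> b) \<and>
     (\<forall>r\<in>R. \<forall>a\<in>J. \<phi> (r * a) = r \<odot>\<^bsub>E\<^esub> \<phi> a)"

text \<open>
  Only ideals containing \<open>z\<^sup>N\<close> are tested: they have finite index, and no others are met.
\<close>

definition baer :: "('f fps, 'e) module \<Rightarrow> 'e set \<Rightarrow> bool" where
  "baer E W \<longleftrightarrow>
     (\<forall>J \<phi>. submod J \<and> J \<subseteq> R \<and> xN \<in> J \<and> linmap E J \<phi> \<and> \<phi> ` J \<subseteq> W \<longrightarrow>
        (\<exists>w\<in>W. \<forall>a\<in>J. \<phi> a = a \<odot>\<^bsub>E\<^esub> w))"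

lemma baerD:
  fixes E (structure)
  assumes "baer E W" "submod J" "J \<subseteq> R" "xN \<in> J" "linmap E J \<phi>" "\<phi> ` J \<subseteq> W"
  obtains w where "w \<in> W" "\<And>a. a \<in> J \<Longrightarrow> \<phi> a = a \<odot> w"
proof -
  have "\<exists>w\<in>W. \<forall>a\<in>J. \<phi> a = a \<odot> w"
    using assms(1)[unfolded baer_def, rule_format, of J \<phi>] assms(2-6) by simp
  then show ?thesis using that by blast
qed

lemma smult_facts:
  fixes E (structure)
  assumes "Module.module RR E"
  shows "r \<in> R \<Longrightarrow> x \<in> carrier E \<Longrightarrow> r \<odot> x \<in> carrier E"
    and "r \<in> R \<Longrightarrow> s \<in> R \<Longrightarrow> x \<in> carrier E \<Longrightarrow> (r + s) \<odot> x = r \<odot> x \<oplus> s \<odot> x"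
    and "r \<in> R \<Longrightarrow> x \<in> carrier E \<Longrightarrow> y \<in> carrier E \<Longrightarrow> r \<odot> (x \<oplus> y) = r \<odot> x \<oplus> r \<odot> y"
    and "r \<in> R \<Longrightarrow> s \<in> R \<Longrightarrow> x \<in> carrier E \<Longrightarrow> (r * s) \<odot> x = r \<odot> (s \<odot> x)"
    and "x \<in> carrier E \<Longrightarrow> 1 \<odot> x = x"
    and "x \<in> carrier E \<Longrightarrow> 0 \<odot> x = \<zero>"
    and "r \<in> R \<Longrightarrow> r \<odot> \<zero> = \<zero>"
    and "r \<in> R \<Longrightarrow> x \<in> carrier E \<Longrightarrow> y \<in> carrier E \<Longrightarrow> r \<odot> (x \<ominus> y) = r \<odot> x \<ominus> r \<odot> y"
  using module.smult_closed[OF assms, of r x] module.smult_l_distr[OF assms, of r s x]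
    module.smult_r_distr[OF assms, of r x] module.smult_assoc1[OF assms, of r s x]
    module.smult_one[OF assms, of x] module.smult_l_null[OF assms, of x]
    module.smult_r_null[OF assms, of r] module.smult_r_minus[OF assms, of r y]
    abelian_group.a_inv_closed[OF Module.module.axioms(2)[OF assms], of y]
  by (simp_all add: a_minus_def)

text \<open>The extension sends j + r u to \<phi> j + r w. If j + r u = j' + r' u, then r - r'
  multiplies u into \<open>J\<close>, so it is a nonunit because u is not in \<open>J\<close>; the
  condition on \<open>mm\<close> then makes the two values agree.\<close>

lemma extend_linmap:
  fixes E (structure)
  assumes E: "Module.module RR E" and W: "submodule W RR E"
    and J: "submod J" and u: "u \<in> R" "u \<notin> J"
    and \<phi>: "linmap E J \<phi>" "\<phi> ` J \<subseteq> W"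
    and w: "w \<in> W" "\<And>a. a \<in> mm \<Longrightarrow> a * u \<in> J" "\<And>a. a \<in> mm \<Longrightarrow> \<phi> (a * u) = a \<odot> w"
  obtains \<psi> where "linmap E (enlarge J u) \<psi>" "\<psi> ` (enlarge J u) \<subseteq> W"
    "\<And>j. j \<in> J \<Longrightarrow> \<psi> j = \<phi> j" "\<psi> u = w"
proof -
  interpret M: module RR E by fact
  note sm = smult_facts[OF E]
  have Wc: "W \<subseteq> carrier E" "\<And>x y. x \<in> W \<Longrightarrow> y \<in> W \<Longrightarrow> x \<oplus> y \<in> W" "\<And>r x. r \<in> R \<Longrightarrow> x \<in> W \<Longrightarrow> r \<odot> x \<in> W"
    using W by (auto simp: submodule_def submodule_axioms_def subgroup_def)
  have wE: "w \<in> carrier E" using w(1) Wc(1) by blast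
  have \<phi>E: "\<phi> j \<in> carrier E" if "j \<in> J" for j using that \<phi>(1) by (auto simp: linmap_def)
  have \<phi>W: "\<phi> j \<in> W" if "j \<in> J" for j using that \<phi>(2) by auto
  have \<phi>add: "\<phi> (a + b) = \<phi> a \<oplus> \<phi> b" if "a \<in> J" "b \<in> J" for a b using that \<phi>(1) by (auto simp: linmap_def)
  have \<phi>mult: "\<phi> (r * b) = r \<odot> \<phi> b" if "r \<in> R" "b \<in> J" for r b using that \<phi>(1) by (auto simp: linmap_def)
  define \<psi> where "\<psi> y = (THE v. \<exists>j\<in>J. \<exists>r\<in>R. y = j + r * u \<and> v = \<phi> j \<oplus> r \<odot> w)" for y
  have wd: "\<phi> j' \<oplus> r' \<odot> w = \<phi> j \<oplus> r \<odot> w"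
    if "j \<in> J" "j' \<in> J" "r \<in> R" "r' \<in> R" "j + r * u = j' + r' * u" for j j' r r'
  proof -
    have eq: "(r - r') * u = j' - j" using that(5) by (simp add: algebra_simps)
    then have "(r - r') * u \<in> J" using J that by (simp add: submodD)
    then have mm: "r - r' \<in> mm" using submod_unit[OF J _ _, of "r - r'" u] that u R_diff by blast
    have "\<phi> j' = \<phi> (j + (r - r') * u)" using eq by simp
    also have "\<dots> = \<phi> j \<oplus> (r - r') \<odot> w" using \<phi>add w(2,3) mm that by simp
    finally have "\<phi> j' \<oplus> r' \<odot> w = \<phi> j \<oplus> ((r - r') \<odot> w \<oplus> r' \<odot> w)"
      using that \<phi>E sm(1) wE mm_R[OF mm] by (simp add: M.a_assoc)
    also have "(r - r') \<odot> w \<oplus> r' \<odot> w = r \<odot> w"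
      using sm(2)[of "r - r'" r' w] that wE mm_R[OF mm] by simp
    finally show ?thesis .
  qed
  have \<psi>: "\<psi> (j + r * u) = \<phi> j \<oplus> r \<odot> w" if "j \<in> J" "r \<in> R" for j r
    unfolding \<psi>_def by (rule the_equality) (use that wd in blast)+
  have mem: "\<psi> y \<in> W" if "y \<in> enlarge J u" for y
    using that unfolding enlarge_def by (auto simp: \<psi> intro!: Wc \<phi>W w)
  have add: "\<psi> (a + b) = \<psi> a \<oplus> \<psi> b" if ab: "a \<in> enlarge J u" "b \<in> enlarge J u" for a b
  proof -
    from ab obtain j r j' r' where *: "a = j + r * u" "b = j' + r' * u" "j \<in> J" "j' \<in> J" "r \<in> R" "r' \<in> R"
      by (auto simp: enlarge_def)
    have eq: "a + b = (j + j') + (r + r') * u" using * by (simp add: algebra_simps)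
    have "\<psi> (a + b) = \<phi> (j + j') \<oplus> (r + r') \<odot> w"
      unfolding eq using *(3-6) by (intro \<psi> submodD(4)[OF J] R_add)
    also have "\<dots> = (\<phi> j \<oplus> \<phi> j') \<oplus> (r \<odot> w \<oplus> r' \<odot> w)"
      using \<phi>add[OF *(3,4)] sm(2)[OF *(5,6) wE] by simp
    also have "\<dots> = \<psi> a \<oplus> \<psi> b"
      using \<psi>[OF *(3,5)] \<psi>[OF *(4,6)] \<phi>E[OF *(3)] \<phi>E[OF *(4)] sm(1)[OF *(5) wE] sm(1)[OF *(6) wE] *(1,2)
      by (simp add: M.a_ac)
    finally show ?thesis .
  qed
  have mult: "\<psi> (s * a) = s \<odot> \<psi> a" if a: "a \<in> enlarge J u" "s \<in> R" for a s
  proof -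
    from a obtain j r where *: "a = j + r * u" "j \<in> J" "r \<in> R"
      by (auto simp: enlarge_def)
    have eq: "s * a = s * j + (s * r) * u" using * by (simp add: algebra_simps)
    have "\<psi> (s * a) = \<phi> (s * j) \<oplus> (s * r) \<odot> w"
      unfolding eq using *(2,3) a(2) by (intro \<psi> submodD(6)[OF J] R_mult)
    also have "\<dots> = s \<odot> (\<phi> j \<oplus> r \<odot> w)"
      using sm(3)[OF a(2) \<phi>E[OF *(2)] sm(1)[OF *(3) wE]] \<phi>mult[OF a(2) *(2)] sm(4)[OF a(2) *(3) wE] by simp
    finally show ?thesis using \<psi>[OF *(2,3)] *(1) by simp
  qed
  have "\<psi> j = \<phi> j" if "j \<in> J" for j
    using \<psi>[OF that R_zero] \<phi>E[OF that] wE by (simp add: sm)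
  moreover have "\<psi> u = w"
  proof -
    have "\<phi> (0 * u) = 0 \<odot> w" by (rule w(3)) (simp add: mm_def R_zero)
    then have "\<phi> 0 = \<zero>" using sm(6) wE by simp
    then show ?thesis using \<psi>[of 0 1] R_one J wE by (simp add: submodD sm)
  qed
  moreover have "linmap E (enlarge J u) \<psi>"
    unfolding linmap_def using mem Wc(1) add mult by auto
  moreover have "\<psi> ` (enlarge J u) \<subseteq> W" using mem by auto
  ultimately show ?thesis using that by blast
qed

text \<open>The quotient (J + Ru) / J is R / mm, so zero on \<open>J\<close> and
  \<open>u \<mapsto> e\<close> define a map on J + Ru, and Baer's condition writes it as
  multiplication by some \<open>w\<close>. In other words, maps on a line in the socle of R / J
  extend to R / J.\<close>

lemma baer_annihilated:
  fixes E (structure)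
  assumes E: "Module.module RR E" and W: "submodule W RR E" and "baer E W"
    and J: "submod J" "J \<subseteq> R" "xN \<in> J" and u: "u \<in> R" "u \<notin> J" "\<And>a. a \<in> mm \<Longrightarrow> a * u \<in> J"
    and e: "e \<in> W" "\<And>a. a \<in> mm \<Longrightarrow> a \<odot> e = \<zero>"
  obtains w where "w \<in> W" "\<And>j. j \<in> J \<Longrightarrow> j \<odot> w = \<zero>" "u \<odot> w = e"
proof -
  interpret M: module RR E by fact
  have "linmap E J (\<lambda>_. \<zero>)" by (auto simp: linmap_def smult_facts[OF E])
  moreover have "(\<lambda>_. \<zero>) ` J \<subseteq> W"
    using W by (auto simp: submodule_def subgroup_def)
  ultimately obtain \<psi> where \<psi>: "linmap E (enlarge J u) \<psi>" "\<psi> ` (enlarge J u) \<subseteq> W"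
    "\<And>j. j \<in> J \<Longrightarrow> \<psi> j = \<zero>" "\<psi> u = e"
    using extend_linmap[OF E W J(1) u(1,2) _ _ e(1) u(3), of "\<lambda>_. \<zero>"] e(2) by metis
  then obtain w where "w \<in> W" "\<And>a. a \<in> enlarge J u \<Longrightarrow> \<psi> a = a \<odot> w"
    using baerD[OF assms(3) submod_enlarge[OF J(1)] enlarge_R[OF J(2) u(1)] _ \<psi>(1,2)]
      J(3) subset_enlarge by blast
  then show ?thesis
    using that \<psi>(3,4) subset_enlarge mem_enlarge[OF J(1)] by (metis subsetD)
qed

text \<open>Socle elements \<open>u\<close> of R / J are adjoined one at a time until the ideal is
  R. The only obstruction to adjoining \<open>u\<close> is the map
  \<open>a \<mapsto> \<phi> (a * u)\<close> on \<open>mm\<close>, so it suffices to extend maps from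
  the maximal ideal.\<close>

lemma baerI:
  fixes E (structure)
  assumes E: "Module.module RR E" and W: "submodule W RR E"
    and ext: "\<And>\<phi>. linmap E mm \<phi> \<Longrightarrow> \<phi> ` mm \<subseteq> W \<Longrightarrow> \<exists>w\<in>W. \<forall>a\<in>mm. \<phi> a = a \<odot> w"
  shows "baer E W"
proof -
  have "\<exists>w\<in>W. \<forall>a\<in>J. \<phi> a = a \<odot> w"
    if "submod J" "J \<subseteq> R" "xN \<in> J" "linmap E J \<phi>" "\<phi> ` J \<subseteq> W" for J \<phi>
    using that
  proof (induction "tcard R - tcard J"
      arbitrary: J \<phi> rule: less_induct)
    case less
    show ?case
    proof (cases "J = R")
      case True
      then have "\<phi> a = a \<odot> \<phi> 1" if "a \<in> J" for a
      proof -
        have "\<phi> (a * 1) = a \<odot> \<phi> 1"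
          using less.prems(4) that True R_one unfolding linmap_def by blast
        then show ?thesis by simp
      qed
      moreover have "\<phi> 1 \<in> W" using less.prems(5) True R_one by blast
      ultimately show ?thesis by blast
    next
      case False
      obtain u where u: "u \<in> R" "u \<notin> J" "\<And>a. a \<in> mm \<Longrightarrow> a * u \<in> J"
        using proper_ideal_socle[OF less.prems(1-3) False] by blast
      have "linmap E mm (\<lambda>a. \<phi> (a * u))" "(\<lambda>a. \<phi> (a * u)) ` mm \<subseteq> W"
        using less.prems(4,5) u by (auto simp: linmap_def algebra_simps)
      then obtain w where w: "w \<in> W" "\<And>a. a \<in> mm \<Longrightarrow> \<phi> (a * u) = a \<odot> w"
        using ext[of "\<lambda>a. \<phi> (a * u)"] by blast
      obtain \<psi> where \<psi>: "linmap E (enlarge J u) \<psi>" "\<psi> ` (enlarge J u) \<subseteq> W"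
        "\<And>j. j \<in> J \<Longrightarrow> \<psi> j = \<phi> j"
        using extend_linmap[OF E W less.prems(1) u(1,2) less.prems(4,5) w(1) u(3) w(2)] by metis
      have "tcard J < tcard (enlarge J u)"
        by (rule card_enlarge) (use less.prems u in auto)
      moreover have "tcard (enlarge J u) \<le> tcard R"
        by (intro card_mono finite_fps_cutoff image_mono enlarge_R less.prems u)
      ultimately have "tcard R - tcard (enlarge J u)
          < tcard R - tcard J"
        by linarith
      moreover have "xN \<in> enlarge J u" using less.prems(3) subset_enlarge by blast
      ultimately have "\<exists>w\<in>W. \<forall>a\<in>enlarge J u. \<psi> a = a \<odot> w"
        by (intro less.hyps submod_enlarge[OF less.prems(1)] enlarge_R[OF less.prems(2) u(1)] \<psi>(1,2))
      then show ?thesis using \<psi>(3) subset_enlarge by (metis subsetD)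
    qed
  qed
  then show ?thesis unfolding baer_def by blast
qed

text \<open>As z^N is not a zero divisor, z^N r \<mapsto> r e is a well-defined map on the ideal z^N
  R; the element representing it is the quotient sought.\<close>

lemma baer_divisible:
  fixes E (structure)
  assumes E: "Module.module RR E" and "baer E (carrier E)" and e: "e \<in> carrier E"
  obtains y where "y \<in> carrier E" "xN \<odot> y = e"
proof -
  have lin: "linmap E xR (\<lambda>y. fps_shift N y \<odot> e)"
    unfolding linmap_def using e
    by (auto simp: xR_def shift_xN smult_facts[OF E] R_mult mult.left_commute[of _ xN]
        simp flip: distrib_left)
  then have "(\<lambda>y. fps_shift N y \<odot> e) ` xR \<subseteq> carrier E"
    by (simp add: linmap_def image_subset_iff_funcset)
  from baerD[OF assms(2) submod_xR xR_R xN_xR lin this]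
  obtain y where "y \<in> carrier E" "\<And>a. a \<in> xR \<Longrightarrow> fps_shift N a \<odot> e = a \<odot> y"
    by blast
  moreover have "fps_shift N xN \<odot> e = e"
    using shift_xN[of 1] smult_facts(5)[OF E e] by simp
  ultimately show ?thesis using that xN_xR by metis
qed

section \<open>Kernels and images along the resolution\<close>

lemma module_homD:
  fixes E (structure)
  assumes "d \<in> module_hom RR E F"
  shows "x \<in> carrier E \<Longrightarrow> d x \<in> carrier F"
    and "x \<in> carrier E \<Longrightarrow> y \<in> carrier E \<Longrightarrow> d (x \<oplus> y) = d x \<oplus>\<^bsub>F\<^esub> d y"
    and "r \<in> R \<Longrightarrow> x \<in> carrier E \<Longrightarrow> d (r \<odot> x) = r \<odot>\<^bsub>F\<^esub> d x"
  using assms by (auto simp: module_hom_def)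

lemma module_hom_minus:
  fixes E (structure)
  assumes "Module.module RR E" "Module.module RR F" "d \<in> module_hom RR E F"
    and "x \<in> carrier E" "y \<in> carrier E"
  shows "d (x \<ominus> y) = d x \<ominus>\<^bsub>F\<^esub> d y"
proof -
  interpret E: module RR E by fact
  interpret F: module RR F by fact
  note d = module_homD[OF assms(3)]
  have "d (x \<ominus> y) \<oplus>\<^bsub>F\<^esub> d y = d x"
    using d(2)[of "x \<ominus> y" y] assms(4,5) by (simp add: E.minus_eq E.a_assoc E.l_neg)
  then show ?thesis
    using d(1)[of x] d(1)[of y] d(1)[of "x \<ominus> y"] assms(4,5)
    by (metis F.minus_eq F.a_assoc F.r_neg F.r_zero F.a_inv_closed E.minus_closed)
qed

lemma module_hom_zero:
  fixes E (structure)
  assumes "Module.module RR E" "Module.module RR F" "d \<in> module_hom RR E F"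
  shows "d \<zero> = \<zero>\<^bsub>F\<^esub>"
proof -
  interpret E: module RR E by fact
  interpret F: module RR F by fact
  have "d (\<zero> \<ominus> \<zero>) = d \<zero> \<ominus>\<^bsub>F\<^esub> d \<zero>"
    by (rule module_hom_minus[OF assms]) auto
  then show ?thesis using module_homD(1)[OF assms(3)] by (simp add: E.r_neg F.r_neg E.minus_eq F.minus_eq)
qed

lemma submodule_ker:
  fixes E (structure)
  assumes E: "Module.module RR E" and F: "Module.module RR F" and d: "d \<in> module_hom RR E F"
  shows "submodule {x \<in> carrier E. d x = \<zero>\<^bsub>F\<^esub>} RR E"
proof -
  interpret E: module RR E by fact
  interpret F: module RR F by fact
  note m = module_homD[OF d] smult_facts[OF E] smult_facts[OF F] module_hom_zero[OF E F d]
  show ?thesis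
  proof (rule E.submoduleI)
    fix a assume a: "a \<in> {x \<in> carrier E. d x = \<zero>\<^bsub>F\<^esub>}"
    have "d (\<zero> \<ominus> a) = \<zero>\<^bsub>F\<^esub> \<ominus>\<^bsub>F\<^esub> \<zero>\<^bsub>F\<^esub>"
      using module_hom_minus[OF E F d, of "\<zero>" a] a m by auto
    then show "\<ominus> a \<in> {x \<in> carrier E. d x = \<zero>\<^bsub>F\<^esub>}"
      using a by (simp add: E.minus_eq F.minus_eq)
  qed (use m in auto)
qed

lemma submodule_image:
  assumes E: "Module.module RR E" and F: "Module.module RR F" and d: "d \<in> module_hom RR E F"
  shows "submodule (d ` carrier E) RR F"
proof -
  interpret E: module RR E by fact
  interpret F: module RR F by fact
  note m = module_homD[OF d]
  show ?thesis
  proof (rule F.submoduleI)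
    show "\<zero>\<^bsub>F\<^esub> \<in> d ` carrier E" using module_hom_zero[OF E F d] by (metis E.zero_closed image_eqI)
    fix a assume "a \<in> d ` carrier E"
    then obtain x where x: "x \<in> carrier E" "a = d x" by blast
    have "d (\<zero>\<^bsub>E\<^esub> \<ominus>\<^bsub>E\<^esub> x) = \<zero>\<^bsub>F\<^esub> \<ominus>\<^bsub>F\<^esub> a"
      using module_hom_minus[OF E F d, of "\<zero>\<^bsub>E\<^esub>" x] x module_hom_zero[OF E F d] by auto
    then have "\<ominus>\<^bsub>F\<^esub> a = d (\<zero>\<^bsub>E\<^esub> \<ominus>\<^bsub>E\<^esub> x)" using x m(1) by (simp add: F.minus_eq)
    then show "\<ominus>\<^bsub>F\<^esub> a \<in> d ` carrier E" using x(1) by simp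
  next
    fix a b assume "a \<in> d ` carrier E" "b \<in> d ` carrier E"
    then show "a \<oplus>\<^bsub>F\<^esub> b \<in> d ` carrier E" using m(2) by (auto simp flip: m(2))
  next
    fix a x assume "a \<in> carrier RR" "x \<in> d ` carrier E"
    then show "a \<odot>\<^bsub>F\<^esub> x \<in> d ` carrier E" using smult_facts(1)[OF E] by (auto simp flip: m(3))
  qed (use m in auto)
qed

text \<open>A map from \<open>mm\<close> to \<open>Z\<close> is multiplication by some e in E, which
  must be corrected by an element with the same image in F that \<open>mm\<close> annihilates. The
  correction is u v, where u represents a socle element of R / z^N R and z^N v = 0; the divisibility
  of \<open>Z\<close> is what provides such a v.\<close>

lemma baer_kernel:
  fixes E (structure)
  assumes E: "Module.module RR E" and F: "Module.module RR F" and d: "d \<in> module_hom RR E F"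
    and bE: "baer E (carrier E)" and bF: "baer F (d ` carrier E)"
    and Z: "Z = {x \<in> carrier E. d x = \<zero>\<^bsub>F\<^esub>}"
    and div: "\<And>z. z \<in> Z \<Longrightarrow> \<exists>y\<in>Z. xN \<odot> y = z"
  shows "baer E Z"
proof (rule baerI[OF E])
  interpret E: module RR E by fact
  interpret F: module RR F by fact
  note dm = module_homD[OF d] and sm = smult_facts[OF E] and smF = smult_facts[OF F]
  show "submodule Z RR E" unfolding Z by (rule submodule_ker[OF E F d])
  fix \<phi> assume \<phi>: "linmap E mm \<phi>" "\<phi> ` mm \<subseteq> Z"
  have "mm \<subseteq> R" "\<phi> ` mm \<subseteq> carrier E" using mm_R \<phi>(1) by (auto simp: linmap_def)
  from baerD[OF bE submod_mm this(1) xN_mm \<phi>(1) this(2)]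
  obtain e where e: "e \<in> carrier E" "\<And>a. a \<in> mm \<Longrightarrow> \<phi> a = a \<odot> e" by blast
  have "a \<odot>\<^bsub>F\<^esub> d e = \<zero>\<^bsub>F\<^esub>" if "a \<in> mm" for a
    using dm(3)[of a e] e that \<phi>(2) mm_R Z by (metis (mono_tags, lifting) image_subset_iff mem_Collect_eq)
  moreover obtain u where u: "u \<in> R" "u \<notin> xR" "\<And>a. a \<in> mm \<Longrightarrow> a * u \<in> xR"
    using proper_ideal_socle[OF submod_xR xR_R xN_xR] one_notin_xR R_one by blast
  ultimately obtain w' where w': "w' \<in> d ` carrier E" "\<And>j. j \<in> xR \<Longrightarrow> j \<odot>\<^bsub>F\<^esub> w' = \<zero>\<^bsub>F\<^esub>" "u \<odot>\<^bsub>F\<^esub> w' = d e"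
    using baer_annihilated[OF F submodule_image[OF E F d] bF submod_xR xR_R xN_xR u, of "d e"] e(1) by blast
  obtain w where w: "w \<in> carrier E" "w' = d w" using w'(1) by blast
  have "xN \<odot> w \<in> Z" using dm(3)[OF xN_R w(1)] w w'(2)[OF xN_xR] sm(1)[OF xN_R w(1)] by (simp add: Z)
  \<comment> \<open>Subtracting \<open>z\<close> makes the lift of \<open>w'\<close> annihilated by
    z^N and leaves its image in F unchanged.\<close>
  then obtain z where z: "z \<in> Z" "xN \<odot> z = xN \<odot> w" using div by blast
  have zE: "z \<in> carrier E" "d z = \<zero>\<^bsub>F\<^esub>" using z(1) by (auto simp: Z)
  define v where "v = w \<ominus> z"
  have v: "v \<in> carrier E" using w zE by (simp add: v_def)
  have xv: "xN \<odot> v = \<zero>"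
    using sm(8)[OF xN_R w(1) zE(1)] z(2) sm(1)[OF xN_R zE(1)] by (simp add: v_def E.minus_eq E.r_neg)
  have "d v = w'"
    using module_hom_minus[OF E F d w(1) zE(1)] zE w dm(1) by (simp add: v_def F.minus_eq)
  then have "d (u \<odot> v) = d e" using dm(3)[OF u(1) v] w'(3) by simp
  moreover have uv: "u \<odot> v \<in> carrier E" using sm(1)[OF u(1) v] .
  ultimately have "e \<ominus> u \<odot> v \<in> Z"
    using module_hom_minus[OF E F d e(1) uv] e(1) dm(1) by (simp add: Z F.minus_eq F.r_neg)
  moreover have "\<phi> a = a \<odot> (e \<ominus> u \<odot> v)" if a: "a \<in> mm" for a
  proof -
    obtain r where r: "r \<in> R" "a * u = r * xN" using u(3)[OF a] by (auto simp: xR_def)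
    have "a \<odot> (u \<odot> v) = r \<odot> (xN \<odot> v)"
      using sm(4)[OF mm_R[OF a] u(1) v] sm(4)[OF r(1) xN_R v] r(2) by simp
    then have "a \<odot> (u \<odot> v) = \<zero>" using xv sm(7)[OF r(1)] by simp
    then show ?thesis
      using sm(8)[OF mm_R[OF a] e(1) uv] e(2)[OF a] sm(1)[OF mm_R[OF a] e(1)] by (simp add: E.minus_eq)
  qed
  ultimately show "\<exists>w\<in>Z. \<forall>a\<in>mm. \<phi> a = a \<odot> w" by blast
qed

lemma module_ideal:
  assumes "submod J" "J \<subseteq> R"
  shows "Module.module RR (self_module RR\<lparr>carrier := J\<rparr>)"
proof (rule moduleI[OF cring_RR])
  show "abelian_group (self_module RR\<lparr>carrier := J\<rparr>)"
  proof (rule abelian_groupI)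
    fix x assume "x \<in> carrier (self_module RR\<lparr>carrier := J\<rparr>)"
    then show "\<exists>y\<in>carrier (self_module RR\<lparr>carrier := J\<rparr>).
      y \<oplus>\<^bsub>self_module RR\<lparr>carrier := J\<rparr>\<^esub> x = \<zero>\<^bsub>self_module RR\<lparr>carrier := J\<rparr>\<^esub>"
      using assms by (intro bexI[where x = "- x"]) (auto simp: self_module_def submodD)
  qed (use assms in \<open>auto simp: self_module_def submodD algebra_simps\<close>)
qed (use assms in \<open>auto simp: self_module_def submodD algebra_simps\<close>)

lemma injective_imp_baer:
  assumes "injective_module RR E"
  shows "baer E (carrier E)"
  unfolding baer_def
proof safe
  fix J \<phi> assume J: "submod J" "J \<subseteq> R" and \<phi>: "linmap E J \<phi>"
  define NN where "NN = self_module RR\<lparr>carrier := J\<rparr>"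
  define PP where "PP = self_module RR\<lparr>carrier := R\<rparr>"
  have "Module.module RR NN" "Module.module RR PP"
    unfolding NN_def PP_def using J submod_R by (auto intro!: module_ideal)
  moreover have "id \<in> module_hom RR NN PP" "inj_on id (carrier NN)" "\<phi> \<in> module_hom RR NN E"
    using J \<phi> by (auto simp: module_hom_def NN_def PP_def self_module_def linmap_def)
  ultimately obtain g where g: "g \<in> module_hom RR PP E" "\<forall>x\<in>carrier NN. g (id x) = \<phi> x"
    using assms unfolding injective_module_def by blast
  have "\<phi> a = a \<odot>\<^bsub>E\<^esub> g 1" if "a \<in> J" for a
  proof -
    have "g (a \<odot>\<^bsub>PP\<^esub> 1) = a \<odot>\<^bsub>E\<^esub> g 1"
      by (rule module_homD(3)[OF g(1)]) (use that J R_one in \<open>auto simp: PP_def\<close>)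
    then show ?thesis using g(2) that by (simp add: PP_def NN_def self_module_def)
  qed
  moreover have "g 1 \<in> carrier E"
    by (rule module_homD(1)[OF g(1)]) (simp add: PP_def R_one)
  ultimately show "\<exists>w\<in>carrier E. \<forall>a\<in>J. \<phi> a = a \<odot>\<^bsub>E\<^esub> w" by blast
qed

lemma injective_resolutionD:
  assumes "injective_resolution A M E \<epsilon> d"
  shows "injective_module A (E i)" "\<epsilon> \<in> module_hom A M (E 0)" "inj_on \<epsilon> (carrier M)"
    "d i \<in> module_hom A (E i) (E (Suc i))"
    "{x \<in> carrier (E 0). d 0 x = \<zero>\<^bsub>E 1\<^esub>} = \<epsilon> ` carrier M"
    "{x \<in> carrier (E (Suc i)). d (Suc i) x = \<zero>\<^bsub>E (Suc (Suc i))\<^esub>} = d i ` carrier (E i)"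
  using assms unfolding injective_resolution_def by blast+

text \<open>Downward induction from the vanishing end of the resolution. The indices begin at
  \<open>Suc i\<close> because these kernels are images of \<open>E i\<close> and so inherit
  divisibility by z^N; the kernel in \<open>E 0\<close> is a copy of R, where divisibility
  fails.\<close>

lemma baer_resolution:
  assumes res: "injective_resolution RR M E \<epsilon> d" and fin: "\<forall>i>k. carrier (E i) = {\<zero>\<^bsub>E i\<^esub>}"
  shows "baer (E (Suc i)) {x \<in> carrier (E (Suc i)). d (Suc i) x = \<zero>\<^bsub>E (Suc (Suc i))\<^esub>}"
proof (induction "k - i" arbitrary: i rule: less_induct)
  case less
  let ?Z = "\<lambda>i. {x \<in> carrier (E (Suc i)). d (Suc i) x = \<zero>\<^bsub>E (Suc (Suc i))\<^esub>}"
  have E: "Module.module RR (E i)" "baer (E i) (carrier (E i))" for i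
    using injective_resolutionD(1)[OF res, of i] injective_imp_baer[of "E i"]
    by (simp_all add: injective_module_def)
  have d: "d i \<in> module_hom RR (E i) (E (Suc i))" for i
    using injective_resolutionD(4)[OF res] .
  have ex: "?Z i = d i ` carrier (E i)" for i
    using injective_resolutionD(6)[OF res] .
  show ?case
  proof (cases "i < k")
    case True
    show ?thesis
    proof (rule baer_kernel[OF E(1) E(1) d E(2) _ refl])
      show "baer (E (Suc (Suc i))) (d (Suc i) ` carrier (E (Suc i)))"
        using less.hyps[of "Suc i"] True by (simp add: ex)
      fix z assume "z \<in> ?Z i"
      then obtain e where e: "e \<in> carrier (E i)" "z = d i e" unfolding ex by blast
      obtain y where "y \<in> carrier (E i)" "xN \<odot>\<^bsub>E i\<^esub> y = e"
        using baer_divisible[OF E(1) E(2) e(1)] by blast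
      then show "\<exists>y\<in>?Z i. xN \<odot>\<^bsub>E (Suc i)\<^esub> y = z"
        unfolding ex using module_homD(3)[OF d xN_R, of y i] e(2) by auto
    qed
  next
    case False
    then have c: "carrier (E (Suc i)) = {\<zero>\<^bsub>E (Suc i)\<^esub>}" using fin by simp
    have "d (Suc i) \<zero>\<^bsub>E (Suc i)\<^esub> = \<zero>\<^bsub>E (Suc (Suc i))\<^esub>"
      by (rule module_hom_zero[OF E(1) E(1) d])
    then have Z: "?Z i = {\<zero>\<^bsub>E (Suc i)\<^esub>}"
      using c by auto
    show ?thesis
      unfolding Z baer_def
    proof (intro allI impI)
      fix J \<phi>
      assume *: "submod J \<and> J \<subseteq> R \<and> xN \<in> J \<and> linmap (E (Suc i)) J \<phi> \<and> \<phi> ` J \<subseteq> {\<zero>\<^bsub>E (Suc i)\<^esub>}"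
      have "\<phi> a = a \<odot>\<^bsub>E (Suc i)\<^esub> \<zero>\<^bsub>E (Suc i)\<^esub>" if "a \<in> J" for a
      proof -
        have "\<phi> a = \<zero>\<^bsub>E (Suc i)\<^esub>" "a \<in> R" using * that by auto
        then show ?thesis using smult_facts(7)[OF E(1)] by simp
      qed
      then show "\<exists>w\<in>{\<zero>\<^bsub>E (Suc i)\<^esub>}. \<forall>a\<in>J. \<phi> a = a \<odot>\<^bsub>E (Suc i)\<^esub> w" by simp
    qed
  qed
qed

text \<open>
  Every homomorphism from the maximal ideal to \<open>R\<close> comes from one on \<open>J\<close>, that is,
  the first Ext group of \<open>J + Ru\<close> with values in \<open>R\<close> vanishes; fractions have been cleared with \<open>z\<^sup>N\<close>.
\<close>

lemma lift_to_ideal: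
  fixes E (structure)
  assumes E: "Module.module RR E" "baer E (carrier E)" and F: "Module.module RR F" "baer F (d ` carrier E)"
    and d: "d \<in> module_hom RR E F" and \<epsilon>: "\<epsilon> \<in> module_hom RR (self_module RR) E"
    and inj: "inj_on \<epsilon> R" and ker: "{x \<in> carrier E. d x = \<zero>\<^bsub>F\<^esub>} = \<epsilon> ` R"
    and J: "submod J" "J \<subseteq> R" "xN \<in> J" and u: "u \<in> R" "u \<notin> J" "\<And>a. a \<in> mm \<Longrightarrow> a * u \<in> J"
    and s: "s \<in> R" "\<And>a. a \<in> mm \<Longrightarrow> a * s \<in> xR"
  obtains g where "g \<in> R" "\<And>j. j \<in> J \<Longrightarrow> g * j \<in> xR" "g * u - s \<in> xR"
proof -
  note eps = module_homD[OF \<epsilon>, unfolded self_module_def, simplified]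
  interpret E: module RR E by (rule E)
  interpret F: module RR F by (rule F)
  note dm = module_homD[OF d] and sm = smult_facts[OF E(1)]
  \<comment> \<open>Multiplication by the fraction s / z^N, as a map from \<open>mm\<close> to
    R.\<close>
  define q where "q a = fps_shift N (a * s)" for a
  have q: "q a \<in> R" "a * s = xN * q a" if "a \<in> mm" for a
    using s(2)[OF that] by (auto simp: q_def xR_def shift_xN)
  have qadd: "q (a + b) = q a + q b" for a b
    by (simp add: q_def fps_shift_add algebra_simps)
  have qmult: "q (r * a) = r * q a" if "a \<in> mm" for r a
  proof -
    have "q (r * a) = fps_shift N (xN * (r * q a))"
      using q(2)[OF that] by (simp add: q_def mult.assoc mult.left_commute)
    then show ?thesis by (simp only: shift_xN)
  qed
  have "linmap E mm (\<lambda>a. \<epsilon> (q a))"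
    unfolding linmap_def using q(1) by (auto simp: qadd qmult eps)
  moreover have "(\<lambda>a. \<epsilon> (q a)) ` mm \<subseteq> carrier E" "mm \<subseteq> R" using q(1) eps(1) mm_R by auto
  ultimately obtain e where e: "e \<in> carrier E" "\<And>a. a \<in> mm \<Longrightarrow> \<epsilon> (q a) = a \<odot> e"
    using baerD[OF E(2) submod_mm _ xN_mm] by metis
  have "a \<odot>\<^bsub>F\<^esub> d e = \<zero>\<^bsub>F\<^esub>" if "a \<in> mm" for a
  proof -
    have "\<epsilon> (q a) \<in> {x \<in> carrier E. d x = \<zero>\<^bsub>F\<^esub>}" using q(1)[OF that] ker by blast
    then show ?thesis using dm(3)[OF mm_R[OF that] e(1)] e(2)[OF that] by simp
  qed
  from baer_annihilated[OF F(1) submodule_image[OF E(1) F(1) d] F(2) J u imageI[OF e(1)] this]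
  obtain w' where w': "w' \<in> d ` carrier E" "\<And>j. j \<in> J \<Longrightarrow> j \<odot>\<^bsub>F\<^esub> w' = \<zero>\<^bsub>F\<^esub>" "u \<odot>\<^bsub>F\<^esub> w' = d e"
    by blast
  obtain w where w: "w \<in> carrier E" "w' = d w" using w'(1) by blast
  have Jw: "\<exists>k\<in>R. j \<odot> w = \<epsilon> k" if "j \<in> J" for j
  proof -
    have "j \<in> R" using that J by blast
    then have "d (j \<odot> w) = \<zero>\<^bsub>F\<^esub>" "j \<odot> w \<in> carrier E"
      using trans[OF dm(3)[OF _ w(1)] w'(2)[OF that, unfolded w(2)]] sm(1)[OF _ w(1)] by blast+
    then show ?thesis using ker by blast
  qed
  \<comment> \<open>Multiplication by \<open>w\<close> maps \<open>J\<close> into the copy of R. As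
    z^N lies in \<open>J\<close> and is not a zero divisor, this map is multiplication by g / z^N,
    where \<open>g\<close> corresponds to z^N w.\<close>
  obtain g where g: "g \<in> R" "xN \<odot> w = \<epsilon> g" using Jw[OF J(3)] by blast
  have uw: "u \<odot> w \<in> carrier E" using sm(1) u(1) w(1) by blast
  have "u \<odot> w \<ominus> e \<in> {x \<in> carrier E. d x = \<zero>\<^bsub>F\<^esub>}"
  proof -
    have eq: "d (u \<odot> w) = d e"
      by (rule trans[OF dm(3)[OF u(1) w(1)] w'(3)[unfolded w(2)]])
    have "d (u \<odot> w \<ominus> e) = d e \<ominus>\<^bsub>F\<^esub> d e"
      by (simp only: module_hom_minus[OF E(1) F(1) d uw e(1)] eq)
    also have "\<dots> = \<zero>\<^bsub>F\<^esub>"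
      by (simp only: F.minus_eq F.r_neg[OF dm(1)[OF e(1)]])
    finally have "d (u \<odot> w \<ominus> e) = \<zero>\<^bsub>F\<^esub>" .
    then show ?thesis using uw e(1) by blast
  qed
  then have "u \<odot> w \<ominus> e \<in> \<epsilon> ` R" unfolding ker .
  then obtain b where b: "b \<in> R" "u \<odot> w \<ominus> e = \<epsilon> b" by (elim imageE)
  have uwe: "u \<odot> w = e \<oplus> \<epsilon> b"
  proof -
    have "u \<odot> w = (u \<odot> w \<ominus> e) \<oplus> e"
      using uw e(1) by (simp add: E.minus_eq E.a_assoc E.l_neg)
    then show ?thesis using b(2) E.a_comm[OF e(1) eps(1)[OF b(1)]] by metis
  qed
  have "g * j \<in> xR" if "j \<in> J" for j
  proof -
    obtain k where k: "k \<in> R" "j \<odot> w = \<epsilon> k" using Jw[OF \<open>j \<in> J\<close>] by blast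
    have j: "j \<in> R" using that J by blast
    have "\<epsilon> (j * g) = (j * xN) \<odot> w"
      using eps(3)[OF j g(1)] g(2) sm(4)[OF j xN_R w(1)] by simp
    also have "\<dots> = \<epsilon> (xN * k)"
      using eps(3)[OF xN_R k(1)] k(2) sm(4)[OF xN_R j w(1)] by (simp add: mult.commute)
    finally have "j * g = xN * k"
      using inj_onD[OF inj] j g(1) k(1) xN_R R_mult by blast
    then show ?thesis using k(1) by (auto simp: xR_def mult.commute)
  qed
  moreover have "g * u - s \<in> xR"
  proof -
    have "\<epsilon> (u * g) = (u * xN) \<odot> w"
      using eps(3)[OF u(1) g(1)] g(2) sm(4)[OF u(1) xN_R w(1)] by simp
    also have "\<dots> = xN \<odot> (u \<odot> w)"
      using sm(4)[OF xN_R u(1) w(1)] by (simp add: mult.commute)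
    also have "\<dots> = xN \<odot> e \<oplus> xN \<odot> \<epsilon> b"
      using uwe sm(3)[OF xN_R e(1)] eps(1)[OF b(1)] by simp
    \<comment> \<open>The relation defining \<open>e\<close> may be used at z^N, which lies in
      \<open>mm\<close>, and \<open>q xN = s\<close>.\<close>
    also have "xN \<odot> e = \<epsilon> s"
      using e(2)[OF xN_mm] by (simp add: q_def shift_xN)
    also have "\<epsilon> s \<oplus> xN \<odot> \<epsilon> b = \<epsilon> (s + xN * b)"
      using eps(2)[OF s(1), of "xN * b"] eps(3)[OF xN_R b(1)] R_mult[OF xN_R b(1)] by simp
    finally have "u * g = s + xN * b"
      using inj_onD[OF inj] u(1) g(1) s(1) b(1) xN_R R_mult R_add by blast
    then show ?thesis using b(1) by (auto simp: xR_def mult.commute)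
  qed
  ultimately show ?thesis using that g(1) by blast
qed

lemma gorenstein_extension:
  assumes "finite_injective_dimension RR (self_module RR)"
    and J: "submod J" "J \<subseteq> R" "xN \<in> J" and u: "u \<in> R" "u \<notin> J" "\<And>a. a \<in> mm \<Longrightarrow> a * u \<in> J"
    and s: "s \<in> R" "\<And>a. a \<in> mm \<Longrightarrow> a * s \<in> xR"
  obtains g where "g \<in> R" "\<And>j. j \<in> J \<Longrightarrow> g * j \<in> xR" "g * u - s \<in> xR"
proof -
  obtain E :: "nat \<Rightarrow> ('f fps, 'f fps set) module" and \<epsilon> d k where
    res: "injective_resolution RR (self_module RR) E \<epsilon> d" and fin: "\<forall>i>k. carrier (E i) = {\<zero>\<^bsub>E i\<^esub>}"
    using assms(1) unfolding finite_injective_dimension_def by blast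
  have E: "Module.module RR (E i)" "baer (E i) (carrier (E i))" for i
    using injective_resolutionD(1)[OF res, of i] injective_imp_baer[of "E i"]
    by (simp_all add: injective_module_def)
  show ?thesis
  proof (rule lift_to_ideal[OF E(1) E(2) E(1) _ _ injective_resolutionD(2)[OF res] _ _ J u s that])
    show "baer (E 1) (d 0 ` carrier (E 0))"
      using baer_resolution[OF res fin, of 0] injective_resolutionD(6)[OF res, of 0] by simp
    show "d 0 \<in> module_hom RR (E 0) (E 1)"
      using injective_resolutionD(4)[OF res, of 0] by simp
    show "inj_on \<epsilon> R" "{x \<in> carrier (E 0). d 0 x = \<zero>\<^bsub>E 1\<^esub>} = \<epsilon> ` R"
      using injective_resolutionD(3,5)[OF res] by (simp_all add: self_module_def)
  qed
qed

end

section \<open>The type of a Gorenstein subring\<close>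

lemma add_closed_Times: "add_closed A \<Longrightarrow> add_closed B \<Longrightarrow> add_closed (A \<times> B)"
  by (auto simp: add_closed_def zero_prod_def minus_prod_def)

text \<open>Since \<open>\<theta>\<close> vanishes on R, it also vanishes on z^N \<O>; hence the
  value of \<open>\<theta>\<close> at a product f g depends only on f and g modulo z^N.\<close>

locale dualized_subring = large_subring R N for R :: "'f::{field,finite} fps set" and N +
  fixes \<theta> :: "'f fps \<Rightarrow> 'f"
  assumes theta_add: "\<theta> (f + g) = \<theta> f + \<theta> g"
    and theta_scale: "\<theta> (fps_const c * f) = c * \<theta> f"
    and theta_R: "r \<in> R \<Longrightarrow> \<theta> r = 0"
    and theta_nondegenerate: "(\<And>r. r \<in> R \<Longrightarrow> \<theta> (f * r) = 0) \<Longrightarrow> f \<in> R"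

section \<open>Colon ideals and the size of the socle\<close>

context large_subring
begin

lemma trunc_mem:
  assumes "submod J" "xN \<in> J" "a \<in> J"
  shows "trunc a \<in> J"
proof -
  have "a - trunc a \<in> J" by (rule submod_large[OF assms(1,2)]) simp
  then have "a - (a - trunc a) \<in> J" using submodD(3)[OF assms(1,3)] by blast
  then show ?thesis by simp
qed

lemma trunc_eq_0_mem: "submod J \<Longrightarrow> xN \<in> J \<Longrightarrow> trunc a = 0 \<Longrightarrow> a \<in> J"
  using submod_large[of J a] by (simp add: fps_cutoff_eq_0)

lemma add_closed_trunc: "submod J \<Longrightarrow> add_closed (trunc ` J)"
  by (simp add: add_closed_image additive_on_fps_cutoff submodD(1))

lemma card_trunc_pos: "submod J \<Longrightarrow> tcard J > 0"
  using finite_fps_cutoff submodD(2) by (metis card_gt_0_iff empty_iff image_is_empty)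

lemma R_const_part:
  assumes "r \<in> R"
  shows "r - fps_const (r $ 0) \<in> mm"
  using assms by (simp add: mm_def R_diff R_const)

text \<open>R is the sum of the constants and \<open>mm\<close>, and \<open>mm\<close> multiplies u
  into \<open>J\<close>; hence J + Ru is the direct sum of \<open>J\<close> and the line spanned by
  u.\<close>

lemma card_trunc_enlarge:
  assumes J: "submod J" "xN \<in> J" and u: "u \<notin> J" "\<And>a. a \<in> mm \<Longrightarrow> a * u \<in> J"
  shows "tcard (enlarge J u) = CARD('f) * tcard J"
proof -
  define A where "A = (UNIV :: 'f set) \<times> trunc ` J"
  define \<rho> where "\<rho> = (\<lambda>(c, y). trunc (fps_const c * u + y))"
  have closed: "add_closed A"
    unfolding A_def by (intro add_closed_Times add_closed_trunc J) (simp add: add_closed_def)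
  have add: "additive_on A \<rho>"
    by (auto simp: additive_on_def \<rho>_def fps_cutoff_diff algebra_simps fps_cutoff_add
        simp flip: fps_const_sub)
  have "\<rho> ` A = trunc ` enlarge J u"
  proof safe
    fix c y assume "(c, y) \<in> A"
    then obtain j where j: "j \<in> J" "y = trunc j" by (auto simp: A_def)
    have "trunc j + fps_const c * u \<in> enlarge J u"
      by (intro enlarge_mem R_const trunc_mem[OF J] j)
    then show "\<rho> (c, y) \<in> trunc ` enlarge J u" using j by (auto simp: \<rho>_def add.commute)
  next
    fix g assume "g \<in> enlarge J u"
    then obtain j r where *: "g = j + r * u" "j \<in> J" "r \<in> R" by (auto simp: enlarge_def)
    define y where "y = j + (r - fps_const (r $ 0)) * u"
    have "y \<in> J" unfolding y_def by (intro submodD(4)[OF J(1)] u(2) R_const_part *)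
    moreover have "g = fps_const (r $ 0) * u + y" by (simp add: * y_def algebra_simps)
    then have "trunc g = \<rho> (r $ 0, trunc y)" by (simp add: \<rho>_def fps_cutoff_add)
    ultimately show "trunc g \<in> \<rho> ` A" by (auto simp: A_def)
  qed
  moreover have "{p \<in> A. \<rho> p = 0} = {0}"
  proof -
    have "c = 0 \<and> y = 0" if "(c, y) \<in> A" "\<rho> (c, y) = 0" for c y
    proof -
      have y: "y \<in> J" "trunc y = y" using that(1) trunc_mem[OF J] by (auto simp: A_def)
      have "fps_const c * u + y \<in> J" using trunc_eq_0_mem[OF J] that(2) by (simp add: \<rho>_def)
      then have "fps_const c * u \<in> J" using submodD(3)[OF J(1) _ y(1), of "fps_const c * u + y"] by simp
      then have "fps_const c \<in> mm" using submod_unit[OF J(1) R_const, of c u] u(1) by blast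
      then have "c = 0" by (simp add: mm_def)
      then show ?thesis using that(2) y(2) by (simp add: \<rho>_def)
    qed
    moreover have "(0, 0) \<in> A" using add_closed_zero[OF closed] by (simp add: zero_prod_def)
    ultimately show ?thesis by (auto simp: zero_prod_def \<rho>_def)
  qed
  moreover have "finite A" by (simp add: A_def finite_fps_cutoff)
  ultimately have "card A = tcard (enlarge J u)"
    using card_additive[OF _ closed add] by simp
  then show ?thesis by (simp add: A_def card_cartesian_product)
qed

text \<open>\<open>star J = z\<^sup>N (R : J)\<close> and \<open>socle = z\<^sup>N (R : mm)\<close>, without fractions.\<close>

definition star :: "'f fps set \<Rightarrow> 'f fps set" where
  "star J = {g \<in> R. \<forall>j\<in>J. g * j \<in> xR}"

definition socle :: "'f fps set" where
  "socle = {s \<in> R. \<forall>a\<in>mm. a * s \<in> xR}"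

lemma submod_star: "submod (star J)"
proof -
  have "r * g * j \<in> xR" if "g * j \<in> xR" "r \<in> R" for r g j
    using submodD(6)[OF submod_xR that(2,1)] by (simp add: mult.assoc)
  then show ?thesis
    unfolding submod_def add_closed_def star_def
    by (auto simp: R_zero R_diff R_mult left_diff_distrib submodD(2,3)[OF submod_xR])
qed

lemma xN_star: "J \<subseteq> R \<Longrightarrow> xN \<in> star J"
  by (auto simp: star_def xN_R xR_def)

lemma star_antimono: "J \<subseteq> I \<Longrightarrow> star I \<subseteq> star J"
  unfolding star_def by blast

lemma submod_socle: "submod socle"
proof -
  have "a * (r * s) \<in> xR" if "a * s \<in> xR" "r \<in> R" for r s a
    using submodD(6)[OF submod_xR that(2,1)] by (simp add: mult.left_commute)
  then show ?thesis
    unfolding submod_def add_closed_def socle_def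
    by (auto simp: R_zero R_diff R_mult right_diff_distrib submodD(2,3)[OF submod_xR])
qed

lemma xR_socle: "xR \<subseteq> socle"
  using xR_R submodD(6)[OF submod_xR] mm_R by (auto simp: socle_def)

text \<open>The map (g, y) \<mapsto> g u + y from \<open>star J\<close> times z^N R to
  \<open>socle\<close> is onto by \<open>gorenstein_extension\<close>. Its kernel is a copy of the
  smaller colon ideal, since g maps J + Ru into z^N R exactly if it maps both \<open>J\<close> and u
  there. Behind this is the exact sequence 0 \<rightarrow> Hom(J + Ru, R) \<rightarrow> Hom(J, R)
  \<rightarrow> Ext^1(R / mm, R) \<rightarrow> 0.\<close>

lemma card_star_step:
  assumes gor: "finite_injective_dimension RR (self_module RR)"
    and J: "submod J" "J \<subseteq> R" "xN \<in> J" and u: "u \<in> R" "u \<notin> J" "\<And>a. a \<in> mm \<Longrightarrow> a * u \<in> J"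
  shows "tcard (star J) * tcard xR
    = tcard (star (enlarge J u)) * tcard socle"
proof -
  define A where "A = trunc ` star J \<times> trunc ` xR"
  define \<rho> where "\<rho> = (\<lambda>(g, y). trunc (g * u + y))"
  let ?I = "enlarge J u"
  have I: "?I \<subseteq> R" using enlarge_R J u by blast
  note st = submod_star[of J] xN_star[OF J(2)]
  have xs: "xN \<in> socle" using xR_socle xN_xR by blast
  have closed: "add_closed A"
    unfolding A_def by (intro add_closed_Times add_closed_trunc submod_star submod_xR)
  have add: "additive_on A \<rho>"
    by (auto simp: additive_on_def \<rho>_def fps_cutoff_diff algebra_simps fps_cutoff_add)
  have gu: "g * u \<in> socle" if "g \<in> star J" for g
  proof -
    have "a * (g * u) \<in> xR" if "a \<in> mm" for a
      using u(3)[OF that] \<open>g \<in> star J\<close> by (auto simp: star_def mult.left_commute)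
    then show ?thesis using that u(1) by (auto simp: socle_def star_def R_mult)
  qed
  have "\<rho> ` A = trunc ` socle"
  proof safe
    fix g y assume "(g, y) \<in> A"
    then have "g \<in> star J" "y \<in> xR"
      using trunc_mem[OF st] trunc_mem[OF submod_xR xN_xR] by (auto simp: A_def)
    then have "g * u + y \<in> socle"
      using gu xR_socle submodD(4)[OF submod_socle] by blast
    then show "\<rho> (g, y) \<in> trunc ` socle" by (simp add: \<rho>_def)
  next
    fix s assume "s \<in> socle"
    then have s: "s \<in> R" "\<And>a. a \<in> mm \<Longrightarrow> a * s \<in> xR" by (auto simp: socle_def)
    obtain g where g: "g \<in> R" "\<And>j. j \<in> J \<Longrightarrow> g * j \<in> xR" "g * u - s \<in> xR"
      using gorenstein_extension[OF gor J u s] by blast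
    define y where "y = s - g * u"
    have y: "y \<in> xR" using submodD(5)[OF submod_xR g(3)] by (simp add: y_def)
    have "trunc s = trunc (u * g) + trunc y" by (simp add: y_def mult.commute flip: fps_cutoff_add)
    also have "\<dots> = \<rho> (trunc g, trunc y)"
      by (simp add: \<rho>_def fps_cutoff_add mult.commute[of _ u] fps_cutoff_mult_cutoff)
    finally show "trunc s \<in> \<rho> ` A" using g y by (auto simp: A_def star_def)
  qed
  moreover have "bij_betw (\<lambda>g. (g, trunc (- (g * u)))) (trunc ` star ?I) {p \<in> A. \<rho> p = 0}"
  proof (rule bij_betw_byWitness[where f' = fst])
    show "\<forall>p\<in>{p \<in> A. \<rho> p = 0}. (fst p, trunc (- (fst p * u))) = p"
    proof
      fix p assume "p \<in> {p \<in> A. \<rho> p = 0}"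
      then obtain g y where *: "p = (g, y)" "trunc y = y" "\<rho> (g, y) = 0" by (auto simp: A_def)
      then show "(fst p, trunc (- (fst p * u))) = p"
        by (simp add: \<rho>_def fps_cutoff_add fps_cutoff_uminus add_eq_0_iff)
    qed
    show "(\<lambda>g. (g, trunc (- (g * u)))) ` trunc ` star ?I \<subseteq> {p \<in> A. \<rho> p = 0}"
    proof (intro image_subsetI, elim imageE, hypsubst)
      fix f assume "f \<in> star ?I"
      then have g: "trunc f \<in> star ?I" by (rule trunc_mem[OF submod_star xN_star[OF I]])
      then have "trunc f \<in> star J"
        by (rule subsetD[OF star_antimono[OF subset_enlarge]])
      then have "trunc f \<in> trunc ` star J" by (metis fps_cutoff_idem image_eqI)
      moreover have "trunc f * u \<in> xR" using g mem_enlarge[OF J(1)] by (auto simp: star_def)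
      then have "trunc (- (trunc f * u)) \<in> trunc ` xR" using submodD(5)[OF submod_xR] by blast
      ultimately have "(trunc f, trunc (- (trunc f * u))) \<in> A" by (simp add: A_def)
      moreover have "\<rho> (trunc f, trunc (- (trunc f * u))) = 0"
        by (simp add: \<rho>_def fps_cutoff_add fps_cutoff_uminus)
      ultimately show "(trunc f, trunc (- (trunc f * u))) \<in> {p \<in> A. \<rho> p = 0}" by blast
    qed
    show "fst ` {p \<in> A. \<rho> p = 0} \<subseteq> trunc ` star ?I"
    proof (rule image_subsetI)
      fix p assume "p \<in> {p \<in> A. \<rho> p = 0}"
      then obtain g y where *: "p = (g, y)" "(g, y) \<in> A" "\<rho> (g, y) = 0" by (cases p) auto
      then have g: "g \<in> star J" "trunc g = g" "y \<in> xR"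
        using trunc_mem[OF st] trunc_mem[OF submod_xR xN_xR] by (auto simp: A_def)
      have "g * u + y \<in> xR" using *(3) trunc_eq_0_mem[OF submod_xR xN_xR] by (simp add: \<rho>_def)
      then have gu: "g * u \<in> xR" using submodD(3)[OF submod_xR _ g(3), of "g * u + y"] by simp
      have "g * (j + r * u) \<in> xR" if "j \<in> J" "r \<in> R" for j r
      proof -
        have "g * (j + r * u) = g * j + r * (g * u)" by (simp add: algebra_simps)
        then show ?thesis
          using that g(1) gu submodD(4,6)[OF submod_xR] by (simp add: star_def)
      qed
      then have "g \<in> star ?I" using g(1) by (auto simp: star_def enlarge_def)
      then show "fst p \<in> trunc ` star ?I" using g(2) *(1) by (metis fst_conv image_eqI)
    qed
  qed simp
  then have "card {p \<in> A. \<rho> p = 0} = tcard (star ?I)"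
    by (simp add: bij_betw_same_card)
  moreover have "finite A" by (simp add: A_def finite_fps_cutoff)
  ultimately have "card A = tcard socle * tcard (star ?I)"
    using card_additive[OF _ closed add] by simp
  then show ?thesis by (simp add: A_def card_cartesian_product mult.commute)
qed

lemma star_R: "star R = xR"
proof -
  have "g \<in> xR" if "\<forall>j\<in>R. g * j \<in> xR" for g
    using that R_one by (metis mult_1_right)
  moreover have "g * j \<in> xR" if "g \<in> xR" "j \<in> R" for g j
    using submodD(6)[OF submod_xR that(2,1)] by (simp add: mult.commute)
  ultimately show ?thesis
    unfolding star_def using xR_R by blast
qed

lemma star_xR: "star xR = R"
proof -
  have "g * j \<in> xR" if "g \<in> R" "j \<in> xR" for g j
    using submodD(6)[OF submod_xR that] .
  then show ?thesis unfolding star_def by blast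
qed

text \<open>The number \<open>l\<close> is the length of R / J. Each composition factor multiplies
  the index of z^N R in the colon ideal by the index of z^N R in the socle.\<close>

lemma card_star:
  assumes gor: "finite_injective_dimension RR (self_module RR)"
    and J: "submod J" "J \<subseteq> R" "xN \<in> J"
  obtains l where "tcard R = CARD('f) ^ l * tcard J"
    "tcard (star J) * tcard xR ^ l = tcard xR * tcard socle ^ l"
proof -
  have "\<exists>l. tcard R = CARD('f) ^ l * tcard J \<and>
    tcard (star J) * tcard xR ^ l = tcard xR * tcard socle ^ l"
    using J
  proof (induction "tcard R - tcard J" arbitrary: J rule: less_induct)
    case less
    show ?case
    proof (cases "J = R")
      case True
      then show ?thesis by (intro exI[where x = 0]) (simp add: star_R)
    next
      case False
      obtain u where u: "u \<in> R" "u \<notin> J" "\<And>a. a \<in> mm \<Longrightarrow> a * u \<in> J"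
        using proper_ideal_socle[OF less.prems False] by blast
      have I: "submod (enlarge J u)" "enlarge J u \<subseteq> R" "xN \<in> enlarge J u"
        using submod_enlarge[OF less.prems(1)] enlarge_R[OF less.prems(2) u(1)] less.prems(3)
          subset_enlarge by blast+
      have lt: "tcard J < tcard (enlarge J u)"
        by (rule card_enlarge[OF less.prems u(2)])
      have "tcard (enlarge J u) \<le> tcard R"
        by (intro card_mono finite_fps_cutoff image_mono I)
      with lt have "tcard R - tcard (enlarge J u) < tcard R - tcard J"
        by linarith
      from less.hyps[OF this I] obtain l where l:
        "tcard R = CARD('f) ^ l * tcard (enlarge J u)"
        "tcard (star (enlarge J u)) * tcard xR ^ l = tcard xR * tcard socle ^ l"
        by blast
      have "tcard R = CARD('f) ^ Suc l * tcard J"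
        using l(1) card_trunc_enlarge[OF less.prems(1,3) u(2,3)] by simp
      moreover have "tcard (star J) * tcard xR ^ Suc l
          = tcard xR * tcard socle ^ Suc l"
        using l(2) card_star_step[OF gor less.prems u] by (simp flip: mult.assoc)
      ultimately show ?thesis by blast
    qed
  qed
  then show ?thesis using that by blast
qed

text \<open>For J = z^N R the colon ideal is R, so the index of z^N R in R is both q^l and the l-th
  power of its index in \<open>socle\<close>. Taking roots requires l > 0, which holds because 1 is
  not in z^N R.\<close>

lemma card_socle:
  assumes "finite_injective_dimension RR (self_module RR)"
  shows "tcard socle = CARD('f) * tcard xR"
proof -
  let ?x = "tcard xR" and ?s = "tcard socle"
  obtain l where l: "tcard R = CARD('f) ^ l * ?x" "tcard (star xR) * ?x ^ l = ?x * ?s ^ l"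
    using card_star[OF assms submod_xR xR_R xN_xR] by blast
  have "?x > 0" by (rule card_trunc_pos[OF submod_xR])
  with l have "(CARD('f) * ?x) ^ l = ?s ^ l"
    by (simp add: star_xR power_mult_distrib)
  moreover have "l > 0"
  proof (rule ccontr)
    assume "\<not> l > 0"
    then have "tcard xR = tcard R" using l(1) by simp
    then have "xR = R"
      using eq_of_card_image_eq[OF xR_R submodD(1)[OF submod_xR] submodD(1)[OF submod_R]
          additive_on_fps_cutoff trunc_eq_0_mem[OF submod_xR xN_xR] finite_fps_cutoff] by blast
    then show False using one_notin_xR R_one by blast
  qed
  ultimately show ?thesis using power_eq_imp_eq_base[of "CARD('f) * ?x" l ?s] by simp
qed

lemma socle_eq_enlarge:
  assumes gor: "finite_injective_dimension RR (self_module RR)"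
    and s: "s \<in> socle" "s \<notin> xR"
  shows "socle = enlarge xR s"
proof -
  have "y + r * s \<in> socle" if "y \<in> xR" "r \<in> R" for y r
    using submodD(4)[OF submod_socle subsetD[OF xR_socle that(1)] submodD(6)[OF submod_socle that(2) s(1)]] .
  then have sub: "enlarge xR s \<subseteq> socle"
    unfolding enlarge_def by blast
  have I: "submod (enlarge xR s)" "xN \<in> enlarge xR s"
    using submod_enlarge[OF submod_xR] xN_xR subset_enlarge by blast+
  have "tcard (enlarge xR s) = tcard socle"
    using card_trunc_enlarge[OF submod_xR xN_xR s(2)] s(1) card_socle[OF gor] by (auto simp: socle_def)
  then show ?thesis
    using eq_of_card_image_eq[OF sub submodD(1)[OF I(1)] submodD(1)[OF submod_socle]
        additive_on_fps_cutoff trunc_eq_0_mem[OF I] finite_fps_cutoff] by blast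
qed

text \<open>A vector space basis of R stays independent when s is added, so the functional can be
  prescribed there and extended to \<O>. Its continuity is automatic, as R contains a power of z
  times \<O>.\<close>

lemma separating_functional:
  assumes "s \<notin> R"
  obtains \<theta> :: "'f fps \<Rightarrow> 'f" where "\<And>f g. \<theta> (f + g) = \<theta> f + \<theta> g" "\<And>c f. \<theta> (fps_const c * f) = c * \<theta> f"
    "\<And>r. r \<in> R \<Longrightarrow> \<theta> r = 0" "\<theta> s = 1"
proof -
  interpret V: vector_space "\<lambda>c (f :: 'f fps). fps_const c * f"
    by unfold_locales (auto simp: algebra_simps simp flip: fps_const_add fps_const_mult)
  interpret F: vector_space "(*) :: 'f \<Rightarrow> 'f \<Rightarrow> 'f"
    by unfold_locales (auto simp: algebra_simps)
  interpret P: vector_space_pair "\<lambda>c (f :: 'f fps). fps_const c * f" "(*) :: 'f \<Rightarrow> 'f \<Rightarrow> 'f" ..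
  have R: "V.subspace R" by (simp add: V.subspace_def R_zero R_add R_mult R_const)
  obtain B where B: "B \<subseteq> R" "V.independent B" "R \<subseteq> V.span B"
    using V.maximal_independent_subset[of R] by blast
  then have span: "V.span B = R" using V.span_minimal[OF B(1) R] by blast
  then have "V.independent (insert s B)" using assms B(2) V.independent_insert by auto
  then obtain g where g: "Vector_Spaces.linear (\<lambda>c f. fps_const c * f) (*) g"
    "\<forall>x\<in>insert s B. g x = (if x = s then 1 else 0)"
    using P.linear_independent_extend[of "insert s B" "\<lambda>x. if x = s then 1 else 0"] by blast
  interpret g: Vector_Spaces.linear "\<lambda>c f. fps_const c * f" "(*)" g by fact
  have "s \<notin> B" using B(1) assms by blast
  then have "g b = 0" if "b \<in> B" for b using that g(2) by auto
  then have "g r = 0" if "r \<in> R" for r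
    using g.eq_0_on_span[of B r] that span by blast
  then show ?thesis using that[of g] g.add g.scale g(2) by auto
qed

text \<open>
  A functional that vanishes on \<open>R\<close> and not on the socle of \<open>\<O> / R\<close> is nondegenerate, since the socle
  is a line that every nonzero submodule of \<open>\<O> / R\<close> meets.
\<close>

lemma dualizing_functional:
  assumes gor: "finite_injective_dimension RR (self_module RR)"
  shows "\<exists>\<theta>. dualized_subring R N \<theta>"
proof (cases "R = UNIV")
  case True
  \<comment> \<open>Here \<O> / R is zero and has no socle element to detect.\<close>
  have "dualized_subring R N (\<lambda>_. 0)" by unfold_locales (simp_all add: True)
  then show ?thesis by blast
next
  case False
  then obtain f where "f \<notin> R" by blast
  have large: "g \<in> R" if "\<forall>k<N. g $ k = 0" for g using R_large that by blast
  obtain r where r: "r \<in> R" "r * f \<notin> R" "\<And>a. a \<in> mm \<Longrightarrow> a * (r * f) \<in> R"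
    using socle_multiple[OF submod_R large \<open>f \<notin> R\<close>] by blast
  define s where "s = r * f"
  have s: "s \<notin> R" "\<And>a. a \<in> mm \<Longrightarrow> a * s \<in> R" using r by (auto simp: s_def)
  \<comment> \<open>Multiplication by z^N moves (R : mm) into \<open>socle\<close>, which
    \<open>socle_eq_enlarge\<close> describes by a single generator.\<close>
  have soc: "xN * h \<in> socle" if "\<And>a. a \<in> mm \<Longrightarrow> a * h \<in> R" for h
    using that xN_mult_R by (auto simp: socle_def xR_def mult.left_commute)
  have xs: "xN * s \<notin> xR" using s(1) by (auto simp: xR_def)
  obtain \<theta> :: "'f fps \<Rightarrow> 'f" where l: "\<And>f g. \<theta> (f + g) = \<theta> f + \<theta> g" "\<And>c f. \<theta> (fps_const c * f) = c * \<theta> f"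
    "\<And>r. r \<in> R \<Longrightarrow> \<theta> r = 0" "\<theta> s = 1"
    using separating_functional[OF s(1)] by blast
  have "g \<in> R" if g: "\<And>r. r \<in> R \<Longrightarrow> \<theta> (g * r) = 0" for g
  proof (rule ccontr)
    assume "g \<notin> R"
    then obtain r where r: "r \<in> R" "r * g \<notin> R" "\<And>a. a \<in> mm \<Longrightarrow> a * (r * g) \<in> R"
      using socle_multiple[OF submod_R large \<open>g \<notin> R\<close>] by blast
    have "xN * (r * g) \<in> enlarge xR (xN * s)"
      using soc[OF r(3)] socle_eq_enlarge[OF gor soc[OF s(2)] xs] by simp
    then obtain b c where bc: "b \<in> R" "c \<in> R" "xN * (r * g) = xN * b + c * (xN * s)"
      by (auto simp: enlarge_def xR_def)
    then have "xN * (r * g) = xN * (b + c * s)" by (simp add: algebra_simps)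
    then have eq: "r * g = b + c * s" by simp
    have c0: "c $ 0 \<noteq> 0"
    proof
      assume "c $ 0 = 0"
      then have "c * s \<in> R" using s(2) bc(2) by (simp add: mm_def)
      then show False using eq r(2) bc(1) R_add by simp
    qed
    \<comment> \<open>Only the constant term of \<open>c\<close> matters for
      \<open>\<theta>\<close>: the rest of \<open>c\<close> lies in \<open>mm\<close> and multiplies
      \<open>s\<close> into R.\<close>
    have "c * s = fps_const (c $ 0) * s + (c - fps_const (c $ 0)) * s" by (simp add: algebra_simps)
    then have "\<theta> (c * s) = c $ 0 * \<theta> s + \<theta> ((c - fps_const (c $ 0)) * s)" using l(1,2) by simp
    then have "\<theta> (c * s) = c $ 0" using l(3)[OF s(2)[OF R_const_part[OF bc(2)]]] l(4) by simp
    then have "\<theta> (r * g) = c $ 0" using eq l(1) l(3)[OF bc(1)] by simp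
    then show False using g[OF r(1)] c0 by (simp add: mult.commute)
  qed
  then have "dualized_subring R N \<theta>" by unfold_locales (use l in auto)
  then show ?thesis by blast
qed

end

section \<open>Orthogonality for a bilinear pairing over a finite field\<close>

lemma card_field_gt_1: "1 < CARD('f::{field,finite})"
proof -
  have "card {0, 1 :: 'f} \<le> CARD('f)" by (rule card_mono) auto
  then show ?thesis by simp
qed

lemma card_zeros_functional:
  fixes \<phi> :: "'v::ab_group_add \<Rightarrow> 'f::{field,finite}"
  assumes B: "finite B" "add_closed B" "\<And>c b. b \<in> B \<Longrightarrow> sc c b \<in> B"
    and \<phi>: "additive_on B \<phi>" "\<And>c b. b \<in> B \<Longrightarrow> \<phi> (sc c b) = c * \<phi> b"
    and nz: "b0 \<in> B" "\<phi> b0 \<noteq> 0"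
  shows "card B = CARD('f) * card {b \<in> B. \<phi> b = 0}"
proof -
  have "c \<in> \<phi> ` B" for c
    using \<phi>(2)[OF nz(1), of "c / \<phi> b0"] B(3)[OF nz(1), of "c / \<phi> b0"] nz(2)
    by (metis image_eqI nonzero_eq_divide_eq)
  then have "\<phi> ` B = UNIV" by blast
  then show ?thesis using card_additive[OF B(1,2) \<phi>(1)] by simp
qed

text \<open>The pairs with \<open>\<beta> a b = 0\<close> are counted in two ways.\<close>

lemma card_orthogonal:
  fixes \<beta> :: "'v::ab_group_add \<Rightarrow> 'v \<Rightarrow> 'f::{field,finite}"
  assumes A: "finite A" "add_closed A" "\<And>c a. a \<in> A \<Longrightarrow> sc c a \<in> A"
    and B: "finite B" "add_closed B" "\<And>c b. b \<in> B \<Longrightarrow> sc c b \<in> B"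
    and \<beta>: "\<And>a b c. \<beta> (a - b) c = \<beta> a c - \<beta> b c" "\<And>a b c. \<beta> c (a - b) = \<beta> c a - \<beta> c b"
      "\<And>k a b. \<beta> (sc k a) b = k * \<beta> a b" "\<And>k a b. \<beta> a (sc k b) = k * \<beta> a b"
  shows "card {a \<in> A. \<forall>b\<in>B. \<beta> a b = 0} * card B = card A * card {b \<in> B. \<forall>a\<in>A. \<beta> a b = 0}"
proof -
  define q where "q = CARD('f)"
  have q: "q \<ge> 2" using card_field_gt_1[where 'f = 'f] by (simp add: q_def)
  \<comment> \<open>An element of \<open>A\<close> that is orthogonal to \<open>B\<close> has card B
    zeros, any other has card B / q; the factor q avoids the division. In comparing the two counts
    the symmetric term \<open>card A * card B\<close> cancels.\<close>
  have count: "q * (\<Sum>a\<in>A. card {b \<in> B. \<gamma> a b = 0}) =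
      (q - 1) * (card {a \<in> A. \<forall>b\<in>B. \<gamma> a b = 0} * card B) + card A * card B"
    if A: "finite A" and B: "finite B" "add_closed B" "\<And>c b. b \<in> B \<Longrightarrow> sc c b \<in> B"
    and \<gamma>: "\<And>a b c. \<gamma> c (a - b) = \<gamma> c a - \<gamma> c b" "\<And>k a b. \<gamma> a (sc k b) = k * \<gamma> a b"
    for A B :: "'v set" and \<gamma> :: "'v \<Rightarrow> 'v \<Rightarrow> 'f"
  proof -
    let ?Z = "{a \<in> A. \<forall>b\<in>B. \<gamma> a b = 0}"
    have 1: "q * card {b \<in> B. \<gamma> a b = 0} = (if a \<in> ?Z then (q - 1) * card B else 0) + card B"
      if aA: "a \<in> A" for a
    proof (cases "a \<in> ?Z")
      case True
      then have "{b \<in> B. \<gamma> a b = 0} = B" by blast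
      then show ?thesis using True q by (simp add: algebra_simps)
    next
      case False
      then obtain b where "b \<in> B" "\<gamma> a b \<noteq> 0" using aA by blast
      then have "card B = q * card {b \<in> B. \<gamma> a b = 0}"
        unfolding q_def using B \<gamma> by (intro card_zeros_functional[where sc = sc]) (auto simp: additive_on_def)
      then show ?thesis by (simp only: if_not_P[OF False])
    qed
    have "q * (\<Sum>a\<in>A. card {b \<in> B. \<gamma> a b = 0})
        = (\<Sum>a\<in>A. (if a \<in> ?Z then (q - 1) * card B else 0) + card B)"
      unfolding sum_distrib_left by (rule sum.cong) (use 1 in auto)
    also have "\<dots> = (\<Sum>a\<in>A. if a \<in> ?Z then (q - 1) * card B else 0) + card A * card B"
      by (simp add: sum.distrib)
    also have "(\<Sum>a\<in>A. if a \<in> ?Z then (q - 1) * card B else 0) = (\<Sum>a\<in>A \<inter> ?Z. (q - 1) * card B)"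
      using A by (simp only: sum.inter_restrict)
    also have "A \<inter> ?Z = ?Z" by blast
    finally show ?thesis by simp
  qed
  have "(\<Sum>a\<in>A. card {b \<in> B. \<beta> a b = 0}) = (\<Sum>b\<in>B. card {a \<in> A. \<beta> a b = 0})"
    using sum.swap_restrict[OF A(1) B(1), of "\<lambda>_ _. 1 :: nat" "\<lambda>a b. \<beta> a b = 0"] by simp
  then have "(q - 1) * (card {a \<in> A. \<forall>b\<in>B. \<beta> a b = 0} * card B)
      = (q - 1) * (card {b \<in> B. \<forall>a\<in>A. \<beta> a b = 0} * card A)"
    using count[OF A(1) B, of \<beta>] count[OF B(1) A, of "\<lambda>b a. \<beta> a b"] \<beta>
    by (auto simp add: mult.commute)
  then show ?thesis using q by (simp add: mult.commute)
qed


section \<open>Lattices in free modules and their duals\<close>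

lemma sum_fun_apply: "(\<Sum>i\<in>I. f i) x = (\<Sum>i\<in>I. f i x)"
  for f :: "'a \<Rightarrow> 'b \<Rightarrow> 'c::comm_monoid_add"
  by (induction I rule: infinite_finite_induct) auto

context large_subring
begin

text \<open>Vectors of length n are encoded as functions that are zero from n on, unlike the partial
  functions of \<open>free_module\<close>, so that they belong to an additive group type.\<close>

definition VV :: "nat \<Rightarrow> (nat \<Rightarrow> 'f fps) set" where
  "VV n = {v. \<forall>i\<ge>n. v i = 0}"

definition scal :: "'f fps \<Rightarrow> (nat \<Rightarrow> 'f fps) \<Rightarrow> nat \<Rightarrow> 'f fps" where
  "scal r v = (\<lambda>i. r * v i)"

text \<open>In contrast to ideals, truncation at \<open>N\<close> is enough here: all lattices that
  are counted contain z^N \<O>^n.\<close>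

definition vt :: "(nat \<Rightarrow> 'f fps) \<Rightarrow> nat \<Rightarrow> 'f fps" where
  "vt v = (\<lambda>i. fps_cutoff N (v i))"

definition vmod :: "nat \<Rightarrow> (nat \<Rightarrow> 'f fps) set \<Rightarrow> bool" where
  "vmod n M \<longleftrightarrow> M \<subseteq> VV n \<and> add_closed M \<and> (\<forall>r\<in>R. \<forall>v\<in>M. scal r v \<in> M)"

text \<open>The conductor by its elements; \<open>conductor_eq\<close> identifies it with the
  greatest ideal inside R.\<close>

definition cond :: "'f fps set" where
  "cond = {f. \<forall>g. f * g \<in> R}"

definition RV :: "nat \<Rightarrow> (nat \<Rightarrow> 'f fps) set" where
  "RV n = {v \<in> VV n. \<forall>i. v i \<in> R}"

definition CV :: "nat \<Rightarrow> (nat \<Rightarrow> 'f fps) set" where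
  "CV n = {v \<in> VV n. \<forall>i. v i \<in> cond}"

text \<open>The lattice z^N \<O>^n, the kernel of truncation.\<close>

definition ZV :: "nat \<Rightarrow> (nat \<Rightarrow> 'f fps) set" where
  "ZV n = {v \<in> VV n. vt v = 0}"

abbreviation sz :: "(nat \<Rightarrow> 'f fps) set \<Rightarrow> nat" where
  "sz M \<equiv> card (vt ` M)"

definition dot :: "nat \<Rightarrow> (nat \<Rightarrow> 'f fps) \<Rightarrow> (nat \<Rightarrow> 'f fps) \<Rightarrow> 'f fps" where
  "dot n f g = (\<Sum>i<n. f i * g i)"

lemma vmodD:
  assumes "vmod n M"
  shows "M \<subseteq> VV n" "add_closed M" "0 \<in> M" "a \<in> M \<Longrightarrow> b \<in> M \<Longrightarrow> a - b \<in> M" "a \<in> M \<Longrightarrow> b \<in> M \<Longrightarrow> a + b \<in> M"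
    "r \<in> R \<Longrightarrow> a \<in> M \<Longrightarrow> scal r a \<in> M"
  using assms by (auto simp: vmod_def add_closed_zero add_closed_diff add_closed_add)

lemma vt_diff: "vt (v - w) = vt v - vt w"
  by (simp add: vt_def fun_eq_iff fps_cutoff_diff)

lemma vt_add: "vt (v + w) = vt v + vt w"
  by (simp add: vt_def fun_eq_iff fps_cutoff_add)

lemma vt_idem [simp]: "vt (vt v) = vt v"
  by (simp add: vt_def)

lemma vt_0 [simp]: "vt 0 = 0"
  by (simp add: vt_def fun_eq_iff)

lemma additive_on_vt: "additive_on M vt"
  by (simp add: additive_on_def vt_diff)

lemma vt_eq_0_iff: "vt v = 0 \<longleftrightarrow> (\<forall>i. \<forall>k<N. v i $ k = 0)"
  by (simp add: vt_def fun_eq_iff fps_cutoff_eq_0)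

lemma vt_VV: "v \<in> VV n \<Longrightarrow> vt v \<in> VV n"
  by (simp add: VV_def vt_def)

lemma add_closed_VV: "add_closed (VV n)"
  by (simp add: VV_def add_closed_def)

lemma scal_VV: "v \<in> VV n \<Longrightarrow> scal r v \<in> VV n"
  by (simp add: VV_def scal_def)

lemma vmod_VV: "vmod n (VV n)"
  by (simp add: vmod_def add_closed_VV scal_VV)

lemma vmod_RV: "vmod n (RV n)"
  by (auto simp: vmod_def add_closed_def RV_def VV_def scal_def R_zero R_diff R_mult)

lemma cond_R: "f \<in> cond \<Longrightarrow> f \<in> R"
  by (auto simp: cond_def dest: spec[of _ 1])

lemma R_large_mult: "\<forall>k<N. f $ k = 0 \<Longrightarrow> f * g \<in> R"
proof -
  assume "\<forall>k<N. f $ k = 0"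
  then have "f * g = xN * (fps_shift N f * g)" using xN_shift[of f] by (metis mult.assoc)
  then show ?thesis using xN_mult_R by metis
qed

lemma vmod_CV: "vmod n (CV n)"
  by (auto simp: vmod_def add_closed_def CV_def VV_def scal_def R_zero R_diff R_mult cond_def
      algebra_simps)

lemma CV_RV: "CV n \<subseteq> RV n"
  by (auto simp: CV_def RV_def cond_R)

lemma ZV_CV: "ZV n \<subseteq> CV n"
  by (auto simp: ZV_def CV_def cond_def vt_eq_0_iff R_large_mult)

lemma finite_vt: "M \<subseteq> VV n \<Longrightarrow> finite (vt ` M)"
proof (rule finite_subset)
  let ?F = "\<lambda>h i. if i < n then h i else (0 :: 'f fps)"
  assume M: "M \<subseteq> VV n"
  show "vt ` M \<subseteq> ?F ` ({..<n} \<rightarrow>\<^sub>E range (fps_cutoff N))"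
  proof (rule image_subsetI)
    fix v assume "v \<in> M"
    then have "vt v = ?F (restrict (vt v) {..<n})"
      using M by (auto simp: VV_def vt_def fun_eq_iff)
    moreover have "restrict (vt v) {..<n} \<in> {..<n} \<rightarrow>\<^sub>E range (fps_cutoff N)"
      by (auto simp: vt_def)
    ultimately show "vt v \<in> ?F ` ({..<n} \<rightarrow>\<^sub>E range (fps_cutoff N))" by blast
  qed
qed (intro finite_imageI finite_PiE finite_lessThan finite_fps_cutoff)

lemma sz_pos: "vmod n M \<Longrightarrow> sz M > 0"
  using finite_vt[OF vmodD(1)] vmodD(3) by (metis card_gt_0_iff empty_iff image_is_empty)

lemma diff_vt_ZV: "v \<in> VV n \<Longrightarrow> v - vt v \<in> ZV n"
  using add_closed_diff[OF add_closed_VV _ vt_VV] by (simp add: ZV_def vt_diff)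

lemma vt_mem:
  assumes "vmod n M" "ZV n \<subseteq> M" "v \<in> M"
  shows "vt v \<in> M"
proof -
  have "v - (v - vt v) \<in> M"
    by (intro vmodD(4)[OF assms(1,3)] subsetD[OF assms(2)] diff_vt_ZV subsetD[OF vmodD(1)[OF assms(1)] assms(3)])
  then show ?thesis by simp
qed

lemma vmod_eq_of_vt:
  assumes "A \<subseteq> B" "vmod n A" "vmod n B" "ZV n \<subseteq> A" "sz A = sz B"
  shows "A = B"
  using eq_of_card_image_eq[OF assms(1) vmodD(2)[OF assms(2)] vmodD(2)[OF assms(3)] additive_on_vt
      _ finite_vt[OF vmodD(1)[OF assms(3)]] assms(5)] vmodD(1)[OF assms(3)] assms(4)
  by (auto simp: ZV_def)

lemma dot_commute: "dot n f g = dot n g f"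
  by (simp add: dot_def mult.commute)

lemma dot_diff: "dot n (f - f') g = dot n f g - dot n f' g"
  by (simp add: dot_def left_diff_distrib sum_subtractf)

lemma dot_scal: "dot n (scal r f) g = r * dot n f g"
  by (simp add: dot_def scal_def sum_distrib_left mult.assoc)

lemma dot_diff_right: "dot n g (f - f') = dot n g f - dot n g f'"
  by (simp add: dot_def right_diff_distrib sum_subtractf)

lemma dot_scal_right: "dot n f (scal r g) = r * dot n f g"
  by (simp add: dot_def scal_def sum_distrib_left mult.left_commute)

lemma dot_large: "vt f = 0 \<Longrightarrow> dot n f g \<in> R"
  unfolding dot_def by (intro R_sum R_large_mult) (simp add: vt_eq_0_iff)

definition upper :: "nat \<Rightarrow> (nat \<Rightarrow> 'f fps) set set" where
  "upper n = {L. vmod n L \<and> RV n \<subseteq> L}"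

definition unit_vec :: "nat \<Rightarrow> 'f fps \<Rightarrow> nat \<Rightarrow> 'f fps" where
  "unit_vec j f = (\<lambda>i. if i = j then f else 0)"

lemma unit_vec_VV: "j < n \<Longrightarrow> unit_vec j f \<in> VV n"
  by (simp add: unit_vec_def VV_def)

lemma dot_unit_vec: "j < n \<Longrightarrow> dot n f (unit_vec j g) = f j * g"
  by (simp add: dot_def unit_vec_def if_distrib[of "(*) _"] cong: if_cong)

end

section \<open>Orthogonal lattices\<close>

context dualized_subring
begin

lemma theta_diff: "\<theta> (f - g) = \<theta> f - \<theta> g"
  using theta_add[of "f - g" g] by simp

definition ortho :: "nat \<Rightarrow> (nat \<Rightarrow> 'f fps) set \<Rightarrow> (nat \<Rightarrow> 'f fps) set" where
  "ortho n Y = {f \<in> VV n. \<forall>g\<in>Y. \<theta> (dot n f g) = 0}"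

lemma vmod_ortho:
  assumes "vmod n Y"
  shows "vmod n (ortho n Y)"
proof -
  have "\<theta> (dot n (scal r f) g) = 0" if "\<forall>g\<in>Y. \<theta> (dot n f g) = 0" "g \<in> Y" "r \<in> R" for r f g
  proof -
    have "dot n (scal r f) g = dot n f (scal r g)" by (metis dot_scal dot_commute)
    then show ?thesis using that vmodD(6)[OF assms] by simp
  qed
  moreover have "\<theta> (dot n 0 g) = 0" for g
    using theta_R[OF R_zero] by (simp add: dot_def)
  ultimately show ?thesis
    unfolding vmod_def add_closed_def ortho_def
    by (auto simp: dot_diff theta_diff scal_VV add_closed_zero[OF add_closed_VV] add_closed_diff[OF add_closed_VV])
qed

lemma ortho_antimono: "Y \<subseteq> W \<Longrightarrow> ortho n W \<subseteq> ortho n Y"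
  by (auto simp: ortho_def)

lemma ortho_ortho_subset: "Y \<subseteq> VV n \<Longrightarrow> Y \<subseteq> ortho n (ortho n Y)"
  by (auto simp: ortho_def dot_commute)

lemma theta_sum: "\<theta> (\<Sum>i\<in>I. f i) = (\<Sum>i\<in>I. \<theta> (f i))"
  using theta_R[OF R_zero] by (induction I rule: infinite_finite_induct) (simp_all add: theta_add)

text \<open>Testing against multiples of unit vectors separates the coordinates. This handles \<O>^n
  and R^n at once.\<close>

lemma ortho_coordinates:
  assumes S: "0 \<in> S" and T: "0 \<in> T" "\<And>f. f \<in> T \<longleftrightarrow> (\<forall>s\<in>S. \<theta> (f * s) = 0)"
  shows "ortho n {v \<in> VV n. \<forall>i. v i \<in> S} = {v \<in> VV n. \<forall>i. v i \<in> T}"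
proof -
  have "(\<forall>g\<in>{v \<in> VV n. \<forall>i. v i \<in> S}. \<theta> (dot n f g) = 0) \<longleftrightarrow> (\<forall>i. f i \<in> T)" if f: "f \<in> VV n" for f
  proof (intro iffI allI ballI)
    fix i assume *: "\<forall>g\<in>{v \<in> VV n. \<forall>i. v i \<in> S}. \<theta> (dot n f g) = 0"
    show "f i \<in> T"
    proof (cases "i < n")
      case True
      have "\<theta> (f i * s) = 0" if "s \<in> S" for s
      proof -
        have "unit_vec i s \<in> {v \<in> VV n. \<forall>i. v i \<in> S}"
          using unit_vec_VV[OF True] S that by (simp add: unit_vec_def)
        then have "\<theta> (dot n f (unit_vec i s)) = 0" using * by blast
        then show ?thesis by (simp only: dot_unit_vec[OF True])
      qed
      then show ?thesis using T(2) by blast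
    next
      case False
      then show ?thesis using f T(1) by (simp add: VV_def)
    qed
  next
    fix g assume "\<forall>i. f i \<in> T" "g \<in> {v \<in> VV n. \<forall>i. v i \<in> S}"
    then show "\<theta> (dot n f g) = 0" using T(2) by (simp add: dot_def theta_sum)
  qed
  then show ?thesis unfolding ortho_def by blast
qed

text \<open>If \<open>\<theta>\<close> vanishes on f \<O>, then for every g it vanishes on the
  multiples of f g by elements of R, so f g lies in R by nondegeneracy. Thus the annihilator of \<O>
  is the conductor.\<close>

lemma ortho_VV: "ortho n (VV n) = CV n"
proof -
  have "f * g \<in> R" if "\<forall>s. \<theta> (f * s) = 0" for f g
    by (rule theta_nondegenerate) (simp add: mult.assoc that)
  then have cond: "f \<in> cond \<longleftrightarrow> (\<forall>s\<in>UNIV. \<theta> (f * s) = 0)" for f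
    using theta_R by (auto simp: cond_def)
  have "0 \<in> cond" by (simp add: cond_def R_zero)
  from ortho_coordinates[OF UNIV_I this cond, of n] show ?thesis by (simp add: CV_def)
qed

lemma ortho_RV: "ortho n (RV n) = RV n"
  unfolding RV_def using theta_R R_mult theta_nondegenerate R_zero by (intro ortho_coordinates) blast+

lemma theta_dot_vt: "\<theta> (dot n (vt f) g) = \<theta> (dot n f g)"
proof -
  have "vt (f - vt f) = 0" by (simp add: vt_diff)
  then have "\<theta> (dot n (f - vt f) g) = 0" by (intro theta_R dot_large)
  then show ?thesis by (simp add: dot_diff theta_diff)
qed

lemma theta_dot_vt_right: "\<theta> (dot n f (vt g)) = \<theta> (dot n f g)"
  using theta_dot_vt[of n g f] by (simp add: dot_commute)

text \<open>Modulo z^N this is \<open>card_orthogonal\<close> for \<open>Y\<close> and \<O>^n. The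
  kernel in \<open>Y\<close> is the intersection of \<open>Y\<close> with \<open>CV n\<close>, which
  is \<open>CV n\<close>; the kernel in \<O>^n is the orthogonal complement of
  \<open>Y\<close>.\<close>

lemma sz_ortho:
  assumes Y: "vmod n Y" "CV n \<subseteq> Y"
  shows "sz Y * sz (ortho n Y) = sz (VV n) * sz (CV n)"
proof -
  let ?b = "\<lambda>f g. \<theta> (dot n f g)" and ?sc = "\<lambda>c. scal (fps_const c)"
  have sc: "?sc c v \<in> vt ` M" if "vmod n M" "v \<in> vt ` M" for c v M
  proof -
    from that(2) obtain w where w: "w \<in> M" "v = vt w" by blast
    then have "?sc c v = vt (?sc c w)"
      by (simp add: vt_def scal_def fun_eq_iff fps_eq_iff)
    then show ?thesis using vmodD(6)[OF that(1) R_const w(1)] by blast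
  qed
  have fin: "finite (vt ` M)" "add_closed (vt ` M)" if "vmod n M" for M
    using finite_vt[OF vmodD(1)[OF that]] add_closed_image[OF vmodD(2)[OF that] additive_on_vt] by auto
  have "card {a \<in> vt ` Y. \<forall>b\<in>vt ` VV n. ?b a b = 0} * sz (VV n)
      = sz Y * card {b \<in> vt ` VV n. \<forall>a\<in>vt ` Y. ?b a b = 0}"
    by (rule card_orthogonal[where sc = ?sc])
      (auto simp: fin Y vmod_VV dot_diff theta_diff dot_scal theta_scale sc
        dot_diff_right dot_scal_right)
  moreover have "{a \<in> vt ` Y. \<forall>b\<in>vt ` VV n. ?b a b = 0} = vt ` CV n"
  proof -
    have "{a \<in> vt ` Y. \<forall>b\<in>vt ` VV n. ?b a b = 0} = vt ` (Y \<inter> ortho n (VV n))"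
      using vmodD(1)[OF Y(1)]
      by (auto simp: ortho_def theta_dot_vt theta_dot_vt_right)
    then show ?thesis using Y(2) by (simp add: ortho_VV Int_absorb1)
  qed
  moreover have "{b \<in> vt ` VV n. \<forall>a\<in>vt ` Y. ?b a b = 0} = vt ` ortho n Y"
    by (auto simp: ortho_def theta_dot_vt theta_dot_vt_right dot_commute)
  ultimately show ?thesis by (simp add: mult.commute)
qed

definition lower :: "nat \<Rightarrow> (nat \<Rightarrow> 'f fps) set set" where
  "lower n = {M. vmod n M \<and> CV n \<subseteq> M \<and> M \<subseteq> RV n}"

text \<open>One inclusion is formal, and two applications of \<open>sz_ortho\<close> show that both
  sides have the same size modulo z^N.\<close>

lemma ortho_ortho:
  assumes M: "vmod n M" "CV n \<subseteq> M"
  shows "ortho n (ortho n M) = M"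
proof -
  have C: "CV n \<subseteq> ortho n M"
    using ortho_antimono[OF vmodD(1)[OF M(1)], of n] by (simp add: ortho_VV)
  have "sz M * sz (ortho n M) = sz (ortho n M) * sz (ortho n (ortho n M))"
    using sz_ortho[OF M] sz_ortho[OF vmod_ortho[OF M(1)] C] by simp
  then have "sz M = sz (ortho n (ortho n M))"
    using sz_pos[OF vmod_ortho[OF M(1)]] by (simp add: mult.commute)
  then show ?thesis
    using vmod_eq_of_vt[OF ortho_ortho_subset[OF vmodD(1)[OF M(1)]] M(1)
        vmod_ortho[OF vmod_ortho[OF M(1)]]] ZV_CV M(2) by blast
qed

lemma bij_betw_ortho: "bij_betw (ortho n) (lower n) (upper n)"
proof (rule bij_betw_byWitness[where f' = "ortho n"])
  have U: "vmod n L \<and> CV n \<subseteq> L" if "L \<in> upper n" for L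
    using that CV_RV unfolding upper_def by blast
  show "\<forall>M\<in>lower n. ortho n (ortho n M) = M" by (auto simp: lower_def ortho_ortho)
  show "\<forall>L\<in>upper n. ortho n (ortho n L) = L" using U by (auto simp: ortho_ortho)
  show "ortho n ` lower n \<subseteq> upper n"
    using ortho_antimono[of _ "RV n" n] by (auto simp: lower_def upper_def vmod_ortho ortho_RV)
  show "ortho n ` upper n \<subseteq> lower n"
    using ortho_antimono[of "RV n" _ n] ortho_antimono[OF vmodD(1), of n _ n]
    by (auto simp: lower_def upper_def vmod_ortho ortho_RV ortho_VV)
qed

end

text \<open>
  The matrices congruent to the identity modulo \<open>z\<close>, given by their columns and truncated
  modulo \<open>z\<^sup>N\<close>, act on the lattices between \<open>R\<^sup>n\<close> and \<open>\<O>\<^sup>n\<close>; the translates are standard,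
  and each standard lattice arises with a multiplicity depending on its index only.
\<close>

context large_subring
begin

definition osub :: "nat \<Rightarrow> (nat \<Rightarrow> 'f fps) set \<Rightarrow> bool" where
  "osub n W \<longleftrightarrow> W \<subseteq> VV n \<and> add_closed W \<and> (\<forall>r. \<forall>v\<in>W. scal r v \<in> W)"

text \<open>The condition \<O> M = \<O>^n in a form suited to proofs: a property holds for all of
  \<O>^n as soon as it holds on M and cuts out an \<O>-submodule \<open>W\<close>.\<close>

definition std :: "nat \<Rightarrow> (nat \<Rightarrow> 'f fps) set set" where
  "std n = {M. vmod n M \<and> (\<forall>W. osub n W \<and> M \<subseteq> W \<longrightarrow> W = VV n)}"

definition ccols :: "nat \<Rightarrow> (nat \<Rightarrow> 'f fps) set \<Rightarrow> nat \<Rightarrow> (nat \<Rightarrow> 'f fps) set" where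
  "ccols n M j = {w \<in> M. vt w = w \<and> (\<forall>i<n. w i $ 0 = (if i = j then 1 else 0))}"

definition mats :: "nat \<Rightarrow> (nat \<Rightarrow> 'f fps) set \<Rightarrow> (nat \<Rightarrow> nat \<Rightarrow> 'f fps) set" where
  "mats n M = Pi\<^sub>E {..<n} (ccols n M)"

text \<open>The product of a matrix and a vector; \<open>g j\<close> is the j-th column.\<close>

definition app :: "nat \<Rightarrow> (nat \<Rightarrow> nat \<Rightarrow> 'f fps) \<Rightarrow> (nat \<Rightarrow> 'f fps) \<Rightarrow> nat \<Rightarrow> 'f fps" where
  "app n g v = (\<Sum>j<n. scal (v j) (g j))"

lemma unit_vec_RV: "j < n \<Longrightarrow> unit_vec j 1 \<in> RV n"
  using unit_vec_VV[of j n 1] R_one R_zero by (simp add: RV_def) (simp add: unit_vec_def)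

text \<open>Since z^N \<O> \<subseteq> R, the vectors v with z^N \<O> v \<subseteq> M form an
  \<O>-submodule that contains M. For a standard M it is all of \<O>^n.\<close>

lemma ZV_std:
  assumes "M \<in> std n"
  shows "ZV n \<subseteq> M"
proof
  have M: "vmod n M" "\<And>W. osub n W \<Longrightarrow> M \<subseteq> W \<Longrightarrow> W = VV n" using assms by (auto simp: std_def)
  define W where "W = {v \<in> VV n. \<forall>f. scal (xN * f) v \<in> M}"
  have s: "scal f (a - b) = scal f a - scal f b" "scal f (scal r a) = scal (f * r) a" "scal f 0 = 0" for f r a b
    by (auto simp: scal_def fun_eq_iff algebra_simps)
  have "osub n W"
    unfolding osub_def add_closed_def W_def
    by (auto simp: s scal_VV vmodD[OF M(1)] add_closed_diff[OF add_closed_VV]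
        add_closed_zero[OF add_closed_VV] mult.assoc)
  moreover have "M \<subseteq> W"
    using vmodD(1)[OF M(1)] vmodD(6)[OF M(1) xN_mult_R] by (auto simp: W_def)
  ultimately have W: "W = VV n" by (rule M(2))
  fix v assume "v \<in> ZV n"
  then have v: "v \<in> VV n" "\<And>i k. k < N \<Longrightarrow> v i $ k = 0" by (auto simp: ZV_def vt_eq_0_iff)
  define w where "w = (\<lambda>i. fps_shift N (v i))"
  have "w \<in> W" using v(1) by (simp add: W VV_def w_def)
  then have "scal (xN * 1) w \<in> M" unfolding W_def by blast
  moreover have "scal (xN * 1) w = v"
    using xN_shift[OF v(2)] by (simp add: scal_def w_def fun_eq_iff)
  ultimately show "v \<in> M" by simp
qed

definition cterm :: "nat \<Rightarrow> (nat \<Rightarrow> 'f fps) \<Rightarrow> nat \<Rightarrow> 'f" where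
  "cterm n w = (\<lambda>i. if i < n then w i $ 0 else 0)"

lemma cterm_diff: "cterm n (v - w) = cterm n v - cterm n w"
  by (simp add: cterm_def fun_eq_iff)

lemma cterm_vt: "cterm n (vt w) = cterm n w"
  using N_pos by (simp add: cterm_def fun_eq_iff vt_def)

text \<open>Series act on constant terms through their own constant term, and R contains the
  constants. So the vectors whose constant term occurs in M form an \<O>-submodule containing M.
  This supplies columns in M congruent to the unit vectors.\<close>

lemma cterm_std:
  assumes "M \<in> std n"
  shows "cterm n ` M = {h. \<forall>i\<ge>n. h i = 0}"
proof
  have M: "vmod n M" "\<And>W. osub n W \<Longrightarrow> M \<subseteq> W \<Longrightarrow> W = VV n" using assms by (auto simp: std_def)
  define W where "W = {w \<in> VV n. cterm n w \<in> cterm n ` M}"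
  have "add_closed (cterm n ` M)"
    by (intro add_closed_image vmodD(2)[OF M(1)]) (simp add: additive_on_def cterm_diff)
  note ac = add_closed_zero[OF this] add_closed_diff[OF this]
  have "cterm n 0 = 0" by (simp add: cterm_def fun_eq_iff)
  moreover have "cterm n (scal r w) \<in> cterm n ` M" if "cterm n w \<in> cterm n ` M" for r w
  proof -
    obtain m where m: "m \<in> M" "cterm n w = cterm n m" using \<open>cterm n w \<in> cterm n ` M\<close> by blast
    have "cterm n (scal r w) = (\<lambda>i. r $ 0 * cterm n w i)" by (simp add: cterm_def scal_def fun_eq_iff)
    also have "\<dots> = (\<lambda>i. r $ 0 * cterm n m i)" using m(2) by simp
    also have "\<dots> = cterm n (scal (fps_const (r $ 0)) m)" by (simp add: cterm_def scal_def fun_eq_iff)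
    finally show ?thesis using vmodD(6)[OF M(1) R_const m(1)] by blast
  qed
  ultimately have "osub n W"
    unfolding osub_def add_closed_def W_def
    by (auto simp: scal_VV add_closed_diff[OF add_closed_VV] add_closed_zero[OF add_closed_VV] cterm_diff ac
        simp del: image_iff)
  moreover have "M \<subseteq> W" using vmodD(1)[OF M(1)] by (auto simp: W_def)
  ultimately have W: "W = VV n" by (rule M(2))
  show "{h. \<forall>i\<ge>n. h i = 0} \<subseteq> cterm n ` M"
  proof
    fix h :: "nat \<Rightarrow> 'f" assume h: "h \<in> {h. \<forall>i\<ge>n. h i = 0}"
    define w where "w = (\<lambda>i. fps_const (h i))"
    have "w \<in> W" using h by (simp add: W VV_def w_def)
    moreover have "cterm n w = h" using h by (auto simp: cterm_def w_def fun_eq_iff)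
    ultimately show "h \<in> cterm n ` M" by (simp add: W_def)
  qed
qed (auto simp: cterm_def)

lemma card_fun_space: "card {h :: nat \<Rightarrow> 'f. \<forall>i\<ge>n. h i = 0} = CARD('f) ^ n"
proof -
  have "bij_betw (\<lambda>h i. if i < n then h i else 0) ({..<n} \<rightarrow>\<^sub>E UNIV) {h :: nat \<Rightarrow> 'f. \<forall>i\<ge>n. h i = 0}"
    by (rule bij_betw_byWitness[where f' = "\<lambda>h. restrict h {..<n}"])
      (auto simp: fun_eq_iff PiE_def extensional_def)
  then have "card {h :: nat \<Rightarrow> 'f. \<forall>i\<ge>n. h i = 0} = card ({..<n} \<rightarrow>\<^sub>E (UNIV :: 'f set))"
    by (simp add: bij_betw_same_card)
  then show ?thesis by (simp add: card_PiE)
qed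

lemma VV_std: "VV n \<in> std n"
  using vmod_VV by (auto simp: std_def osub_def)

text \<open>The admissible columns are one fibre of the constant term map from the truncations of M
  onto a space of size q^n, and all fibres have the same size.\<close>

lemma card_ccols:
  assumes M: "M \<in> std n" and j: "j < n"
  shows "CARD('f) ^ n * card (ccols n M j) = sz M"
proof -
  have v: "vmod n M" using M by (simp add: std_def)
  have Z: "ZV n \<subseteq> M" by (rule ZV_std[OF M])
  have ac: "add_closed (vt ` M)"
    by (intro add_closed_image vmodD(2)[OF v] additive_on_vt)
  have add: "additive_on (vt ` M) (cterm n)" by (simp add: additive_on_def cterm_diff)
  have im: "cterm n ` vt ` M = {h. \<forall>i\<ge>n. h i = 0}"
    using cterm_std[OF M] by (simp add: image_image cterm_vt)
  have "(\<lambda>i. if i = j then 1 else 0) \<in> cterm n ` vt ` M" unfolding im using j by auto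
  then obtain a where a: "a \<in> vt ` M" "cterm n a = (\<lambda>i. if i = j then 1 else 0)" by (metis imageE)
  have "ccols n M j = {w \<in> vt ` M. cterm n w = cterm n a}"
  proof -
    have "vt ` M = {w \<in> M. vt w = w}" using vt_mem[OF v Z] by force
    moreover have "cterm n w = cterm n a \<longleftrightarrow> (\<forall>i<n. w i $ 0 = (if i = j then 1 else 0))" for w
      unfolding a(2) using j by (auto simp: cterm_def fun_eq_iff)
    ultimately show ?thesis unfolding ccols_def by simp
  qed
  then have "card (ccols n M j) = card {w \<in> vt ` M. cterm n w = 0}"
    using card_fibre[OF ac add a(1)] by simp
  then show ?thesis
    using card_additive[OF finite_vt[OF vmodD(1)[OF v]] ac add] im card_fun_space[of n] by simp
qed

lemma card_mats:
  assumes M: "M \<in> std n" and d: "CARD('f) ^ d * sz M = sz (VV n)"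
  shows "CARD('f) ^ (n * d) * card (mats n M) = card (mats n (VV n))"
proof -
  let ?q = "CARD('f)"
  have "?q ^ d * card (ccols n M j) = card (ccols n (VV n) j)" if "j < n" for j
  proof -
    have "?q ^ n * (?q ^ d * card (ccols n M j)) = ?q ^ n * card (ccols n (VV n) j)"
      using card_ccols[OF M that] card_ccols[OF VV_std that] d by (simp add: mult.left_commute)
    then show ?thesis by simp
  qed
  then have "(\<Prod>j<n. ?q ^ d * card (ccols n M j)) = (\<Prod>j<n. card (ccols n (VV n) j))" by simp
  then show ?thesis
    by (simp add: mats_def card_PiE prod.distrib power_mult[symmetric] mult.commute)
qed

lemma finite_mats: "M \<subseteq> VV n \<Longrightarrow> finite (mats n M)"
  unfolding mats_def
proof (intro finite_PiE)
  fix j assume M: "M \<subseteq> VV n"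
  have "ccols n M j \<subseteq> vt ` M" unfolding ccols_def by force
  then show "finite (ccols n M j)" using finite_vt[OF M] finite_subset by blast
qed simp

lemma vmod_vt_eq:
  assumes M: "vmod n M" "ZV n \<subseteq> M" and "a \<in> VV n" "b \<in> M" "vt a = vt b"
  shows "a \<in> M"
proof -
  have "a - b \<in> ZV n"
    using assms vmodD(1)[OF M(1)] add_closed_diff[OF add_closed_VV, of a n b] by (auto simp: ZV_def vt_diff)
  then have "a - b + b \<in> M" using vmodD(5)[OF M(1)] M(2) assms(4) by blast
  then show ?thesis by simp
qed

lemma finite_std: "finite (std n)"
proof (rule inj_on_finite)
  show "inj_on (\<lambda>M. vt ` M) (std n)"
  proof (rule inj_onI)
    fix A B assume *: "A \<in> std n" "B \<in> std n" "vt ` A = vt ` B"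
    have "C \<subseteq> D" if "C \<in> std n" "D \<in> std n" "vt ` C = vt ` D" for C D
    proof
      fix x assume x: "x \<in> C"
      then obtain y where y: "y \<in> D" "vt x = vt y" using \<open>vt ` C = vt ` D\<close> by blast
      have "x \<in> VV n" "vmod n D" using x vmodD(1) that by (auto simp: std_def)
      then show "x \<in> D" using vmod_vt_eq ZV_std[OF \<open>D \<in> std n\<close>] y by blast
    qed
    then show "A = B" using * by (metis subset_antisym)
  qed
  show "(\<lambda>M. vt ` M) ` std n \<subseteq> Pow (vt ` VV n)"
    using vmodD(1) by (fastforce simp: std_def)
qed (simp add: finite_vt[OF subset_refl])

section \<open>The action of a matrix congruent to the identity\<close>

context
  fixes n :: nat and g :: "nat \<Rightarrow> nat \<Rightarrow> 'f fps"
  assumes g: "g \<in> mats n (VV n)"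
begin

lemma g_col: "j < n \<Longrightarrow> g j \<in> VV n" "j < n \<Longrightarrow> i < n \<Longrightarrow> g j i $ 0 = (if i = j then 1 else 0)"
  using g by (auto simp: mats_def ccols_def PiE_iff)

lemma app_apply: "app n g v i = (\<Sum>j<n. v j * g j i)"
  by (simp add: app_def sum_fun_apply scal_def)

lemma app_diff: "app n g (v - w) = app n g v - app n g w"
  by (simp add: fun_eq_iff app_apply left_diff_distrib sum_subtractf)

lemma app_0: "app n g 0 = 0"
  by (simp add: fun_eq_iff app_apply)

lemma app_scal: "app n g (scal r v) = scal r (app n g v)"
  by (simp add: fun_eq_iff app_apply scal_def sum_distrib_left mult.assoc)

lemma app_VV: "app n g v \<in> VV n"
  using g_col(1) by (simp add: VV_def app_apply)

lemma app_mem: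
  assumes "add_closed W" "\<And>j. j < n \<Longrightarrow> scal (v j) (g j) \<in> W"
  shows "app n g v \<in> W"
  unfolding app_def using assms by (intro add_closed_sum) auto

lemma app_unit_vec: "j < n \<Longrightarrow> app n g (unit_vec j 1) = g j"
  by (simp add: fun_eq_iff app_apply unit_vec_def if_distrib[of "\<lambda>x. x * _"] cong: if_cong)

text \<open>The matrix is the identity modulo z, so once the coefficients of v below k vanish, v and
  its image have the same k-th coefficients. This gives injectivity modulo powers of z without an
  inverse matrix.\<close>

lemma app_lowest:
  assumes "\<And>i k. k < K \<Longrightarrow> app n g v i $ k = 0" "v \<in> VV n"
  shows "k < K \<Longrightarrow> v i $ k = 0"
proof (induction k arbitrary: i rule: less_induct)
  case (less k)
  show ?case
  proof (cases "i < n")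
    case True
    have "(v j * g j i) $ k = (if j = i then v j $ k else 0)" if "j < n" for j
    proof -
      have "(v j * g j i) $ k = (\<Sum>l=0..k. v j $ l * g j i $ (k - l))" by (rule fps_mult_nth)
      also have "\<dots> = (\<Sum>l=0..k. if l = k then v j $ k * g j i $ 0 else 0)"
        by (rule sum.cong) (use less in auto)
      also have "\<dots> = v j $ k * g j i $ 0" by simp
      finally show ?thesis using g_col(2)[OF that True] by auto
    qed
    then have "app n g v i $ k = (\<Sum>j<n. if j = i then v j $ k else 0)"
      by (simp add: app_apply fps_sum_nth)
    then show ?thesis using assms(1)[OF less.prems] True by simp
  next
    case False
    then show ?thesis using assms(2) by (simp add: VV_def)
  qed
qed

lemma vt_app_eq_0:
  assumes "v \<in> VV n"
  shows "vt (app n g v) = 0 \<longleftrightarrow> vt v = 0"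
proof
  assume "vt (app n g v) = 0"
  then show "vt v = 0" unfolding vt_eq_0_iff using app_lowest[of N v] assms by blast
next
  assume "vt v = 0"
  then have "v j = xN * fps_shift N (v j)" for j by (intro xN_shift) (simp add: vt_eq_0_iff)
  then have "app n g v i = xN * (\<Sum>j<n. fps_shift N (v j) * g j i)" for i
    unfolding app_apply sum_distrib_left by (metis (no_types, lifting) mult.assoc)
  then show "vt (app n g v) = 0" by (simp add: vt_eq_0_iff xN_nth)
qed

lemma vt_app_eq: "v \<in> VV n \<Longrightarrow> w \<in> VV n \<Longrightarrow> vt (app n g v) = vt (app n g w) \<longleftrightarrow> vt v = vt w"
  using vt_app_eq_0[of "v - w"] add_closed_diff[OF add_closed_VV] by (simp add: app_diff vt_diff)

lemma vt_app_vt: "v \<in> VV n \<Longrightarrow> vt (app n g (vt v)) = vt (app n g v)"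
  by (simp add: vt_app_eq vt_VV)

lemma inj_vt_app: "inj_on (\<lambda>v. vt (app n g v)) (vt ` VV n)"
  by (auto simp: inj_on_def vt_app_eq vt_VV)

text \<open>An injective map of the finite set of truncations to itself is onto.\<close>

lemma app_surj:
  assumes "w \<in> VV n"
  obtains v where "v \<in> VV n" "vt (app n g v) = vt w"
proof -
  have "(\<lambda>v. vt (app n g v)) ` vt ` VV n = vt ` VV n"
    by (rule endo_inj_surj[OF finite_vt[OF subset_refl] _ inj_vt_app]) (auto intro: app_VV)
  then have "vt w \<in> (\<lambda>v. vt (app n g v)) ` vt ` VV n" using assms by simp
  then obtain v where v: "vt w = vt (app n g v)" "v \<in> vt ` VV n" by (rule imageE)
  show ?thesis by (rule that[OF _ v(1)[symmetric]]) (use v(2) vt_VV in auto)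
qed

text \<open>The lattice g L + z^N \<O>^n, which for L containing z^N \<O>^n is just g L. Working
  modulo z^N makes \<open>app_surj\<close> sufficient in place of an inverse matrix;
  \<open>pull\<close> is the preimage under g.\<close>

definition push :: "(nat \<Rightarrow> 'f fps) set \<Rightarrow> (nat \<Rightarrow> 'f fps) set" where
  "push L = {w \<in> VV n. \<exists>v\<in>L. vt w = vt (app n g v)}"

definition pull :: "(nat \<Rightarrow> 'f fps) set \<Rightarrow> (nat \<Rightarrow> 'f fps) set" where
  "pull M = {v \<in> VV n. app n g v \<in> M}"

lemma app_push: "v \<in> L \<Longrightarrow> app n g v \<in> push L"
  using app_VV by (auto simp: push_def)

lemma vt_scal: "vt (scal r w) = vt (scal r (vt w))"
  by (simp add: vt_def scal_def fun_eq_iff fps_cutoff_mult_cutoff)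

lemma vmod_push:
  assumes L: "vmod n L"
  shows "vmod n (push L)"
  unfolding vmod_def add_closed_def
proof (intro conjI ballI)
  show "push L \<subseteq> VV n" by (auto simp: push_def)
  show "0 \<in> push L"
    using app_push[OF vmodD(3)[OF L]] by (simp add: app_0)
  fix a b assume "a \<in> push L" "b \<in> push L"
  then obtain v w where *: "v \<in> L" "w \<in> L" "vt a = vt (app n g v)" "vt b = vt (app n g w)" "a \<in> VV n" "b \<in> VV n"
    by (auto simp: push_def)
  have "vt (a - b) = vt (app n g (v - w))" using * by (simp add: vt_diff app_diff)
  then show "a - b \<in> push L"
    using vmodD(4)[OF L *(1,2)] add_closed_diff[OF add_closed_VV *(5,6)] by (auto simp: push_def)
next
  fix r a assume r: "r \<in> R" and "a \<in> push L"
  then obtain v where *: "v \<in> L" "vt a = vt (app n g v)" "a \<in> VV n" by (auto simp: push_def)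
  have "vt (scal r a) = vt (app n g (scal r v))"
    using vt_scal[of r a] vt_scal[of r "app n g v"] * by (simp add: app_scal)
  then show "scal r a \<in> push L"
    using vmodD(6)[OF L r *(1)] scal_VV[OF *(3)] by (auto simp: push_def)
qed

lemma vmod_pull:
  assumes M: "vmod n M"
  shows "vmod n (pull M)"
  unfolding vmod_def add_closed_def
  by (auto simp: pull_def app_0 app_diff app_scal scal_VV vmodD[OF M] add_closed_diff[OF add_closed_VV]
      add_closed_zero[OF add_closed_VV])

lemma ZV_upper: "L \<in> upper n \<Longrightarrow> ZV n \<subseteq> L"
  using ZV_CV CV_RV unfolding upper_def by blast

lemma cols_push:
  assumes "L \<in> upper n" "j < n"
  shows "g j \<in> push L"
proof -
  have "app n g (unit_vec j 1) \<in> push L" using assms(1) unit_vec_RV[OF assms(2)] by (intro app_push) (auto simp: upper_def)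
  then show ?thesis by (simp add: app_unit_vec[OF assms(2)])
qed

text \<open>An \<O>-submodule containing the columns of g contains every g v, hence \<O>^n up to z^N
  \<O>^n, and the latter lies in \<open>push L\<close> by construction.\<close>

lemma push_std:
  assumes L: "L \<in> upper n"
  shows "push L \<in> std n"
proof -
  have v: "vmod n L" using L by (simp add: upper_def)
  have "W = VV n" if W: "osub n W" "push L \<subseteq> W" for W
  proof
    show "VV n \<subseteq> W"
    proof
      fix w assume w: "w \<in> VV n"
      obtain v where v: "v \<in> VV n" "vt (app n g v) = vt w" using app_surj[OF w] by blast
      have "app n g v \<in> W"
      proof (rule app_mem)
        show "add_closed W" using W(1) by (simp add: osub_def)
        show "scal (v j) (g j) \<in> W" if "j < n" for j
          using W cols_push[OF L that] unfolding osub_def by blast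
      qed
      moreover have "w - app n g v \<in> push L"
        using v add_closed_diff[OF add_closed_VV w app_VV] vmodD(3)[OF \<open>vmod n L\<close>]
        by (auto simp: push_def vt_diff app_0 intro!: bexI[where x = 0])
      ultimately have "w - app n g v + app n g v \<in> W"
        using W by (intro add_closed_add) (auto simp: osub_def)
      then show "w \<in> W" by simp
    qed
  qed (use W in \<open>simp add: osub_def\<close>)
  then show ?thesis using vmod_push[OF v] by (simp add: std_def)
qed

lemma sz_push:
  assumes L: "L \<in> upper n"
  shows "sz (push L) = sz L"
proof -
  have v: "L \<subseteq> VV n" using L vmodD(1) by (auto simp: upper_def)
  have "vt ` push L = (\<lambda>v. vt (app n g v)) ` L"
    using app_push by (fastforce simp: push_def)
  also have "\<dots> = (\<lambda>v. vt (app n g v)) ` vt ` L"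
    unfolding image_image by (rule image_cong) (use v vt_app_vt in auto)
  finally have "sz (push L) = card ((\<lambda>v. vt (app n g v)) ` vt ` L)" by simp
  also have "\<dots> = sz L"
    by (rule card_image[OF inj_on_subset[OF inj_vt_app]]) (use v in blast)
  finally show ?thesis .
qed

lemma pull_push:
  assumes L: "L \<in> upper n"
  shows "pull (push L) = L"
proof
  have v: "vmod n L" "ZV n \<subseteq> L" using L ZV_upper by (auto simp: upper_def)
  show "L \<subseteq> pull (push L)" using app_push vmodD(1)[OF v(1)] by (auto simp: pull_def)
  have "w \<in> L" if "w \<in> VV n" "u \<in> L" "vt (app n g w) = vt (app n g u)" for w u
    using vmod_vt_eq[OF v that(1,2)] that vt_app_eq[OF that(1), of u] vmodD(1)[OF v(1)] by blast
  then show "pull (push L) \<subseteq> L" by (auto simp: pull_def push_def)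
qed

lemma push_pull:
  assumes M: "M \<in> std n"
  shows "push (pull M) = M"
proof
  have v: "vmod n M" "ZV n \<subseteq> M" using M ZV_std by (auto simp: std_def)
  note mem = vmod_vt_eq[OF v]
  show "push (pull M) \<subseteq> M" using mem by (auto simp: push_def pull_def)
  show "M \<subseteq> push (pull M)"
  proof
    fix w assume w: "w \<in> M"
    then have wV: "w \<in> VV n" using vmodD(1)[OF v(1)] by blast
    obtain u where u: "u \<in> VV n" "vt (app n g u) = vt w" using app_surj[OF wV] by blast
    then have "app n g u \<in> M" using mem[OF app_VV w] by simp
    then show "w \<in> push (pull M)" using u wV by (auto simp: push_def pull_def)
  qed
qed

lemma pull_upper:
  assumes M: "M \<in> std n" "g \<in> mats n M"
  shows "pull M \<in> upper n"
proof -
  have v: "vmod n M" using M by (simp add: std_def)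
  have "app n g r \<in> M" if "r \<in> RV n" for r
    by (rule app_mem[OF vmodD(2)[OF v]])
      (use that M(2) in \<open>auto simp: RV_def mats_def ccols_def PiE_iff intro: vmodD(6)[OF v]\<close>)
  then show ?thesis using vmod_pull[OF v] by (auto simp: upper_def pull_def RV_def)
qed

lemma push_mats: "L \<in> upper n \<Longrightarrow> g \<in> mats n (push L)"
  using g cols_push by (auto simp: mats_def ccols_def PiE_iff)

text \<open>The columns of g lie in M exactly when g R^n \<subseteq> M, that is, when R^n lies in
  the preimage of M.\<close>

lemma bij_betw_push: "bij_betw push (upper n) {M \<in> std n. g \<in> mats n M}"
  by (rule bij_betw_byWitness[where f' = pull])
    (auto simp: pull_push push_pull push_std push_mats pull_upper)

end

lemma upper_std: "L \<in> upper n \<Longrightarrow> L \<in> std n"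
proof -
  assume L: "L \<in> upper n"
  then have v: "vmod n L" by (simp add: upper_def)
  have mem: "w \<in> W" if W: "osub n W" "L \<subseteq> W" and w: "w \<in> VV n" for W w
  proof -
    have "unit_vec j 1 \<in> W" if "j < n" for j
      using L W(2) unit_vec_RV[OF that] by (auto simp: upper_def)
    then have "(\<Sum>j<n. scal (w j) (unit_vec j 1)) \<in> W"
      using W(1) by (intro add_closed_sum) (auto simp: osub_def)
    also have "(\<Sum>j<n. scal (w j) (unit_vec j 1)) = w"
      using w by (auto simp: fun_eq_iff sum_fun_apply scal_def unit_vec_def VV_def if_distrib[of "(*) _"] cong: if_cong)
    finally show ?thesis .
  qed
  have "W = VV n" if "osub n W" "L \<subseteq> W" for W
    using mem[OF that] that(1) by (intro subset_antisym subsetI) (auto simp: osub_def)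
  then show ?thesis using v by (simp add: std_def)
qed

lemma mats_VV_nonempty: "card (mats n (VV n)) > 0"
proof -
  have "(\<lambda>j\<in>{..<n}. unit_vec j 1) \<in> mats n (VV n)"
    using N_pos by (auto simp: mats_def ccols_def unit_vec_VV)
      (auto simp: unit_vec_def vt_def fun_eq_iff fps_cutoff_one)
  then show ?thesis using finite_mats[OF subset_refl] by (metis card_gt_0_iff empty_iff)
qed

text \<open>The exponent \<open>d\<close> enters only through the index equation, so the count is
  independent of how dimensions are defined.\<close>

lemma sum_std_eq_sum_upper:
  fixes x :: "'k::field_char_0"
  assumes d: "\<And>M. M \<in> std n \<Longrightarrow> CARD('f) ^ d M * sz M = sz (VV n)"
  shows "(\<Sum>M\<in>std n. x ^ d M) = (\<Sum>L\<in>upper n. (x * of_nat CARD('f) ^ n) ^ d L)"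
proof -
  let ?q = "of_nat CARD('f) :: 'k"
  let ?y = "x * ?q ^ n"
  let ?G = "mats n (VV n)"
  have fin: "finite ?G" by (rule finite_mats) simp
  have q0: "CARD('f) > 0" by simp
  have sub: "{g \<in> ?G. g \<in> mats n M} = mats n M" if "M \<in> std n" for M
  proof -
    have "M \<subseteq> VV n" using that by (simp add: std_def vmod_def)
    then have "mats n M \<subseteq> ?G" unfolding mats_def by (intro PiE_mono) (auto simp: ccols_def)
    then show ?thesis by blast
  qed
  \<comment> \<open>By \<open>card_mats\<close>, replacing all matrices by those with columns in M
    costs the factor q^(n d M), which turns \<open>x\<close> into \<open>?y\<close>.\<close>
  have "of_nat (card ?G) * (\<Sum>M\<in>std n. x ^ d M) = (\<Sum>M\<in>std n. of_nat (card (mats n M)) * ?y ^ d M)"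
    unfolding sum_distrib_left
  proof (rule sum.cong)
    fix M assume M: "M \<in> std n"
    have "of_nat (card ?G) = ?q ^ (n * d M) * of_nat (card (mats n M))"
      using card_mats[OF M d[OF M]] by (metis of_nat_mult of_nat_power)
    then show "of_nat (card ?G) * x ^ d M = of_nat (card (mats n M)) * ?y ^ d M"
      by (simp add: power_mult_distrib power_mult)
  qed simp
  also have "\<dots> = (\<Sum>M\<in>std n. \<Sum>g\<in>{g \<in> ?G. g \<in> mats n M}. ?y ^ d M)"
    by (rule sum.cong) (simp_all add: sub)
  also have "\<dots> = (\<Sum>g\<in>?G. \<Sum>M\<in>{M \<in> std n. g \<in> mats n M}. ?y ^ d M)"
    by (rule sum.swap_restrict[OF finite_std fin])
  \<comment> \<open>For each \<open>g\<close> the inner sum is reindexed by \<open>push\<close>,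
    which preserves sizes and hence \<open>d\<close>; the result does not depend on
    \<open>g\<close>.\<close>
  also have "\<dots> = (\<Sum>g\<in>?G. \<Sum>L\<in>upper n. ?y ^ d L)"
  proof (rule sum.cong)
    fix g assume g: "g \<in> ?G"
    have "(\<Sum>M\<in>{M \<in> std n. g \<in> mats n M}. ?y ^ d M) = (\<Sum>L\<in>upper n. ?y ^ d (push n g L))"
      by (rule sum.reindex_bij_betw[OF bij_betw_push[OF g], symmetric])
    also have "\<dots> = (\<Sum>L\<in>upper n. ?y ^ d L)"
    proof (rule sum.cong)
      fix L assume L: "L \<in> upper n"
      have "CARD('f) ^ d (push n g L) * sz L = CARD('f) ^ d L * sz L"
        using d[OF push_std[OF g L]] d[OF upper_std[OF L]] sz_push[OF g L] by simp
      moreover have "sz L > 0" using L by (intro sz_pos[of n]) (simp add: upper_def)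
      ultimately have "CARD('f) ^ d (push n g L) = CARD('f) ^ d L" by simp
      then have "d (push n g L) = d L" using card_field_gt_1[where 'f = 'f] by simp
      then show "?y ^ d (push n g L) = ?y ^ d L" by simp
    qed simp
    finally show "(\<Sum>M\<in>{M \<in> std n. g \<in> mats n M}. ?y ^ d M) = (\<Sum>L\<in>upper n. ?y ^ d L)" .
  qed simp
  also have "\<dots> = of_nat (card ?G) * (\<Sum>L\<in>upper n. ?y ^ d L)" by simp
  \<comment> \<open>The number of matrices is positive, so it can be cancelled in characteristic
    zero.\<close>
  finally have "(of_nat (card ?G) :: 'k) = 0 \<or> (\<Sum>M\<in>std n. x ^ d M) = (\<Sum>L\<in>upper n. ?y ^ d L)"
    by (simp add: mult_cancel_left)
  then show ?thesis using mats_VV_nonempty[of n] by (simp only: of_nat_eq_0_iff) simp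
qed

end

context dualized_subring
begin

text \<open>All reduces to D = e M + d (ortho n M). By \<open>sz_ortho\<close>, the index of the
  orthogonal complement of M in \<O>^n is that of \<open>CV n\<close> in M. Multiplied by the index
  of M in R^n it gives the index of \<open>CV n\<close> in R^n, which equals that of R^n in \<O>^n,
  namely q^D, because R^n is its own orthogonal complement.\<close>

lemma duality_identity:
  fixes t :: "'k::field_char_0"
  assumes t: "t \<noteq> 0"
    and d: "\<And>M. M \<in> std n \<Longrightarrow> CARD('f) ^ d M * sz M = sz (VV n)"
    and e: "\<And>M. M \<in> lower n \<Longrightarrow> CARD('f) ^ e M * sz M = sz (RV n)"
    and D: "CARD('f) ^ D * sz (RV n) = sz (VV n)"
  shows "(\<Sum>M\<in>std n. t ^ d M) =
    (t * of_nat CARD('f) ^ n) ^ D * (\<Sum>M\<in>lower n. (1 / (t * of_nat CARD('f) ^ n)) ^ e M)"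
proof -
  let ?y = "t * of_nat CARD('f) ^ n"
  let ?q = "CARD('f)"
  have "(\<Sum>M\<in>std n. t ^ d M) = (\<Sum>L\<in>upper n. ?y ^ d L)"
    by (rule sum_std_eq_sum_upper[OF d])
  also have "\<dots> = (\<Sum>M\<in>lower n. ?y ^ d (ortho n M))"
    by (rule sum.reindex_bij_betw[OF bij_betw_ortho, symmetric])
  also have "\<dots> = (\<Sum>M\<in>lower n. ?y ^ D * (1 / ?y) ^ e M)"
  proof (rule sum.cong)
    fix M assume M: "M \<in> lower n"
    then have v: "vmod n M" "CV n \<subseteq> M" by (auto simp: lower_def)
    let ?L = "ortho n M"
    have "?L \<in> upper n" using bij_betwE[OF bij_betw_ortho] M by blast
    note L = d[OF upper_std[OF this]]
    have pos: "sz (VV n) > 0" "sz (RV n) > 0" "sz (CV n) > 0"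
      using sz_pos vmod_VV vmod_RV vmod_CV by blast+
    have R: "sz (RV n) * sz (RV n) = sz (VV n) * sz (CV n)"
      using sz_ortho[OF vmod_RV CV_RV, of n] by (simp add: ortho_RV)
    have "?q ^ (e M + d ?L) * sz (CV n) * sz (VV n) = (?q ^ e M * sz M) * (?q ^ d ?L * sz ?L)"
      using sz_ortho[OF v] by (simp add: power_add mult_ac)
    also have "\<dots> = sz (RV n) * sz (VV n)" using e[OF M] L by simp
    finally have 1: "?q ^ (e M + d ?L) * sz (CV n) = sz (RV n)" using pos by simp
    have "(?q ^ D * sz (CV n)) * sz (VV n) = (?q ^ D * sz (RV n)) * sz (RV n)"
      using R by (simp add: mult_ac)
    also have "\<dots> = sz (RV n) * sz (VV n)" using D by simp
    finally have "?q ^ D * sz (CV n) = sz (RV n)" using pos by simp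
    then have "?q ^ (e M + d ?L) * sz (CV n) = ?q ^ D * sz (CV n)" using 1 by simp
    then have "?q ^ (e M + d ?L) = ?q ^ D" using pos by simp
    then have "D = e M + d ?L" using card_field_gt_1[where 'f = 'f] by simp
    moreover have "?y \<noteq> 0" using t by simp
    ultimately show "?y ^ d ?L = ?y ^ D * (1 / ?y) ^ e M" by (simp add: power_add power_one_over)
  qed simp
  finally show ?thesis by (simp add: sum_distrib_left)
qed

end

section \<open>Codimension and index\<close>

abbreviation KK :: "'f::{field,finite} ring" where
  "KK \<equiv> ring_of_type_algebra"

lemma module_finsum_smult:
  fixes V (structure)
  assumes V: "Module.module KK V" and b: "finite b" "b \<subseteq> carrier V"
  shows "(\<Oplus>x\<in>b. c x \<odot> x) \<in> carrier V"
    and "(\<Oplus>x\<in>b. (c x + c' x) \<odot> x) = (\<Oplus>x\<in>b. c x \<odot> x) \<oplus> (\<Oplus>x\<in>b. c' x \<odot> x)"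
    and "(\<Oplus>x\<in>b. (k * c x) \<odot> x) = k \<odot> (\<Oplus>x\<in>b. c x \<odot> x)"
proof -
  interpret module KK V by fact
  have cl: "a \<odot> x \<in> carrier V" if "x \<in> carrier V" for a x
    using smult_closed[of a x] that by simp
  have d: "(a + b) \<odot> x = a \<odot> x \<oplus> b \<odot> x" if "x \<in> carrier V" for a b x
    using smult_l_distr[of a b x] that by simp
  have a: "(a * b) \<odot> x = a \<odot> (b \<odot> x)" if "x \<in> carrier V" for a b x
    using smult_assoc1[of a b x] that by simp
  show "(\<Oplus>x\<in>b. c x \<odot> x) \<in> carrier V" using b cl by (intro M.finsum_closed) auto
  show "(\<Oplus>x\<in>b. (c x + c' x) \<odot> x) = (\<Oplus>x\<in>b. c x \<odot> x) \<oplus> (\<Oplus>x\<in>b. c' x \<odot> x)"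
  proof -
    have "(\<Oplus>x\<in>b. (c x + c' x) \<odot> x) = (\<Oplus>x\<in>b. c x \<odot> x \<oplus> c' x \<odot> x)"
      using b d cl by (intro M.finsum_cong') auto
    also have "\<dots> = (\<Oplus>x\<in>b. c x \<odot> x) \<oplus> (\<Oplus>x\<in>b. c' x \<odot> x)"
      using b cl by (intro M.finsum_addf) auto
    finally show ?thesis .
  qed
  show "(\<Oplus>x\<in>b. (k * c x) \<odot> x) = k \<odot> (\<Oplus>x\<in>b. c x \<odot> x)"
  proof -
    have "(\<Oplus>x\<in>b. (k * c x) \<odot> x) = (\<Oplus>x\<in>b. k \<odot> (c x \<odot> x))"
      using b a cl by (intro M.finsum_cong') auto
    also have "\<dots> = k \<odot> (\<Oplus>x\<in>b. c x \<odot> x)"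
      using b cl by (intro finsum_smult_ldistr[symmetric]) auto
    finally show ?thesis .
  qed
qed

text \<open>Vectors outside the span are adjoined until the span is everything. Independence is
  expressed as injectivity of the coefficient map, matching the unique coefficients in
  \<open>is_finite_basis\<close>.\<close>

lemma finite_basis_extend:
  fixes V (structure)
  assumes V: "Module.module KK V" and fin: "finite (carrier V)"
    and b: "b \<subseteq> carrier V" "inj_on (\<lambda>c. \<Oplus>x\<in>b. c x \<odot> x) (b \<rightarrow>\<^sub>E UNIV)"
  shows "\<exists>b'. is_finite_basis (KK :: 'f::{field,finite} ring) V b'"
  using b
proof (induction "card (carrier V) - card b" arbitrary: b rule: less_induct)
  case less
  interpret module KK V by fact
  have fb: "finite b" using less.prems(1) fin finite_subset by blast
  let ?s = "\<lambda>b c. \<Oplus>x\<in>b. c x \<odot> x"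
  have cl: "a \<odot> x \<in> carrier V" if "x \<in> carrier V" for a x
    using smult_closed[of a x] that by simp
  show ?case
  proof (cases "carrier V \<subseteq> ?s b ` (b \<rightarrow>\<^sub>E UNIV)")
    case True
    have "\<exists>!c. c \<in> b \<rightarrow>\<^sub>E UNIV \<and> v = ?s b c" if v: "v \<in> carrier V" for v
    proof -
      obtain c where c: "v = ?s b c" "c \<in> b \<rightarrow>\<^sub>E UNIV" using subsetD[OF True v] by (elim imageE)
      show ?thesis
      proof (rule ex1I[of _ c])
        show "c' = c" if "c' \<in> b \<rightarrow>\<^sub>E UNIV \<and> v = ?s b c'" for c'
          using inj_onD[OF less.prems(2), of c' c] that c by metis
      qed (use c in simp)
    qed
    then have "is_finite_basis KK V b"
      unfolding is_finite_basis_def using fb less.prems(1) by simp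
    then show ?thesis by blast
  next
    case False
    then obtain v where v: "v \<in> carrier V" "v \<notin> ?s b ` (b \<rightarrow>\<^sub>E UNIV)" by blast
    have span: "?s b c \<in> ?s b ` (b \<rightarrow>\<^sub>E UNIV)" for c
    proof -
      have "?s b c = ?s b (restrict c b)"
        using less.prems(1) cl by (intro M.finsum_cong') auto
      then show ?thesis by auto
    qed
    have "v \<notin> b"
    proof
      assume vb: "v \<in> b"
      have "?s b (\<lambda>x. if x = v then 1 else 0) = (\<Oplus>x\<in>b. if v = x then x else \<zero>)"
        using less.prems(1) smult_one smult_l_null by (intro M.finsum_cong') auto
      also have "\<dots> = v" using fb vb less.prems(1) by (subst M.finsum_singleton) auto
      finally show False using v(2) span[of "\<lambda>x. if x = v then 1 else 0"] by (simp only: not_True_eq_False)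
    qed
    have ins: "?s (insert v b) c = c v \<odot> v \<oplus> ?s b c" for c
      using fb \<open>v \<notin> b\<close> v(1) less.prems(1) cl by (intro M.finsum_insert) auto
    have "inj_on (?s (insert v b)) (insert v b \<rightarrow>\<^sub>E UNIV)"
    proof (rule inj_onI)
      fix c c' assume c: "c \<in> insert v b \<rightarrow>\<^sub>E UNIV" "c' \<in> insert v b \<rightarrow>\<^sub>E UNIV"
        and eq: "?s (insert v b) c = ?s (insert v b) c'"
      note fs = module_finsum_smult[OF V fb less.prems(1)]
      define k where "k = c v - c' v"
      have kv: "k \<odot> v \<oplus> ?s b c = ?s b c'"
      proof -
        have "c v \<odot> v = c' v \<odot> v \<oplus> k \<odot> v"
          using smult_l_distr[of "c' v" k v] v(1) by (simp add: k_def)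
        then have "c' v \<odot> v \<oplus> (k \<odot> v \<oplus> ?s b c) = c' v \<odot> v \<oplus> ?s b c'"
          using eq v(1) cl fs(1) by (simp add: ins M.a_assoc)
        then show ?thesis using v(1) cl fs(1) by simp
      qed
      \<comment> \<open>Otherwise division by \<open>k\<close> would express \<open>v\<close> as a
        combination of \<open>b\<close>.\<close>
      have "k = 0"
      proof (rule ccontr)
        assume k: "k \<noteq> 0"
        have "k \<odot> v = ?s b (\<lambda>x. c' x + (-1) * c x)"
        proof -
          have "?s b (\<lambda>x. c' x + (-1) * c x) \<oplus> ?s b c = ?s b c'"
            by (simp flip: fs(2))
          then have "?s b (\<lambda>x. c' x + (-1) * c x) \<oplus> ?s b c = k \<odot> v \<oplus> ?s b c"
            by (simp only: kv)
          from M.add.r_cancel[OF this fs(1) cl[OF v(1)] fs(1)] show ?thesis by (rule sym)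
        qed
        then have "?s b (\<lambda>x. inverse k * (c' x + (-1) * c x)) = inverse k \<odot> (k \<odot> v)"
          unfolding fs(3) by simp
        also have "\<dots> = v"
          using smult_assoc1[of "inverse k" k v] smult_one[of v] v(1) k by simp
        finally show False
          using v(2) span[of "\<lambda>x. inverse k * (c' x + (-1) * c x)"] by (simp only: not_True_eq_False)
      qed
      then have eq0: "?s b c = ?s b c'" using kv v(1) smult_l_null[of v] fs(1) by simp
      have r: "?s b c = ?s b (restrict c b)" for c :: "'a \<Rightarrow> 'f"
        using less.prems(1) cl by (auto intro!: M.finsum_cong')
      have "restrict c b = restrict c' b"
      proof (rule inj_onD[OF less.prems(2)])
        show "?s b (restrict c b) = ?s b (restrict c' b)"
          by (rule trans[OF trans[OF sym[OF r] eq0] r])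
      qed simp_all
      then have "c x = c' x" if "x \<in> insert v b" for x
        using that \<open>k = 0\<close> by (auto simp: k_def dest: fun_cong[of _ _ x])
      then show "c = c'" using c by (intro PiE_ext) auto
    qed
    moreover have "card (carrier V) - card (insert v b) < card (carrier V) - card b"
      using card_mono[OF fin, of "insert v b"] v(1) less.prems(1) fb \<open>v \<notin> b\<close> by simp
    ultimately show ?thesis using less.hyps v(1) less.prems(1) by blast
  qed
qed

text \<open>A basis b makes the space a copy of the functions from b to the field. Counting these
  shows that all bases have the same size, so the definite description in \<open>vdim\<close> has a
  value.\<close>

lemma card_eq_power_vdim:
  fixes V (structure)
  assumes V: "Module.module (KK :: 'f::{field,finite} ring) V" and fin: "finite (carrier V)"
  shows "CARD('f) ^ vdim (KK :: 'f ring) V = card (carrier V)"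
proof -
  interpret module "KK :: 'f ring" V by fact
  have card: "card (carrier V) = CARD('f) ^ card b" if b: "is_finite_basis (KK :: 'f ring) V b" for b
  proof -
    let ?s = "\<lambda>c. \<Oplus>x\<in>b. c x \<odot> x"
    have fb: "finite b" "b \<subseteq> carrier V" and ex: "\<forall>v\<in>carrier V. \<exists>!c. c \<in> b \<rightarrow>\<^sub>E UNIV \<and> v = ?s c"
      using b by (auto simp: is_finite_basis_def)
    have cl: "?s c \<in> carrier V" for c by (rule module_finsum_smult(1)[OF V fb])
    have "bij_betw ?s (b \<rightarrow>\<^sub>E UNIV) (carrier V)"
      unfolding bij_betw_def
    proof
      show "inj_on ?s (b \<rightarrow>\<^sub>E UNIV)" using ex cl unfolding inj_on_def by metis
      show "?s ` (b \<rightarrow>\<^sub>E UNIV) = carrier V" using ex cl by blast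
    qed
    then have "card (carrier V) = card (b \<rightarrow>\<^sub>E (UNIV :: 'f set))" by (simp add: bij_betw_same_card)
    then show ?thesis by (simp add: card_PiE fb)
  qed
  have "inj_on (\<lambda>c. \<Oplus>x\<in>{}. c x \<odot> x) ({} \<rightarrow>\<^sub>E (UNIV :: 'f set))" by simp
  then obtain b where b: "is_finite_basis (KK :: 'f ring) V b"
    using finite_basis_extend[OF V fin, of "{}"] by auto
  have "vdim (KK :: 'f ring) V = card b"
    unfolding vdim_def
  proof (rule the_equality)
    fix d assume "\<exists>b. is_finite_basis (KK :: 'f ring) V b \<and> card b = d"
    then have "CARD('f) ^ d = CARD('f) ^ card b" using card b by metis
    then show "d = card b" using card_field_gt_1[where 'f = 'f] by simp
  qed (use b in blast)
  then show ?thesis using card[OF b] by simp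
qed

lemma module_quotient:
  fixes V (structure)
  assumes V: "Module.module K V" and W: "submodule W K V"
  shows "Module.module K (quotient_module V W)"
proof -
  interpret module K V by fact
  have sg: "subgroup W (add_monoid V)" using W by (simp add: submodule_def)
  have Wc: "W \<subseteq> carrier V" "\<zero> \<in> W" "\<And>x y. x \<in> W \<Longrightarrow> y \<in> W \<Longrightarrow> x \<oplus> y \<in> W"
    "\<And>r x. r \<in> carrier K \<Longrightarrow> x \<in> W \<Longrightarrow> r \<odot> x \<in> W"
    using W by (auto simp: submodule_def submodule_axioms_def subgroup_def)
  have as: "abelian_subgroup W V"
    by (rule abelian_subgroupI3) (use sg M.abelian_group_axioms in \<open>auto simp: additive_subgroup_def\<close>)
  interpret W: abelian_subgroup W V by (rule as)
  let ?Q = "quotient_module V W"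
  have cs: "carrier ?Q = {W +> x | x. x \<in> carrier V}"
    by (auto simp: quotient_module_def A_RCOSETS_def' a_r_coset_def')
  have add: "(W +> x) \<oplus>\<^bsub>?Q\<^esub> (W +> y) = W +> (x \<oplus> y)" if "x \<in> carrier V" "y \<in> carrier V" for x y
    using W.a_rcos_sum[OF that] by (simp add: quotient_module_def)
  \<comment> \<open>The image of a coset under \<open>r\<close> may be smaller than a coset, for
    instance when \<open>r\<close> is zero; adding \<open>W\<close> completes it.\<close>
  have sm: "r \<odot>\<^bsub>?Q\<^esub> (W +> x) = W +> (r \<odot> x)" if "r \<in> carrier K" "x \<in> carrier V" for r x
  proof -
    have "W <+>\<^bsub>V\<^esub> ((\<lambda>y. r \<odot> y) ` (W +> x)) = W +> (r \<odot> x)"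
    proof
      show "W <+>\<^bsub>V\<^esub> ((\<lambda>y. r \<odot> y) ` (W +> x)) \<subseteq> W +> (r \<odot> x)"
      proof
        fix z assume "z \<in> W <+>\<^bsub>V\<^esub> ((\<lambda>y. r \<odot> y) ` (W +> x))"
        then obtain w w' where w: "w \<in> W" "w' \<in> W" "z = w \<oplus> r \<odot> (w' \<oplus> x)"
          by (auto simp: set_add_def' a_r_coset_def')
        have wc: "w \<in> carrier V" "w' \<in> carrier V" using w Wc(1) by auto
        have "z = (w \<oplus> r \<odot> w') \<oplus> r \<odot> x"
          using wc that w(3) smult_r_distr by (simp add: M.a_assoc)
        then show "z \<in> W +> (r \<odot> x)" using Wc(3,4) w that by (auto simp: a_r_coset_def')
      qed
      show "W +> (r \<odot> x) \<subseteq> W <+>\<^bsub>V\<^esub> ((\<lambda>y. r \<odot> y) ` (W +> x))"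
      proof
        fix z assume "z \<in> W +> (r \<odot> x)"
        then obtain w where "w \<in> W" "z = w \<oplus> r \<odot> x"
          by (auto simp: a_r_coset_def')
        then have "w \<in> W" "z = w \<oplus> r \<odot> (\<zero> \<oplus> x)"
          using that by simp_all
        then show "z \<in> W <+>\<^bsub>V\<^esub> ((\<lambda>y. r \<odot> y) ` (W +> x))"
          unfolding set_add_def' a_r_coset_def' using Wc(2) by blast
      qed
    qed
    then show ?thesis by (simp add: quotient_module_def)
  qed
  have z: "\<zero>\<^bsub>?Q\<^esub> = W +> \<zero>"
    using M.a_coset_add_zero[OF Wc(1)] by (simp add: quotient_module_def)
  have ab: "abelian_group ?Q"
  proof (rule abelian_groupI)
    fix U assume "U \<in> carrier ?Q"
    then obtain x where x: "x \<in> carrier V" "U = W +> x" by (auto simp: cs)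
    then have "(W +> (\<ominus> x)) \<oplus>\<^bsub>?Q\<^esub> U = \<zero>\<^bsub>?Q\<^esub>" by (simp add: add z M.l_neg)
    then show "\<exists>U'\<in>carrier ?Q. U' \<oplus>\<^bsub>?Q\<^esub> U = \<zero>\<^bsub>?Q\<^esub>"
      using x(1) unfolding cs by (intro bexI) auto
  qed (auto simp: cs add z M.a_ac)
  show ?thesis
    by (rule moduleI[OF R.cring_axioms ab])
      (auto simp: cs add sm smult_l_distr smult_r_distr smult_assoc1)
qed

section \<open>Cosets counted through an additive map\<close>

locale additive_map = abelian_group V for V :: "('v, 'm) ring_scheme" (structure) +
  fixes f :: "'v \<Rightarrow> 'c::ab_group_add"
  assumes f_add: "x \<in> carrier V \<Longrightarrow> y \<in> carrier V \<Longrightarrow> f (x \<oplus> y) = f x + f y"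
begin

lemma f_zero: "f \<zero> = 0"
  using f_add[of \<zero> \<zero>] by simp

lemma f_uminus: "x \<in> carrier V \<Longrightarrow> f (\<ominus> x) = - f x"
  using f_add[of "\<ominus> x" x] by (simp add: l_neg f_zero eq_neg_iff_add_eq_0)

lemma add_closed_image_subgroup:
  assumes "subgroup W (add_monoid V)"
  shows "add_closed (f ` W)"
proof -
  have W: "W \<subseteq> carrier V" "\<zero> \<in> W" "\<And>x y. x \<in> W \<Longrightarrow> y \<in> W \<Longrightarrow> x \<oplus> y \<in> W" "\<And>x. x \<in> W \<Longrightarrow> \<ominus> x \<in> W"
    using assms by (auto simp: subgroup_def a_inv_def)
  have "f x - f y \<in> f ` W" if "x \<in> W" "y \<in> W" for x y
  proof (rule image_eqI[of _ _ "x \<oplus> \<ominus> y"])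
    show "f x - f y = f (x \<oplus> \<ominus> y)" using that W(1) by (simp add: subset_iff f_add f_uminus)
  qed (use that W in blast)
  moreover have "0 \<in> f ` W" using W(2) f_zero by (metis image_eqI)
  ultimately show ?thesis by (auto simp: add_closed_def)
qed

definition preimage :: "'c set \<Rightarrow> 'v set" where
  "preimage S = {x \<in> carrier V. f x \<in> S}"

lemma subgroup_preimage:
  assumes "add_closed S"
  shows "subgroup (preimage S) (add_monoid V)"
proof (rule subgroup.intro)
  fix x assume "x \<in> preimage S"
  then show "inv\<^bsub>add_monoid V\<^esub> x \<in> preimage S"
    unfolding a_inv_def[symmetric] by (simp add: preimage_def f_uminus add_closed_uminus[OF assms])
qed (auto simp: preimage_def f_add f_zero add_closed_add[OF assms] add_closed_zero[OF assms])

lemma image_preimage: "S \<subseteq> f ` carrier V \<Longrightarrow> f ` preimage S = S"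
  by (auto simp: preimage_def)

lemma preimage_image:
  assumes "subgroup W (add_monoid V)" "\<And>x. x \<in> carrier V \<Longrightarrow> f x = 0 \<Longrightarrow> x \<in> W"
  shows "preimage (f ` W) = W"
proof
  have W: "W \<subseteq> carrier V" "\<And>x y. x \<in> W \<Longrightarrow> y \<in> W \<Longrightarrow> x \<oplus> y \<in> W"
    using assms(1) by (auto simp: subgroup_def)
  show "W \<subseteq> preimage (f ` W)" using W(1) by (auto simp: preimage_def)
  show "preimage (f ` W) \<subseteq> W"
  proof
    fix x assume "x \<in> preimage (f ` W)"
    then obtain w where w: "x \<in> carrier V" "w \<in> W" "f x = f w" by (auto simp: preimage_def)
    then have wc: "w \<in> carrier V" using W(1) by blast
    have "x \<oplus> \<ominus> w \<in> W" using w wc by (intro assms(2)) (simp_all add: f_add f_uminus)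
    then have "(x \<oplus> \<ominus> w) \<oplus> w \<in> W" using W(2) w(2) by blast
    then show "x \<in> W" using w(1) wc by (simp add: a_assoc l_neg)
  qed
qed

text \<open>Since \<open>W\<close> contains the kernel of f, distinct cosets have disjoint images.
  These images are translates of \<open>f\<close> W\<open>, so they partition\<close>f
  \<open>carrier V\<close> into blocks of equal size.\<close>

lemma card_cosets:
  assumes W: "subgroup W (add_monoid V)"
    and f: "\<And>x. x \<in> carrier V \<Longrightarrow> f x = 0 \<Longrightarrow> x \<in> W" "finite (f ` carrier V)"
  shows "finite (a_rcosets W)" "card (a_rcosets W) * card (f ` W) = card (f ` carrier V)"
proof -
  have Wc: "W \<subseteq> carrier V" "\<zero> \<in> W" "\<And>x y. x \<in> W \<Longrightarrow> y \<in> W \<Longrightarrow> x \<oplus> y \<in> W"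
    using W by (auto simp: subgroup_def)
  have cs: "a_rcosets W = (\<lambda>x. W +> x) ` carrier V"
    by (auto simp: A_RCOSETS_def' a_r_coset_def')
  have img: "f ` (W +> x) = (\<lambda>y. y + f x) ` f ` W" if "x \<in> carrier V" for x
  proof -
    have "W +> x = (\<lambda>w. w \<oplus> x) ` W" by (auto simp: a_r_coset_def')
    then have "f ` (W +> x) = (\<lambda>w. f (w \<oplus> x)) ` W" by (simp add: image_image)
    also have "\<dots> = (\<lambda>w. f w + f x) ` W"
      by (rule image_cong) (use f_add Wc(1) that in auto)
    finally show ?thesis by (simp add: image_image)
  qed
  have eq: "W +> x = W +> y" if xy: "x \<in> carrier V" "y \<in> carrier V" "f x = w + f y" "w \<in> f ` W" for x y w
  proof -
    obtain u where u: "u \<in> W" "w = f u" using xy(4) by blast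
    let ?d = "x \<oplus> \<ominus> (u \<oplus> y)"
    have uc: "u \<in> carrier V" using u Wc by blast
    have "f ?d = 0" using xy u(2) uc f_add f_uminus by simp
    then have d: "?d \<in> W" using f(1)[of ?d] xy uc by simp
    have "x = ?d \<oplus> (u \<oplus> y)" using xy uc by (simp add: a_assoc l_neg)
    then have "x = (?d \<oplus> u) \<oplus> y" using xy uc by (simp add: a_assoc)
    then have "x \<in> W +> y" using Wc(3)[OF d u(1)] by (auto simp: a_r_coset_def')
    then show ?thesis using a_repr_independence[OF _ xy(2) W] by metis
  qed
  define F where "F = (\<lambda>U. f ` U) ` (a_rcosets W)"
  have inj: "inj_on (\<lambda>U. f ` U) (a_rcosets W)"
  proof (rule inj_onI)
    fix U U' assume *: "U \<in> a_rcosets W" "U' \<in> a_rcosets W" "f ` U = f ` U'"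
    then obtain x y where xy: "x \<in> carrier V" "y \<in> carrier V" "U = W +> x" "U' = W +> y" unfolding cs by blast
    have "0 + f x \<in> f ` U" using img[OF xy(1)] xy(3) Wc(2) f_zero by (metis image_eqI)
    then obtain w where "w \<in> f ` W" "f x = w + f y" using *(3) img[OF xy(2)] xy(4) by auto
    then show "U = U'" using eq[OF xy(1,2)] xy by blast
  qed
  have UF: "\<Union>F = f ` carrier V"
  proof
    show "\<Union>F \<subseteq> f ` carrier V"
      unfolding F_def cs using Wc(1) by (auto simp: a_r_coset_def')
    show "f ` carrier V \<subseteq> \<Union>F"
    proof (rule image_subsetI)
      fix x assume x: "x \<in> carrier V"
      have "0 + f x \<in> f ` (W +> x)" using img[OF x] Wc(2) f_zero by (metis image_eqI)
      then show "f x \<in> \<Union>F" unfolding F_def cs using x by auto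
    qed
  qed
  have finF: "finite F"
    by (rule finite_subset[of _ "Pow (f ` carrier V)"]) (use UF f(2) in auto)
  then show "finite (a_rcosets W)" using inj by (simp add: F_def finite_image_iff)
  have "card (f ` carrier V) = (\<Sum>S\<in>F. card S)"
    unfolding UF[symmetric]
  proof (rule card_Union_disjoint)
    show "pairwise disjnt F"
    proof (rule pairwiseI)
      fix S T assume ST: "S \<in> F" "T \<in> F" "S \<noteq> T"
      then obtain x y where xy: "x \<in> carrier V" "y \<in> carrier V" "S = f ` (W +> x)" "T = f ` (W +> y)"
        unfolding F_def cs by blast
      show "disjnt S T"
      proof (rule ccontr)
        assume "\<not> disjnt S T"
        then obtain a b where ab: "a \<in> W" "b \<in> W" "f a + f x = f b + f y"
          using img xy by (auto simp: disjnt_def)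
        let ?d = "\<ominus> a \<oplus> b"
        have d: "f ?d = - f a + f b" using ab(1,2) Wc(1) f_add f_uminus by (simp add: subset_iff)
        have dW: "?d \<in> W"
          using ab(1,2) Wc(3) subgroup.m_inv_closed[OF W, of a] by (simp add: a_inv_def)
        have "f x = - f a + (f a + f x)" by simp
        also have "\<dots> = - f a + (f b + f y)" by (simp only: ab(3))
        also have "\<dots> = f ?d + f y" by (simp add: d add.assoc)
        finally have "W +> x = W +> y" using eq[OF xy(1,2)] dW by blast
        then show False using xy(3,4) ST(3) by simp
      qed
    qed
    show "finite S" if "S \<in> F" for S using that UF f(2) finite_subset[of S] by blast
  qed
  also have "\<dots> = (\<Sum>S\<in>F. card (f ` W))"
  proof (rule sum.cong)
    fix S assume "S \<in> F"
    then obtain x where x: "x \<in> carrier V" "S = f ` (W +> x)" unfolding F_def cs by blast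
    then show "card S = card (f ` W)" by (simp add: img card_image)
  qed simp
  also have "\<dots> = card (a_rcosets W) * card (f ` W)"
    using card_image[OF inj] by (simp add: F_def)
  finally show "card (a_rcosets W) * card (f ` W) = card (f ` carrier V)" by simp
qed

end

lemma module_restrict_scalars:
  fixes \<iota> :: "'f::{field,finite} \<Rightarrow> 'a"
  assumes V: "Module.module A V" and \<iota>: "\<iota> \<in> ring_hom (KK :: 'f ring) A"
  shows "Module.module (KK :: 'f ring) (restrict_scalars \<iota> V)"
proof -
  interpret module A V by fact
  have h: "\<iota> c \<in> carrier A" "\<iota> (c + d) = \<iota> c \<oplus>\<^bsub>A\<^esub> \<iota> d" "\<iota> (c * d) = \<iota> c \<otimes>\<^bsub>A\<^esub> \<iota> d" "\<iota> 1 = \<one>\<^bsub>A\<^esub>" for c d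
    using ring_hom_closed[OF \<iota>, of c] ring_hom_add[OF \<iota>, of c d] ring_hom_mult[OF \<iota>, of c d] ring_hom_one[OF \<iota>]
    by simp_all
  have "abelian_group (restrict_scalars \<iota> V)"
  proof (rule abelian_groupI)
    fix x assume "x \<in> carrier (restrict_scalars \<iota> V)"
    then show "\<exists>y\<in>carrier (restrict_scalars \<iota> V).
        y \<oplus>\<^bsub>restrict_scalars \<iota> V\<^esub> x = \<zero>\<^bsub>restrict_scalars \<iota> V\<^esub>"
      by (intro bexI[where x = "\<ominus>\<^bsub>V\<^esub> x"]) (auto simp: restrict_scalars_def M.l_neg)
  qed (auto simp: restrict_scalars_def M.a_ac)
  then show ?thesis
    by (rule moduleI[OF cring_from_type_algebra])
      (auto simp: restrict_scalars_def h smult_l_distr smult_r_distr smult_assoc1)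
qed

text \<open>With \<open>f\<close> a truncation whose kernel lies in \<open>W\<close>, the
  codimension in a possibly infinite space becomes a ratio of finite cardinalities. All codimensions
  of the theorem are evaluated in this way.\<close>

lemma codim_index:
  fixes V (structure) and \<iota> :: "'f::{field,finite} \<Rightarrow> 'a" and f :: "'v \<Rightarrow> 'c::ab_group_add"
  assumes V: "Module.module A V" and \<iota>: "\<iota> \<in> ring_hom (KK :: 'f ring) A"
    and W: "subgroup W (add_monoid V)" "\<And>c w. w \<in> W \<Longrightarrow> \<iota> c \<odot> w \<in> W"
    and f: "\<And>x y. x \<in> carrier V \<Longrightarrow> y \<in> carrier V \<Longrightarrow> f (x \<oplus> y) = f x + f y"
      "\<And>x. x \<in> carrier V \<Longrightarrow> f x = 0 \<Longrightarrow> x \<in> W" "finite (f ` carrier V)"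
  shows "CARD('f) ^ codim \<iota> V W * card (f ` W) = card (f ` carrier V)"
proof -
  interpret module A V by fact
  interpret f: additive_map V f by unfold_locales (fact f(1))
  let ?V = "restrict_scalars \<iota> V"
  interpret V': module "KK :: 'f ring" ?V by (rule module_restrict_scalars[OF V \<iota>])
  have Vs: "carrier ?V = carrier V" "add ?V = add V" "\<zero>\<^bsub>?V\<^esub> = \<zero>" "c \<odot>\<^bsub>?V\<^esub> x = \<iota> c \<odot> x" for c x
    by (simp_all add: restrict_scalars_def)
  have sub: "submodule W (KK :: 'f ring) ?V"
  proof (rule V'.submoduleI)
    fix w assume w: "w \<in> W"
    then have wc: "w \<in> carrier V" "\<ominus> w \<in> W"
      using W(1) subgroup.m_inv_closed[OF W(1), of w] by (auto simp: subgroup_def a_inv_def)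
    then have "\<ominus>\<^bsub>?V\<^esub> w = \<ominus> w"
      using V'.M.minus_equality[of "\<ominus> w" w] by (simp add: Vs M.l_neg)
    then show "\<ominus>\<^bsub>?V\<^esub> w \<in> W" using wc(2) by simp
  qed (use W in \<open>auto simp: Vs subgroup_def\<close>)
  have rc: "carrier (quotient_module ?V W) = a_rcosets W"
    by (simp add: quotient_module_def A_RCOSETS_def' a_r_coset_def' Vs)
  note cc = f.card_cosets[OF W(1) f(2,3)]
  have fin: "finite (carrier (quotient_module ?V W))" unfolding rc by (rule cc(1))
  have eq: "CARD('f) ^ codim \<iota> V W = card (carrier (quotient_module ?V W))"
    unfolding codim_def
    by (rule card_eq_power_vdim[OF module_quotient[OF module_restrict_scalars[OF V \<iota>] sub] fin])
  show ?thesis unfolding eq rc by (rule cc(2))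
qed

section \<open>Completeness bounds the conductor\<close>

text \<open>Order at least k. Unlike \<open>subdegree\<close>, which is 0 at the zero series, this
  includes the zero series for every k.\<close>

definition vanishes :: "nat \<Rightarrow> 'f::field fps \<Rightarrow> bool" where
  "vanishes k f \<longleftrightarrow> (\<forall>i<k. f $ i = 0)"

lemma vanishes_add: "vanishes k f \<Longrightarrow> vanishes k g \<Longrightarrow> vanishes k (f + g)"
  by (simp add: vanishes_def)

lemma vanishes_mult:
  assumes "vanishes k f" "vanishes l g"
  shows "vanishes (k + l) (f * g)"
proof -
  have "(\<Sum>j=0..i. f $ j * g $ (i - j)) = 0" if "i < k + l" for i
  proof (rule sum.neutral, rule ballI)
    fix j assume "j \<in> {0..i}"
    then have "j < k \<or> i - j < l" using that by auto
    then show "f $ j * g $ (i - j) = 0" using assms by (auto simp: vanishes_def)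
  qed
  then show ?thesis by (simp add: vanishes_def fps_mult_nth)
qed

lemma vanishes_antimono: "vanishes k f \<Longrightarrow> l \<le> k \<Longrightarrow> vanishes l f"
  by (simp add: vanishes_def)

lemma vanishes_Suc: "vanishes (Suc k) f \<longleftrightarrow> vanishes k f \<and> f $ k = 0"
  by (auto simp: vanishes_def less_Suc_eq)

text \<open>Write z = a / b with a and b in R. Expanding the fraction by a gives the denominator a
  b, which has no constant term because a is z b.\<close>

lemma fls_X_quotient:
  assumes "has_fraction_field_laurent R" "\<And>a b. a \<in> R \<Longrightarrow> b \<in> R \<Longrightarrow> a * b \<in> R"
  obtains a b where "a \<in> R" "b \<in> R" "b \<noteq> 0" "b $ 0 = 0" "a = fps_X * b"
proof -
  obtain a b where ab: "a \<in> R" "b \<in> R" "b \<noteq> 0" "(fls_X :: 'a fls) = fps_to_fls a / fps_to_fls b"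
    using assms(1) unfolding has_fraction_field_laurent_def by blast
  then have "fps_to_fls a = fps_to_fls (fps_X * b)"
    by (simp add: fls_times_fps_to_fls fps_to_fls_eq_0_iff field_simps)
  then have a: "a = fps_X * b" by (simp only: fps_to_fls_eq_iff)
  show ?thesis
  proof (rule that[of "a * a" "a * b"])
    show "a * a = fps_X * (a * b)" using a by (simp add: mult_ac)
    show "a * b \<noteq> 0" using a ab(3) by simp
    show "(a * b) $ 0 = 0" using a by simp
  qed (use ab assms(2) in auto)
qed

locale complete_presentation =
  fixes \<iota> :: "'f::field \<Rightarrow> 'b" and B :: "'b ring" (structure) and R :: "'f fps set" and \<pi> :: "'b \<Rightarrow> 'f fps"
  assumes complete: "complete_local_algebra \<iota> B"
    and pi_hom: "\<pi> \<in> ring_hom B (power_series_subring R)"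
    and pi_surj: "\<pi> ` carrier B = R"
    and pi_iota: "\<pi> (\<iota> c) = fps_const c"
begin

sublocale B: cring B
  using complete by (simp add: complete_local_algebra_def local_ring_def)

lemma iota_hom: "\<iota> \<in> ring_hom (ring_of_type_algebra :: 'f ring) B"
  using complete by (simp add: complete_local_algebra_def)

lemma iota_closed: "\<iota> c \<in> carrier B"
  using ring_hom_closed[OF iota_hom, of c] by simp

lemma iota_mult: "\<iota> (c * d) = \<iota> c \<otimes> \<iota> d"
  using ring_hom_mult[OF iota_hom, of c d] by simp

lemma iota_one: "\<iota> 1 = \<one>"
  using ring_hom_one[OF iota_hom] by simp

lemma pi_add: "x \<in> carrier B \<Longrightarrow> y \<in> carrier B \<Longrightarrow> \<pi> (x \<oplus> y) = \<pi> x + \<pi> y"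
  using ring_hom_add[OF pi_hom] by simp

lemma pi_mult: "x \<in> carrier B \<Longrightarrow> y \<in> carrier B \<Longrightarrow> \<pi> (x \<otimes> y) = \<pi> x * \<pi> y"
  using ring_hom_mult[OF pi_hom] by simp

lemma pi_one: "\<pi> \<one> = 1"
  using ring_hom_one[OF pi_hom] by simp

lemma pi_zero: "\<pi> \<zero> = 0"
  by (metis B.l_zero B.zero_closed add_cancel_right_right pi_add)

lemma pi_uminus: "x \<in> carrier B \<Longrightarrow> \<pi> (\<ominus> x) = - \<pi> x"
  using pi_add[of "\<ominus> x" x] by (simp add: B.l_neg pi_zero eq_neg_iff_add_eq_0)

lemma pi_minus: "x \<in> carrier B \<Longrightarrow> y \<in> carrier B \<Longrightarrow> \<pi> (x \<ominus> y) = \<pi> x - \<pi> y"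
  by (simp add: B.minus_eq pi_add pi_uminus)

lemma pi_pow: "x \<in> carrier B \<Longrightarrow> \<pi> (x [^] (k::nat)) = \<pi> x ^ k"
  by (induction k) (simp_all add: pi_one pi_mult mult.commute)

definition mB :: "'b set" where
  "mB = {b \<in> carrier B. \<pi> b $ 0 = 0}"

text \<open>The structure map lifts constant terms: an element outside \<open>mB\<close> differs by
  an element of \<open>mB\<close> from some \<open>\<iota> c\<close> with c nonzero, which is a
  unit.\<close>

lemma maximal_mB: "maximalideal mB B"
proof (rule maximalidealI)
  show "ideal mB B"
  proof (rule idealI[OF B.ring_axioms])
    show "subgroup mB (add_monoid B)"
    proof (rule subgroup.intro)
      fix x assume "x \<in> mB"
      then show "inv\<^bsub>add_monoid B\<^esub> x \<in> mB"
        unfolding a_inv_def[symmetric] by (simp add: mB_def pi_uminus)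
    qed (auto simp: mB_def pi_add pi_zero)
  qed (auto simp: mB_def pi_mult)
  have "\<one> \<notin> mB" by (simp add: mB_def pi_one)
  then show "carrier B \<noteq> mB" using B.one_closed by blast
  fix J assume J: "ideal J B" "mB \<subseteq> J" "J \<subseteq> carrier B"
  interpret J: ideal J B by (rule J)
  show "J = mB \<or> J = carrier B"
  proof (rule disjCI)
    assume "J \<noteq> carrier B"
    show "J = mB"
    proof (rule ccontr)
      assume "J \<noteq> mB"
      then obtain b where b: "b \<in> J" "b \<notin> mB" using J(2) by blast
      have bc: "b \<in> carrier B" using b(1) J(3) by blast
      define c where "c = \<pi> b $ 0"
      have c: "c \<noteq> 0" using b(2) bc by (simp add: mB_def c_def)
      have "\<iota> c \<ominus> b \<in> mB"
        using bc iota_closed[of c] by (simp add: mB_def pi_minus pi_iota) (simp add: c_def)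
      then have "(\<iota> c \<ominus> b) \<oplus> b \<in> J" using J(2) b(1) J.a_closed by blast
      then have "\<iota> c \<in> J" using bc iota_closed[of c] by (simp add: B.minus_eq B.a_assoc B.l_neg)
      then have "\<iota> (inverse c) \<otimes> \<iota> c \<in> J" using J.I_l_closed iota_closed by blast
      then have "\<one> \<in> J" using c by (simp flip: iota_mult iota_one)
      then show False using \<open>J \<noteq> carrier B\<close> J.one_imp_carrier by blast
    qed
  qed
qed

lemma max_ideal_B: "max_ideal B = mB"
proof -
  have "\<exists>!m. maximalideal m B"
    using complete by (simp add: complete_local_algebra_def local_ring_def)
  then show ?thesis
    unfolding max_ideal_def using maximal_mB by (rule the1_equality)
qed

lemma ideal_power_ideal: "ideal (ideal_power B mB k) B"
  by (induction k) (auto intro: B.oneideal B.ideal_prod_is_ideal maximalideal.axioms(1)[OF maximal_mB])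

lemma pow_mem_ideal_power: "b \<in> mB \<Longrightarrow> b [^] (k::nat) \<in> ideal_power B mB k"
  by (induction k) (auto intro: ideal_prod.prod)

text \<open>This is the continuity of \<open>\<pi>\<close>: convergence for the maximal ideal of B
  becomes convergence of power series.\<close>

lemma vanishes_ideal_power: "x \<in> ideal_power B mB k \<Longrightarrow> x \<in> carrier B \<and> vanishes k (\<pi> x)"
proof (induction k arbitrary: x)
  case (Suc k)
  from Suc.prems have "x \<in> ideal_prod B (ideal_power B mB k) mB" by simp
  then show ?case
  proof (induction rule: ideal_prod.induct)
    case (prod i j)
    have "vanishes 1 (\<pi> j)" using prod(2) by (simp add: mB_def vanishes_def)
    then have "vanishes (k + 1) (\<pi> i * \<pi> j)" using Suc.IH[OF prod(1)] vanishes_mult by blast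
    then show ?case using Suc.IH[OF prod(1)] prod(2) by (simp add: mB_def pi_mult)
  next
    case (sum x y)
    then show ?case by (simp add: pi_add vanishes_add)
  qed
qed (simp add: vanishes_def)

text \<open>Successive approximation: the coefficients of f are matched one after another by images
  of elements of ever higher powers of the maximal ideal of B, and completeness supplies an element
  of B whose image is f.\<close>

lemma large_power_series:
  assumes "has_fraction_field_laurent R"
  obtains N where "N \<ge> 1" "\<And>f. (\<And>k. k < N \<Longrightarrow> f $ k = 0) \<Longrightarrow> f \<in> R"
proof -
  have Rmult: "a * b \<in> R" if "a \<in> R" "b \<in> R" for a b
    using that pi_surj B.m_closed by (auto simp flip: pi_mult)
  obtain a b where ab: "a \<in> R" "b \<in> R" "b \<noteq> 0" "b $ 0 = 0" "a = fps_X * b"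
    using fls_X_quotient[OF assms Rmult] by blast
  obtain \<alpha> \<beta> where lift: "\<alpha> \<in> carrier B" "\<pi> \<alpha> = a" "\<beta> \<in> mB" "\<pi> \<beta> = b"
    using ab pi_surj by (auto simp: mB_def)
  have \<beta>: "\<beta> \<in> carrier B" using lift(3) by (simp add: mB_def)
  define p where "p = subdegree b"
  have p: "p \<ge> 1" using ab(3,4) subdegree_eq_0_iff[of b] by (simp add: p_def Suc_le_eq)
  text \<open>
    The products \<open>b\<^sup>p\<^sup>-\<^sup>i a\<^sup>i\<close> with \<open>i < p\<close> have the consecutive orders \<open>p\<^sup>2 + i\<close>,
    and multiplication with \<open>b\<close> raises the order by \<open>p\<close>.
  \<close>
  have step: "\<exists>\<gamma>\<in>ideal_power B mB j. vanishes (p * p + p * j + i) (h - \<pi> \<gamma>)"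
    if h: "vanishes (p * p + p * j) h" and "i \<le> p" for h i j
    using \<open>i \<le> p\<close>
  proof (induction i)
    case 0
    have "\<zero> \<in> ideal_power B mB j"
      by (rule additive_subgroup.zero_closed[OF ideal.axioms(1)[OF ideal_power_ideal]])
    then show ?case using h by (intro bexI[where x = "\<zero>"]) (simp_all add: pi_zero)
  next
    case (Suc i)
    then obtain \<gamma> where \<gamma>: "\<gamma> \<in> ideal_power B mB j" "vanishes (p * p + p * j + i) (h - \<pi> \<gamma>)" by auto
    interpret I: ideal "ideal_power B mB j" B by (rule ideal_power_ideal)
    \<comment> \<open>As a = z b, this is z^i b^(j + p), of order p^2 + p j + i. The factor b^j
      places its lift in the j-th power of the maximal ideal.\<close>
    define r where "r = b ^ j * (b ^ (p - i) * a ^ i)"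
    have "j + (p - i) + i = j + p" using Suc.prems by simp
    moreover have "r = fps_X ^ i * (b ^ j * b ^ (p - i) * b ^ i)"
      by (simp add: r_def ab(5) power_mult_distrib mult_ac)
    ultimately have "r = fps_X ^ i * b ^ (j + p)" by (simp only: power_add[symmetric])
    then have sub: "subdegree r = p * p + p * j + i" "r \<noteq> 0"
      using ab(3) by (simp_all add: p_def algebra_simps)
    \<comment> \<open>The scalar that cancels the first remaining coefficient of h - \<pi>
      \<gamma>.\<close>
    define c where "c = (h - \<pi> \<gamma>) $ (p * p + p * j + i) / r $ subdegree r"
    define \<eta> where "\<eta> = \<iota> c \<otimes> (\<beta> [^] j \<otimes> (\<beta> [^] (p - i) \<otimes> \<alpha> [^] i))"
    have \<eta>: "\<eta> \<in> ideal_power B mB j" "\<pi> \<eta> = fps_const c * r"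
      using pow_mem_ideal_power[OF lift(3), of j] lift \<beta> iota_closed[of c] I.I_l_closed I.I_r_closed
      by (simp_all add: \<eta>_def r_def pi_mult pi_pow pi_iota)
    have "\<pi> (\<gamma> \<oplus> \<eta>) = \<pi> \<gamma> + fps_const c * r"
      using \<gamma>(1) \<eta> I.Icarr by (simp add: pi_add)
    moreover have "vanishes (Suc (p * p + p * j + i)) (h - (\<pi> \<gamma> + fps_const c * r))"
    proof -
      have "r $ k = 0" if "k < p * p + p * j + i" for k
        using that nth_less_subdegree_zero[of k r] by (simp only: sub(1))
      moreover have "r $ (p * p + p * j + i) \<noteq> 0" using sub nth_subdegree_nonzero by metis
      ultimately show ?thesis
        using \<gamma>(2) unfolding vanishes_Suc by (simp add: vanishes_def c_def sub(1))
    qed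
    ultimately show ?case using \<gamma>(1) \<eta>(1) I.a_closed by (metis add_Suc_right)
  qed
  have "f \<in> R" if f: "\<And>k. k < p * p \<Longrightarrow> f $ k = 0" for f
  proof -
    let ?P = "\<lambda>j x. x \<in> carrier B \<and> vanishes (p * p + p * j) (f - \<pi> x)"
    \<comment> \<open>Stage j removes p consecutive coefficients by a correction from the j-th power
      of the maximal ideal, so the approximations form a Cauchy sequence.\<close>
    have "\<exists>s. \<forall>j. ?P j (s j) \<and> s (Suc j) \<ominus> s j \<in> ideal_power B mB j"
    proof (rule dependent_nat_choice)
      show "\<exists>x. ?P 0 x"
        using f by (intro exI[where x = "\<zero>"]) (simp add: pi_zero vanishes_def)
      fix x j assume x: "?P j x"
      then obtain \<gamma> where \<gamma>: "\<gamma> \<in> ideal_power B mB j" "vanishes (p * p + p * j + p) (f - \<pi> x - \<pi> \<gamma>)"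
        using step[of j "f - \<pi> x" p] by auto
      have c: "\<gamma> \<in> carrier B" using vanishes_ideal_power[OF \<gamma>(1)] by blast
      have "(\<gamma> \<oplus> x) \<ominus> x = \<gamma>" using x c by (simp add: B.minus_eq B.a_assoc B.r_neg)
      moreover have "vanishes (p * p + p * Suc j) (f - \<pi> (\<gamma> \<oplus> x))"
        using \<gamma>(2) x c by (simp add: pi_add algebra_simps)
      ultimately show "\<exists>y. ?P (Suc j) y \<and> y \<ominus> x \<in> ideal_power B mB j"
        using \<gamma>(1) x c by (intro exI[where x = "\<gamma> \<oplus> x"]) simp
    qed
    then obtain s where s: "\<And>j. ?P j (s j)" "\<And>j. s (Suc j) \<ominus> s j \<in> ideal_power B mB j" by blast
    have "adically_complete B mB"
      using complete by (simp add: complete_local_algebra_def max_ideal_B)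
    then obtain l where l: "l \<in> carrier B" "\<And>j. s j \<ominus> l \<in> ideal_power B mB j"
      unfolding adically_complete_def using s by meson
    \<comment> \<open>Both f and \<pi> l agree with the image of \<open>s (Suc j)\<close> in all
      coefficients up to the j-th.\<close>
    have "(f - \<pi> l) $ j = 0" for j
    proof -
      have "vanishes (Suc j) (\<pi> (s (Suc j)) - \<pi> l)"
        using vanishes_ideal_power[OF l(2)[of "Suc j"]] s(1)[of "Suc j"] l(1) by (simp add: pi_minus)
      moreover have "1 * Suc j \<le> p * Suc j" using p by (rule mult_le_mono1)
      then have "Suc j \<le> p * p + p * Suc j" by (simp add: trans_le_add2)
      then have "vanishes (Suc j) (f - \<pi> (s (Suc j)))"
        by (rule vanishes_antimono[OF conjunct2[OF s(1)]])
      ultimately have "vanishes (Suc j) (f - \<pi> (s (Suc j)) + (\<pi> (s (Suc j)) - \<pi> l))"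
        by (intro vanishes_add)
      then show ?thesis by (simp add: vanishes_def)
    qed
    then have "f = \<pi> l" by (simp add: fps_eq_iff)
    then show ?thesis using l(1) pi_surj by blast
  qed
  then show ?thesis using that[of "p * p"] p by simp
qed

end

section \<open>Submodules of free modules and lattices\<close>

lemma free_module_simps:
  "carrier (free_module A n) = {..<n} \<rightarrow>\<^sub>E carrier A"
  "u \<oplus>\<^bsub>free_module A n\<^esub> v = (\<lambda>i\<in>{..<n}. u i \<oplus>\<^bsub>A\<^esub> v i)"
  "\<zero>\<^bsub>free_module A n\<^esub> = (\<lambda>i\<in>{..<n}. \<zero>\<^bsub>A\<^esub>)"
  "a \<odot>\<^bsub>free_module A n\<^esub> v = (\<lambda>i\<in>{..<n}. a \<otimes>\<^bsub>A\<^esub> v i)"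
  by (simp_all add: free_module_def)

lemma module_free_module:
  assumes "cring A"
  shows "Module.module A (free_module A n)"
proof -
  interpret cring A by fact
  let ?F = "free_module A n"
  have mem: "v i \<in> carrier A" if "v \<in> carrier ?F" "i < n" for v i
    using that unfolding free_module_simps by (auto elim: PiE_mem)
  have restr: "(\<lambda>i\<in>{..<n}. v i) = v" if "v \<in> carrier ?F" for v
    using PiE_restrict that unfolding free_module_simps by blast
  have closed: "(\<lambda>i\<in>{..<n}. h i) \<in> carrier ?F" if "\<And>i. i < n \<Longrightarrow> h i \<in> carrier A" for h
    unfolding free_module_simps restrict_PiE_iff using that by simp
  have "abelian_group ?F"
  proof (rule abelian_groupI)
    show "\<zero>\<^bsub>?F\<^esub> \<in> carrier ?F" unfolding free_module_simps(3) by (rule closed) simp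
    fix u assume u: "u \<in> carrier ?F"
    show "\<exists>w\<in>carrier ?F. w \<oplus>\<^bsub>?F\<^esub> u = \<zero>\<^bsub>?F\<^esub>"
    proof (rule bexI)
      show "(\<lambda>i\<in>{..<n}. \<ominus>\<^bsub>A\<^esub> u i) \<oplus>\<^bsub>?F\<^esub> u = \<zero>\<^bsub>?F\<^esub>"
        unfolding free_module_simps by (rule restrict_ext) (simp add: mem[OF u] l_neg)
      show "(\<lambda>i\<in>{..<n}. \<ominus>\<^bsub>A\<^esub> u i) \<in> carrier ?F"
        by (rule closed) (simp add: mem[OF u])
    qed
    show "\<zero>\<^bsub>?F\<^esub> \<oplus>\<^bsub>?F\<^esub> u = u"
    proof -
      have "\<zero>\<^bsub>?F\<^esub> \<oplus>\<^bsub>?F\<^esub> u = (\<lambda>i\<in>{..<n}. u i)"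
        unfolding free_module_simps by (rule restrict_ext) (simp add: mem[OF u])
      then show ?thesis using restr[OF u] by simp
    qed
    fix v assume v: "v \<in> carrier ?F"
    show "u \<oplus>\<^bsub>?F\<^esub> v \<in> carrier ?F"
      unfolding free_module_simps(2) by (rule closed) (simp add: mem[OF u] mem[OF v])
    show "u \<oplus>\<^bsub>?F\<^esub> v = v \<oplus>\<^bsub>?F\<^esub> u"
      unfolding free_module_simps by (rule restrict_ext) (simp add: mem[OF u] mem[OF v] a_comm)
    fix w assume w: "w \<in> carrier ?F"
    show "u \<oplus>\<^bsub>?F\<^esub> v \<oplus>\<^bsub>?F\<^esub> w = u \<oplus>\<^bsub>?F\<^esub> (v \<oplus>\<^bsub>?F\<^esub> w)"
      unfolding free_module_simps by (rule restrict_ext) (simp add: mem[OF u] mem[OF v] mem[OF w] a_assoc)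
  qed
  then show ?thesis
  proof (rule moduleI[OF assms])
    fix u assume u: "u \<in> carrier ?F"
    show "\<one>\<^bsub>A\<^esub> \<odot>\<^bsub>?F\<^esub> u = u"
    proof -
      have "\<one>\<^bsub>A\<^esub> \<odot>\<^bsub>?F\<^esub> u = (\<lambda>i\<in>{..<n}. u i)"
        unfolding free_module_simps by (rule restrict_ext) (simp add: mem[OF u])
      then show ?thesis using restr[OF u] by simp
    qed
    fix a assume a: "a \<in> carrier A"
    show "a \<odot>\<^bsub>?F\<^esub> u \<in> carrier ?F"
      unfolding free_module_simps(4) by (rule closed) (simp add: a mem[OF u])
    show "a \<odot>\<^bsub>?F\<^esub> (u \<oplus>\<^bsub>?F\<^esub> v) = a \<odot>\<^bsub>?F\<^esub> u \<oplus>\<^bsub>?F\<^esub> a \<odot>\<^bsub>?F\<^esub> v" if v: "v \<in> carrier ?F" for v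
      unfolding free_module_simps by (rule restrict_ext) (simp add: a mem[OF u] mem[OF v] r_distr)
    fix b assume b: "b \<in> carrier A"
    show "(a \<oplus>\<^bsub>A\<^esub> b) \<odot>\<^bsub>?F\<^esub> u = a \<odot>\<^bsub>?F\<^esub> u \<oplus>\<^bsub>?F\<^esub> b \<odot>\<^bsub>?F\<^esub> u"
      unfolding free_module_simps by (rule restrict_ext) (simp add: a b mem[OF u] l_distr)
    show "(a \<otimes>\<^bsub>A\<^esub> b) \<odot>\<^bsub>?F\<^esub> u = a \<odot>\<^bsub>?F\<^esub> (b \<odot>\<^bsub>?F\<^esub> u)"
      unfolding free_module_simps by (rule restrict_ext) (simp add: a b mem[OF u] m_assoc)
  qed
qed

text \<open>Passes from the vectors of \<open>free_module\<close>, which are undefined outside the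
  index range, to vectors in \<open>VV\<close> while applying \<open>p\<close> to the
  coordinates.\<close>

definition zero_extend :: "('a \<Rightarrow> 'c::zero) \<Rightarrow> nat \<Rightarrow> (nat \<Rightarrow> 'a) \<Rightarrow> nat \<Rightarrow> 'c" where
  "zero_extend p n v = (\<lambda>i. if i < n then p (v i) else 0)"

lemma additive_map_zero_extend:
  fixes p :: "'a \<Rightarrow> 'c::ab_group_add"
  assumes "cring A" "\<And>x y. x \<in> carrier A \<Longrightarrow> y \<in> carrier A \<Longrightarrow> p (x \<oplus>\<^bsub>A\<^esub> y) = p x + p y"
  shows "additive_map (free_module A n) (zero_extend p n)"
proof -
  interpret module A "free_module A n" by (rule module_free_module[OF assms(1)])
  show ?thesis
  proof (unfold_locales)
    fix x y assume "x \<in> carrier (free_module A n)" "y \<in> carrier (free_module A n)"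
    then have "x i \<in> carrier A" "y i \<in> carrier A" if "i < n" for i
      using that by (auto simp: free_module_simps)
    then show "zero_extend p n (x \<oplus>\<^bsub>free_module A n\<^esub> y) = zero_extend p n x + zero_extend p n y"
      using assms(2) by (auto simp: zero_extend_def free_module_simps fun_eq_iff)
  qed
qed

context large_subring
begin

lemma sz_product:
  assumes "0 \<in> S"
  shows "sz {v \<in> VV n. \<forall>i. v i \<in> S} = card (fps_cutoff N ` S) ^ n"
proof -
  let ?F = "{v \<in> VV n. \<forall>i. v i \<in> S}"
  have "bij_betw (\<lambda>w. restrict w {..<n}) (vt ` ?F) ({..<n} \<rightarrow>\<^sub>E fps_cutoff N ` S)"
  proof (rule bij_betw_byWitness[where f' = "zero_extend id n"])
    show "\<forall>w\<in>vt ` ?F. zero_extend id n (restrict w {..<n}) = w"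
      using vt_VV by (fastforce simp: zero_extend_def VV_def fun_eq_iff)
    show "\<forall>h\<in>{..<n} \<rightarrow>\<^sub>E fps_cutoff N ` S. restrict (zero_extend id n h) {..<n} = h"
    proof
      fix h assume "h \<in> {..<n} \<rightarrow>\<^sub>E fps_cutoff N ` S"
      then have "restrict h {..<n} = h" by (rule PiE_restrict)
      moreover have "restrict (zero_extend id n h) {..<n} = restrict h {..<n}"
        by (rule restrict_ext) (simp add: zero_extend_def)
      ultimately show "restrict (zero_extend id n h) {..<n} = h" by simp
    qed
    show "(\<lambda>w. restrict w {..<n}) ` vt ` ?F \<subseteq> {..<n} \<rightarrow>\<^sub>E fps_cutoff N ` S"
    proof (intro image_subsetI)
      fix w assume "w \<in> vt ` ?F"
      then show "restrict w {..<n} \<in> {..<n} \<rightarrow>\<^sub>E fps_cutoff N ` S"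
        unfolding restrict_PiE_iff by (auto simp: vt_def)
    qed
    show "zero_extend id n ` ({..<n} \<rightarrow>\<^sub>E fps_cutoff N ` S) \<subseteq> vt ` ?F"
    proof (rule image_subsetI)
      fix h assume h: "h \<in> {..<n} \<rightarrow>\<^sub>E fps_cutoff N ` S"
      have "\<exists>s\<in>S. h i = fps_cutoff N s" if "i < n" for i using h that by blast
      then obtain s where s: "\<And>i. i < n \<Longrightarrow> s i \<in> S \<and> h i = fps_cutoff N (s i)" by metis
      have "zero_extend id n h = vt (zero_extend id n s)"
        using s by (auto simp: zero_extend_def vt_def fun_eq_iff)
      moreover have "zero_extend id n s \<in> ?F" using s assms by (auto simp: zero_extend_def VV_def)
      ultimately show "zero_extend id n h \<in> vt ` ?F" by blast
    qed
  qed
  then have "sz ?F = card ({..<n} \<rightarrow>\<^sub>E fps_cutoff N ` S)" by (rule bij_betw_same_card)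
  then show ?thesis by (simp add: card_PiE)
qed

lemma fps_const_hom: "fps_const \<in> ring_hom (KK :: 'f ring) (\<O> :: 'f fps ring)"
  by (rule ring_hom_memI) (simp_all add: fps_const_add fps_const_mult flip: fps_const_1_eq_1)

lemma module_O: "Module.module (\<O> :: 'f fps ring) (self_module \<O>)"
proof (rule moduleI[OF cring_from_type_algebra])
  show "abelian_group (self_module (\<O> :: 'f fps ring))"
  proof (rule abelian_groupI)
    fix x :: "'f fps"
    show "\<exists>y\<in>carrier (self_module \<O>). y \<oplus>\<^bsub>self_module \<O>\<^esub> x = \<zero>\<^bsub>self_module \<O>\<^esub>"
      by (rule bexI[of _ "- x"]) (simp_all add: self_module_def)
  qed (simp_all add: self_module_def add_ac)
qed (simp_all add: self_module_def algebra_simps)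

lemma subgroup_R: "subgroup R (add_monoid (self_module (\<O> :: 'f fps ring)))"
proof (rule subgroup.intro)
  interpret module "\<O> :: 'f fps ring" "self_module \<O>" by (rule module_O)
  fix x assume x: "x \<in> R"
  have "\<ominus>\<^bsub>self_module \<O>\<^esub> x = - x"
    by (rule M.minus_equality) (simp_all add: self_module_def)
  then show "inv\<^bsub>add_monoid (self_module \<O>)\<^esub> x \<in> R"
    unfolding a_inv_def using R_uminus[OF x] by simp
qed (simp_all add: self_module_def R_add R_zero)

text \<open>The quotient \<O>^n / R^n consists of n copies of \<O> / R; this is the origin of the
  exponent \<delta> n.\<close>

lemma index_RV: "CARD('f) ^ (delta_invariant R * n) * sz (RV n) = sz (VV n)"
proof -
  have "CARD('f) ^ delta_invariant R * card (fps_cutoff N ` R) = card (fps_cutoff N ` carrier (self_module (\<O> :: 'f fps ring)))"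
    unfolding delta_invariant_def
    by (rule codim_index[OF module_O fps_const_hom subgroup_R])
      (auto simp: self_module_def R_mult R_const fps_cutoff_add fps_cutoff_eq_0 R_large finite_fps_cutoff)
  then have "(CARD('f) ^ delta_invariant R * card (fps_cutoff N ` R)) ^ n = card (fps_cutoff N ` (UNIV :: 'f fps set)) ^ n"
    by (simp add: self_module_def)
  then show ?thesis
    using sz_product[OF R_zero, of n] sz_product[of UNIV n]
    by (simp add: RV_def power_mult_distrib power_mult)
qed

text \<open>An ideal inside R contains all multiples f g of its elements f, so it lies in
  \<open>cond\<close>; as \<open>cond\<close> is itself such an ideal, the greatest one
  exists.\<close>

lemma conductor_eq: "conductor R = cond"
  unfolding conductor_def
proof (rule Greatest_equality)
  have "subgroup cond (add_monoid (\<O> :: 'f fps ring))"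
  proof (rule subgroup.intro)
    fix x assume x: "x \<in> cond"
    have "\<ominus>\<^bsub>\<O>\<^esub> x = - x"
      by (rule abelian_group.minus_equality)
        (simp_all add: ring.is_abelian_group[OF cring.axioms(1)[OF cring_from_type_algebra]])
    then show "inv\<^bsub>add_monoid \<O>\<^esub> x \<in> cond"
      unfolding a_inv_def using x R_uminus by (simp add: cond_def)
  qed (simp_all add: cond_def R_add R_zero distrib_right)
  then have "ideal cond (\<O> :: 'f fps ring)"
    by (rule idealI[OF cring.axioms(1)[OF cring_from_type_algebra]])
      (simp_all add: cond_def mult.assoc mult.left_commute)
  then show "ideal cond \<O> \<and> cond \<subseteq> R" using cond_R by blast
  fix I assume I: "ideal I (\<O> :: 'f fps ring) \<and> I \<subseteq> R"
  then interpret ideal I "\<O> :: 'f fps ring" by blast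
  show "I \<subseteq> cond"
    using I_r_closed I by (auto simp: cond_def)
qed

section \<open>Standard submodules as lattices of vectors of power series\<close>

abbreviation FO :: "nat \<Rightarrow> ('f fps, nat \<Rightarrow> 'f fps) module" where
  "FO n \<equiv> free_module \<O> n"

abbreviation EO :: "nat \<Rightarrow> (nat \<Rightarrow> 'f fps) \<Rightarrow> nat \<Rightarrow> 'f fps" where
  "EO n \<equiv> zero_extend id n"

lemma submodule_iff_subgroup:
  "submodule W A V \<longleftrightarrow> subgroup W (add_monoid V) \<and> (\<forall>a\<in>carrier A. \<forall>x\<in>W. a \<odot>\<^bsub>V\<^esub> x \<in> W)"
  by (auto simp: submodule_def submodule_axioms_def)

lemma additive_EO: "additive_map (FO n) (EO n)"
  by (rule additive_map_zero_extend[OF cring_from_type_algebra]) simp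

lemma EO_smult: "EO n (a \<odot>\<^bsub>FO n\<^esub> v) = scal a (EO n v)"
  by (auto simp: zero_extend_def free_module_simps scal_def fun_eq_iff)

lemma EO_image: "EO n ` carrier (FO n) = VV n"
proof
  show "VV n \<subseteq> EO n ` carrier (FO n)"
  proof
    fix w assume w: "w \<in> VV n"
    then have "w = EO n (restrict w {..<n})" by (auto simp: zero_extend_def VV_def fun_eq_iff)
    moreover have "restrict w {..<n} \<in> carrier (FO n)" by (simp add: free_module_simps restrict_PiE_iff)
    ultimately show "w \<in> EO n ` carrier (FO n)" by blast
  qed
qed (auto simp: zero_extend_def VV_def)

lemma EO_kernel:
  assumes "v \<in> carrier (FO n)" "EO n v = 0"
  shows "v = \<zero>\<^bsub>FO n\<^esub>"
proof -
  have "v i = 0" if "i < n" for i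
    using fun_cong[OF assms(2), of i] that by (simp add: zero_extend_def)
  moreover have "v = restrict v {..<n}" using assms(1) PiE_restrict[of v] by (simp add: free_module_simps)
  ultimately show ?thesis unfolding free_module_simps by (metis (no_types, lifting) lessThan_iff restrict_ext ring_of_type_algebra_simps(5))
qed

lemma EO_kernel_subgroup:
  assumes "subgroup W (add_monoid (FO n))" "v \<in> carrier (FO n)" "EO n v = 0"
  shows "v \<in> W"
  using EO_kernel[OF assms(2,3)] subgroup.one_closed[OF assms(1)] by simp

lemma EO_submodule:
  assumes "submodule M A (FO n)"
  shows "EO n ` M \<subseteq> VV n" "add_closed (EO n ` M)"
    "r \<in> carrier A \<Longrightarrow> v \<in> EO n ` M \<Longrightarrow> scal r v \<in> EO n ` M"
proof -
  have M: "subgroup M (add_monoid (FO n))" "\<And>a x. a \<in> carrier A \<Longrightarrow> x \<in> M \<Longrightarrow> a \<odot>\<^bsub>FO n\<^esub> x \<in> M"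
    using assms by (auto simp: submodule_iff_subgroup)
  have "M \<subseteq> carrier (FO n)" using subgroup.subset[OF M(1)] by simp
  then show "EO n ` M \<subseteq> VV n" using EO_image by blast
  show "add_closed (EO n ` M)"
    by (rule additive_map.add_closed_image_subgroup[OF additive_EO M(1)])
  assume r: "r \<in> carrier A" and "v \<in> EO n ` M"
  then obtain w where w: "w \<in> M" "v = EO n w" by blast
  show "scal r v \<in> EO n ` M"
    unfolding w(2) EO_smult[symmetric] using M(2)[OF r w(1)] by blast
qed

lemma vmod_EO: "submodule M RR (FO n) \<Longrightarrow> vmod n (EO n ` M)"
  using EO_submodule[of M RR n] by (simp add: vmod_def)

lemma osub_EO: "submodule M \<O> (FO n) \<Longrightarrow> osub n (EO n ` M)"
  using EO_submodule[of M \<O> n] by (simp add: osub_def)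

lemma smult_FO_closed: "v \<in> carrier (FO n) \<Longrightarrow> a \<odot>\<^bsub>FO n\<^esub> v \<in> carrier (FO n)"
  by (simp add: free_module_simps restrict_PiE_iff)

abbreviation PO :: "nat \<Rightarrow> (nat \<Rightarrow> 'f fps) set \<Rightarrow> (nat \<Rightarrow> 'f fps) set" where
  "PO n \<equiv> additive_map.preimage (FO n) (EO n)"

lemma PO_mem: "v \<in> PO n W \<longleftrightarrow> v \<in> carrier (FO n) \<and> EO n v \<in> W"
  by (simp add: additive_map.preimage_def[OF additive_EO])

lemma submodule_PO:
  assumes "vmod n N'"
  shows "submodule (PO n N') RR (FO n)"
  unfolding submodule_iff_subgroup
  using additive_map.subgroup_preimage[OF additive_EO vmodD(2)[OF assms]]
  by (auto simp: PO_mem EO_smult smult_FO_closed vmodD(6)[OF assms])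

lemma submodule_PO_osub:
  assumes "osub n W"
  shows "submodule (PO n W) \<O> (FO n)"
  unfolding submodule_iff_subgroup
  using additive_map.subgroup_preimage[OF additive_EO, of W n] assms
  by (auto simp: PO_mem EO_smult smult_FO_closed osub_def)

text \<open>\<open>EO n\<close> has trivial kernel, so images and preimages match the
  \<O>-submodules of the two encodings of \<O>^n.\<close>

lemma generates_iff:
  assumes M: "M \<subseteq> carrier (FO n)"
  shows "generated_submodule \<O> (FO n) M = carrier (FO n) \<longleftrightarrow> (\<forall>W. osub n W \<and> EO n ` M \<subseteq> W \<longrightarrow> W = VV n)"
proof
  assume gen: "generated_submodule \<O> (FO n) M = carrier (FO n)"
  show "\<forall>W. osub n W \<and> EO n ` M \<subseteq> W \<longrightarrow> W = VV n"
  proof (intro allI impI)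
    fix W assume W: "osub n W \<and> EO n ` M \<subseteq> W"
    have "submodule (PO n W) \<O> (FO n)" using submodule_PO_osub W by blast
    moreover have "v \<in> PO n W" if "v \<in> M" for v
      unfolding PO_mem using that M W by blast
    ultimately have "carrier (FO n) \<subseteq> PO n W"
      unfolding gen[symmetric] generated_submodule_def by blast
    then have "VV n \<subseteq> W" unfolding EO_image[symmetric] by (auto simp: PO_mem)
    then show "W = VV n" using W by (auto simp: osub_def)
  qed
next
  assume *: "\<forall>W. osub n W \<and> EO n ` M \<subseteq> W \<longrightarrow> W = VV n"
  have "K = carrier (FO n)" if K: "submodule K \<O> (FO n)" "M \<subseteq> K" for K
  proof -
    have sg: "subgroup K (add_monoid (FO n))" using K(1) by (simp add: submodule_def)
    have "EO n ` K = VV n" using * osub_EO[OF K(1)] K(2) by blast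
    then have "EO n ` K = EO n ` carrier (FO n)" by (simp only: EO_image)
    then have "v \<in> PO n (EO n ` K)" if "v \<in> carrier (FO n)" for v
      unfolding PO_mem using that by blast
    then have "carrier (FO n) \<subseteq> PO n (EO n ` K)" by blast
    also have "\<dots> = K"
      by (rule additive_map.preimage_image[OF additive_EO sg EO_kernel_subgroup[OF sg]])
    finally show ?thesis using subgroup.subset[OF sg] by auto
  qed
  moreover have "submodule (carrier (FO n)) \<O> (FO n)"
    by (rule module.carrier_is_submodule[OF module_free_module[OF cring_from_type_algebra]])
  ultimately show "generated_submodule \<O> (FO n) M = carrier (FO n)"
    unfolding generated_submodule_def using M by blast
qed

lemma standard_subgroup: "M \<in> standard_submodules R n \<Longrightarrow> subgroup M (add_monoid (FO n))"
  by (simp add: standard_submodules_def submodule_def)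

lemma PO_EO: "M \<in> standard_submodules R n \<Longrightarrow> PO n (EO n ` M) = M"
  by (rule additive_map.preimage_image[OF additive_EO])
    (auto dest: standard_subgroup intro: EO_kernel_subgroup)

lemma EO_PO: "M \<in> std n \<Longrightarrow> EO n ` PO n M = M"
  by (rule additive_map.image_preimage[OF additive_EO]) (simp add: EO_image std_def vmod_def)

lemma EO_std:
  assumes "M \<in> standard_submodules R n"
  shows "EO n ` M \<in> std n"
proof -
  have M: "submodule M RR (FO n)" "generated_submodule \<O> (FO n) M = carrier (FO n)"
    using assms by (auto simp: standard_submodules_def)
  have "M \<subseteq> carrier (FO n)" using subgroup.subset[OF standard_subgroup[OF assms]] by simp
  then show ?thesis
    unfolding std_def using vmod_EO[OF M(1)] M(2) generates_iff by blast
qed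

lemma PO_standard:
  assumes "M \<in> std n"
  shows "PO n M \<in> standard_submodules R n"
proof -
  have "PO n M \<subseteq> carrier (FO n)" by (auto simp: PO_mem)
  moreover have "vmod n M" using assms by (simp add: std_def)
  ultimately show ?thesis
    unfolding standard_submodules_def
    using submodule_PO generates_iff[of "PO n M" n] assms by (simp add: EO_PO std_def)
qed

lemma bij_betw_EO: "bij_betw (\<lambda>M. EO n ` M) (standard_submodules R n) (std n)"
  by (rule bij_betw_byWitness[where f' = "PO n"])
    (auto simp: PO_EO EO_PO EO_std PO_standard simp del: image_iff)

lemma index_standard:
  assumes M: "M \<in> standard_submodules R n"
  shows "CARD('f) ^ codim fps_const (FO n) M * sz (EO n ` M) = sz (VV n)"
proof -
  interpret additive_map "FO n" "EO n" by (rule additive_EO)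
  have sg: "subgroup M (add_monoid (FO n))" by (rule standard_subgroup[OF M])
  have sub: "submodule M RR (FO n)" using M by (simp add: standard_submodules_def)
  have "CARD('f) ^ codim fps_const (FO n) M * card ((\<lambda>v. vt (EO n v)) ` M) = card ((\<lambda>v. vt (EO n v)) ` carrier (FO n))"
  proof (rule codim_index[OF module_free_module[OF cring_from_type_algebra] fps_const_hom sg])
    show "fps_const c \<odot>\<^bsub>FO n\<^esub> w \<in> M" if "w \<in> M" for c w
      using that sub R_const by (simp add: submodule_iff_subgroup)
    show "vt (EO n (x \<oplus>\<^bsub>FO n\<^esub> y)) = vt (EO n x) + vt (EO n y)"
      if "x \<in> carrier (FO n)" "y \<in> carrier (FO n)" for x y
      using f_add[OF that] by (simp add: vt_add)
    show "x \<in> M" if x: "x \<in> carrier (FO n)" "vt (EO n x) = 0" for x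
    proof -
      have "EO n x \<in> ZV n" using x EO_image by (auto simp: ZV_def)
      then have "EO n x \<in> EO n ` M" using ZV_std[OF EO_std[OF M]] by blast
      then have "x \<in> PO n (EO n ` M)" using x(1) by (simp add: PO_mem)
      then show ?thesis by (simp add: PO_EO[OF M])
    qed
    show "finite ((\<lambda>v. vt (EO n v)) ` carrier (FO n))"
      using finite_vt[of "VV n" n] by (simp add: EO_image[symmetric] image_image)
  qed
  then show ?thesis by (simp add: EO_image[symmetric] image_image)
qed

end

section \<open>Submodules over the presenting ring\<close>

locale presented_subring =
  dualized_subring R N \<theta> + complete_presentation \<iota> B R \<pi>
  for R :: "'f::{field,finite} fps set" and N \<theta> and \<iota> :: "'f \<Rightarrow> 'b" and B :: "'b ring" and \<pi>
begin

abbreviation FB :: "nat \<Rightarrow> ('b, nat \<Rightarrow> 'b) module" where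
  "FB n \<equiv> free_module B n"

abbreviation EB :: "nat \<Rightarrow> (nat \<Rightarrow> 'b) \<Rightarrow> nat \<Rightarrow> 'f fps" where
  "EB n \<equiv> zero_extend \<pi> n"

lemma additive_EB: "additive_map (FB n) (EB n)"
  by (rule additive_map_zero_extend[OF B.is_cring]) (rule pi_add)

lemma FB_mem: "v \<in> carrier (FB n) \<Longrightarrow> i < n \<Longrightarrow> v i \<in> carrier B"
  unfolding free_module_simps by (auto elim: PiE_mem)

lemma EB_smult: "b \<in> carrier B \<Longrightarrow> v \<in> carrier (FB n) \<Longrightarrow> EB n (b \<odot>\<^bsub>FB n\<^esub> v) = scal (\<pi> b) (EB n v)"
  by (auto simp: zero_extend_def free_module_simps(4) scal_def fun_eq_iff pi_mult FB_mem)

lemma EB_image: "EB n ` carrier (FB n) = RV n"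
proof
  show "EB n ` carrier (FB n) \<subseteq> RV n"
  proof (rule image_subsetI)
    fix v assume "v \<in> carrier (FB n)"
    then have "\<pi> (v i) \<in> R" if "i < n" for i using FB_mem that pi_surj by blast
    then show "EB n v \<in> RV n" using R_zero by (simp add: zero_extend_def RV_def VV_def)
  qed
  show "RV n \<subseteq> EB n ` carrier (FB n)"
  proof
    fix w assume w: "w \<in> RV n"
    then have "w i \<in> \<pi> ` carrier B" for i by (simp add: pi_surj RV_def)
    then have "\<exists>b\<in>carrier B. \<pi> b = w i" for i by (metis imageE)
    then obtain b where b: "\<And>i. b i \<in> carrier B" "\<And>i. \<pi> (b i) = w i" by metis
    have "w = EB n (restrict b {..<n})" using w b(2) by (auto simp: zero_extend_def RV_def VV_def fun_eq_iff)
    moreover have "restrict b {..<n} \<in> carrier (FB n)" by (simp add: free_module_simps restrict_PiE_iff b)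
    ultimately show "w \<in> EB n ` carrier (FB n)" by blast
  qed
qed

abbreviation PB :: "nat \<Rightarrow> (nat \<Rightarrow> 'f fps) set \<Rightarrow> (nat \<Rightarrow> 'b) set" where
  "PB n \<equiv> additive_map.preimage (FB n) (EB n)"

lemma PB_mem: "v \<in> PB n W \<longleftrightarrow> v \<in> carrier (FB n) \<and> EB n v \<in> W"
  by (simp add: additive_map.preimage_def[OF additive_EB])

abbreviation above :: "nat \<Rightarrow> (nat \<Rightarrow> 'b) set set" where
  "above n \<equiv> submodules_above B n (conductor_lift B \<pi> R n)"

lemma conductor_lift_eq: "conductor_lift B \<pi> R n = PB n (CV n)"
proof -
  have "0 \<in> cond" by (simp add: cond_def R_zero)
  then have "EB n v \<in> CV n \<longleftrightarrow> (\<forall>i<n. \<pi> (v i) \<in> cond)" for v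
    by (auto simp: CV_def VV_def zero_extend_def)
  then show ?thesis by (auto simp: conductor_lift_def conductor_eq PB_mem)
qed

lemma aboveD:
  assumes "M \<in> above n"
  shows "subgroup M (add_monoid (FB n))" "\<And>b v. b \<in> carrier B \<Longrightarrow> v \<in> M \<Longrightarrow> b \<odot>\<^bsub>FB n\<^esub> v \<in> M"
    "M \<subseteq> carrier (FB n)" "\<And>v. v \<in> carrier (FB n) \<Longrightarrow> EB n v \<in> CV n \<Longrightarrow> v \<in> M"
proof -
  show sg: "subgroup M (add_monoid (FB n))" "\<And>b v. b \<in> carrier B \<Longrightarrow> v \<in> M \<Longrightarrow> b \<odot>\<^bsub>FB n\<^esub> v \<in> M"
    "\<And>v. v \<in> carrier (FB n) \<Longrightarrow> EB n v \<in> CV n \<Longrightarrow> v \<in> M"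
    using assms by (auto simp: submodules_above_def submodule_iff_subgroup conductor_lift_eq PB_mem)
  show "M \<subseteq> carrier (FB n)" using subgroup.subset[OF sg(1)] by simp
qed

lemma PB_EB:
  assumes "M \<in> above n"
  shows "PB n (EB n ` M) = M"
proof (rule additive_map.preimage_image[OF additive_EB aboveD(1)[OF assms]])
  show "x \<in> M" if "x \<in> carrier (FB n)" "EB n x = 0" for x
    using aboveD(4)[OF assms that(1)] that(2) vmodD(3)[OF vmod_CV] by simp
qed

lemma EB_PB: "M \<in> lower n \<Longrightarrow> EB n ` PB n M = M"
  by (rule additive_map.image_preimage[OF additive_EB]) (simp add: EB_image lower_def)

lemma EB_lower:
  assumes M: "M \<in> above n"
  shows "EB n ` M \<in> lower n"
proof -
  have sub: "EB n ` M \<subseteq> RV n" using aboveD(3)[OF M] EB_image by blast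
  have "scal r (EB n v) \<in> EB n ` M" if r: "r \<in> R" and v: "v \<in> M" for r v
  proof -
    obtain b where b: "b \<in> carrier B" "r = \<pi> b" using r pi_surj by blast
    have "v \<in> carrier (FB n)" using v aboveD(3)[OF M] by blast
    then have "scal r (EB n v) = EB n (b \<odot>\<^bsub>FB n\<^esub> v)" using EB_smult b by simp
    then show ?thesis using aboveD(2)[OF M b(1) v] by simp
  qed
  moreover have "CV n \<subseteq> EB n ` M"
  proof
    fix w assume w: "w \<in> CV n"
    then obtain v where "v \<in> carrier (FB n)" "w = EB n v" using CV_RV EB_image by blast
    then show "w \<in> EB n ` M" using aboveD(4)[OF M] w by blast
  qed
  ultimately show ?thesis
    unfolding lower_def vmod_def
    using sub vmodD(1)[OF vmod_RV] additive_map.add_closed_image_subgroup[OF additive_EB aboveD(1)[OF M]]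
    by blast
qed

lemma PB_above:
  assumes "M \<in> lower n"
  shows "PB n M \<in> above n"
proof -
  have v: "vmod n M" "CV n \<subseteq> M" using assms by (auto simp: lower_def)
  interpret F: module B "FB n" by (rule module_free_module[OF B.is_cring])
  have "b \<odot>\<^bsub>FB n\<^esub> x \<in> PB n M" if b: "b \<in> carrier B" and x: "x \<in> PB n M" for b x
  proof -
    have "\<pi> b \<in> R" using b pi_surj by blast
    then show ?thesis using b x vmodD(6)[OF v(1)] F.smult_closed by (simp add: PB_mem EB_smult)
  qed
  then show ?thesis
    unfolding submodules_above_def submodule_iff_subgroup conductor_lift_eq
    using additive_map.subgroup_preimage[OF additive_EB vmodD(2)[OF v(1)]] v(2) by (auto simp: PB_mem)
qed

text \<open>B acts on R^n through the surjection \<open>\<pi>\<close>, and the lift of the conductor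
  contains the kernel of B^n \<rightarrow> R^n. Hence the B-submodules above the lift are the
  preimages of the R-submodules between \<open>CV n\<close> and R^n.\<close>

lemma bij_betw_EB: "bij_betw (\<lambda>M. EB n ` M) (above n) (lower n)"
  by (rule bij_betw_byWitness[where f' = "PB n"])
    (auto simp: PB_EB EB_PB EB_lower PB_above simp del: image_iff)

lemma index_above:
  assumes M: "M \<in> above n"
  shows "CARD('f) ^ codim \<iota> (FB n) M * sz (EB n ` M) = sz (RV n)"
proof -
  interpret additive_map "FB n" "EB n" by (rule additive_EB)
  have "CARD('f) ^ codim \<iota> (FB n) M * card ((\<lambda>v. vt (EB n v)) ` M) = card ((\<lambda>v. vt (EB n v)) ` carrier (FB n))"
  proof (rule codim_index[OF module_free_module[OF B.is_cring] iota_hom aboveD(1)[OF M]])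
    show "\<iota> c \<odot>\<^bsub>FB n\<^esub> w \<in> M" if "w \<in> M" for c w
      by (rule aboveD(2)[OF M iota_closed that])
    show "vt (EB n (x \<oplus>\<^bsub>FB n\<^esub> y)) = vt (EB n x) + vt (EB n y)"
      if "x \<in> carrier (FB n)" "y \<in> carrier (FB n)" for x y
      using f_add[OF that] by (simp add: vt_add)
    show "x \<in> M" if x: "x \<in> carrier (FB n)" "vt (EB n x) = 0" for x
    proof -
      have "EB n x \<in> VV n" using x(1) EB_image vmodD(1)[OF vmod_RV] by blast
      then have "EB n x \<in> ZV n" using x(2) by (simp add: ZV_def)
      then show ?thesis using aboveD(4)[OF M x(1)] ZV_CV by blast
    qed
    show "finite ((\<lambda>v. vt (EB n v)) ` carrier (FB n))"
      using finite_vt[OF vmodD(1)[OF vmod_RV], of n] by (simp add: EB_image[symmetric] image_image)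
  qed
  then show ?thesis by (simp add: EB_image[symmetric] image_image)
qed

lemma generating_function_identity:
  fixes t :: "'k::field_char_0"
  assumes t: "t \<noteq> 0"
  shows "finite (standard_submodules R n)" "finite (above n)"
    "H_mot R n t = (t * of_nat CARD('f) ^ n) ^ (delta_invariant R * n) *
      H_inst \<iota> B (conductor_lift B \<pi> R n) n (1 / (t * of_nat CARD('f) ^ n))"
proof -
  let ?y = "1 / (t * of_nat CARD('f) ^ n)"
  show "finite (standard_submodules R n)"
    using bij_betw_finite[OF bij_betw_EO] finite_std by blast
  have "upper n \<subseteq> std n" using upper_std by blast
  then have "finite (lower n)"
    using finite_subset[OF _ finite_std] bij_betw_finite[OF bij_betw_ortho] by blast
  then show "finite (above n)" using bij_betw_finite[OF bij_betw_EB] by blast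
  \<comment> \<open>Writing M as \<open>PO n (EO n\<close>
    M)\<open>makes the exponent a function of the lattice\<close>EO n \<open>M\<close>, as needed
    for reindexing; \<open>H_inst\<close> is treated in the same way below.\<close>
  have "H_mot R n t = (\<Sum>M\<in>standard_submodules R n. t ^ codim fps_const (FO n) (PO n (EO n ` M)))"
    unfolding H_mot_def by (rule sum.cong) (simp_all add: PO_EO)
  also have "\<dots> = (\<Sum>M\<in>std n. t ^ codim fps_const (FO n) (PO n M))"
    by (rule sum.reindex_bij_betw[OF bij_betw_EO])
  also have "\<dots> = (t * of_nat CARD('f) ^ n) ^ (delta_invariant R * n) *
      (\<Sum>M\<in>lower n. ?y ^ codim \<iota> (FB n) (PB n M))"
  proof (rule duality_identity[OF t])
    show "CARD('f) ^ codim fps_const (FO n) (PO n M) * sz M = sz (VV n)" if "M \<in> std n" for M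
      using index_standard[OF PO_standard[OF that]] by (simp add: EO_PO[OF that])
    show "CARD('f) ^ codim \<iota> (FB n) (PB n M) * sz M = sz (RV n)" if "M \<in> lower n" for M
      using index_above[OF PB_above[OF that]] by (simp add: EB_PB[OF that])
  qed (rule index_RV)
  also have "(\<Sum>M\<in>lower n. ?y ^ codim \<iota> (FB n) (PB n M))
      = (\<Sum>M\<in>above n. ?y ^ codim \<iota> (FB n) (PB n (EB n ` M)))"
    by (rule sum.reindex_bij_betw[OF bij_betw_EB, symmetric])
  also have "\<dots> = H_inst \<iota> B (conductor_lift B \<pi> R n) n ?y"
    unfolding H_inst_def by (rule sum.cong) (simp_all add: PB_EB)
  finally show "H_mot R n t = (t * of_nat CARD('f) ^ n) ^ (delta_invariant R * n) *
      H_inst \<iota> B (conductor_lift B \<pi> R n) n ?y" .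
qed

end

theorem theorem5p3:
  fixes \<iota> :: "'f::{field,finite} \<Rightarrow> 'b" and B :: "'b ring"
    and R :: "'f fps set" and \<pi> :: "'b \<Rightarrow> 'f fps"
    and n :: nat and t :: "'k::field_char_0"
  assumes "isolated_singularity_ring \<iota> B"
    and "subcring R \<O>"
    and "gorenstein_local_ring (power_series_subring R)"
    and "has_fraction_field_laurent R"
    and "\<pi> \<in> ring_hom B (power_series_subring R)"
    and "\<pi> ` carrier B = R"
    and "\<And>c. \<pi> (\<iota> c) = fps_const c"
    and "n \<ge> 1"
    and "t \<noteq> 0"
  defines "q \<equiv> of_nat CARD('f) :: 'k"
    and "\<delta> \<equiv> delta_invariant R"
    and "C \<equiv> conductor_lift B \<pi> R n"
  shows "finite (standard_submodules R n) \<and> finite (submodules_above B n C) \<and>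
    H_mot R n t = q ^ (\<delta> * n\<^sup>2) * t ^ (\<delta> * n) * H_inst \<iota> B C n (1 / (t * q ^ n))"
proof -
  interpret P: complete_presentation \<iota> B R \<pi>
    using assms(1,5-7) by unfold_locales (auto simp: isolated_singularity_ring_def)
  obtain N where N: "N \<ge> 1" "\<And>f. (\<And>k. k < N \<Longrightarrow> f $ k = 0) \<Longrightarrow> f \<in> R"
    using P.large_power_series[OF assms(4)] by blast
  have im: "\<pi> x \<in> R" if "x \<in> carrier B" for x using that assms(6) by blast
  interpret L: large_subring R N
  proof
    fix a b assume "a \<in> R" "b \<in> R"
    then obtain x y where "x \<in> carrier B" "y \<in> carrier B" "a = \<pi> x" "b = \<pi> y" using assms(6) by blast
    then show "a - b \<in> R" "a * b \<in> R"
      using im[of "x \<ominus>\<^bsub>B\<^esub> y"] im[of "x \<otimes>\<^bsub>B\<^esub> y"] by (simp_all add: P.pi_minus P.pi_mult)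
  qed (use N im[OF P.iota_closed] im[OF P.B.one_closed] assms(7) in \<open>auto simp: P.pi_one\<close>)
  have "finite_injective_dimension (power_series_subring R) (self_module (power_series_subring R))"
    using assms(3) by (simp add: gorenstein_local_ring_def)
  from L.dualizing_functional[OF this] obtain \<theta> where "dualized_subring R N \<theta>" by blast
  then interpret D: dualized_subring R N \<theta> .
  interpret D: presented_subring R N \<theta> \<iota> B \<pi> ..
  have "(t * q ^ n) ^ (\<delta> * n) = q ^ (\<delta> * n\<^sup>2) * t ^ (\<delta> * n)"
    by (simp add: power_mult_distrib power2_eq_square mult_ac flip: power_mult)
  then show ?thesis
    using D.generating_function_identity[OF assms(9), of n] unfolding q_def \<delta>_def C_def by simp
qed

end
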